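(* Let $G$ be of type $B_n$ with $n\ge3$. For any $\gamma=a_1\alpha_1^\vee+\cdots+a_{n-1}\alpha_{n-1}^\vee+b\beta^\vee\in Q^\vee$, set $a_0=a_n:=0$. Then, for $2\le i\le n-1$, \begin{align*} \mathbf m_{w_{\epsilon_1+\epsilon_2}}^{w_\gamma}&=\tfrac12\|\gamma\|+\tfrac14\#\{1\le j\le n:a_{j-1}\not\equiv a_j\bmod2\}\\ \mathbf m_{w_{\epsilon_1+\epsilon_{i+1}}}^{w_\gamma}&=\|\gamma\|-\tfrac12a_i+\tfrac12\#\{i<j\le n:a_{j-1}\not\equiv a_j\bmod2\}\\ \mathbf m_{w_{\epsilon_1-\epsilon_n}}^{w_\gamma}&=\|\gamma\|-b\\ \mathbf m_{w_{\epsilon_1-\epsilon_i}}^{w_\gamma}&=\|\gamma\|-\tfrac12a_i-\tfrac12\#\{i<j\le n:a_{j-1}\not\equiv a_j\bmod2\}\\ \mathbf m_{w_{2\epsilon_2}}^{w_\gamma}&=\tfrac12\|\gamma\|-\tfrac14\#\{1\le j\le n:a_{j-1}\not\equiv a_j\bmod2\}\\ \mathbf m_{w_{\epsilon_2+\epsilon_3}}^{w_\gamma}&=\tfrac12\|\gamma\|-\Big\lceil\frac{a_1}2\Big\rceil+\tfrac14\#\{1\le j\le n:a_{j-1}\not\equiv a_j\bmod2\}\\ \mathbf m_{w_{-\epsilon_1+\epsilon_2}}^{w_\gamma}&=\tfrac12\|\gamma\|-\Big\lfloor\frac{a_1}2\Big\rfloor-\tfrac14\#\{1\le j\le n:a_{j-1}\not\equiv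 a_j\bmod2\}. \end{align*}
   Context: $Q^\vee$ is the coroot lattice of $G$, with simple coroots $\alpha_i^\vee=\epsilon_i-\epsilon_{i+1}$ ($1\le i\le n-1$) and $\beta^\vee=2\epsilon_n$ in $\mathbb R^n$ with standard basis $\epsilon_1,\dots,\epsilon_n$; $W$ is the Weyl group (signed permutations), $\widehat W=Q^\vee\rtimes W$ the affine Weyl group with simple reflections the finite ones and $s_0=t_{\theta^\vee}s_{\theta^\vee}$, $\theta^\vee=\epsilon_1+\epsilon_2$; $\epsilon(\cdot)$ denotes the sign character of $\widehat W$. $w_\gamma$ is the shortest element of the coset $t_\gamma W$. $\|\gamma\|=a_1^2+\cdots+a_{n-1}^2+2b^2-(a_1a_2+\cdots+a_{n-2}a_{n-1}+2a_{n-1}b)$ is the square length normalized so that short coroots have length $1$. The integers $\mathbf m_v^w$ are values at $q=1$ of inverse Kazhdan–Lusztig polynomials of $\widehat W$: with $C_v=\sum_{w\preccurlyeq v}P_{w,v}(1)w\in\mathbb Z[\widehat W]$ ($P_{w,v}$ the Kazhdan–Lusztig polynomials), $w=\sum_{v\preccurlyeq w}\epsilon(wv^{-1})\mathbf m_v^wC_v$.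
   Formalization: The fifth formula is stated and proved for the lower index w_{2ε_1} instead of the printed w_{2ε_2}, for which it is false: at γ=2ε_1 the right side is 1, but w_{2ε_2} is longer than w_{2ε_1}, so the coefficient is 0. *)

theory Defs
  imports
    "HOL-Algebra.Coset"
    "HOL-Combinatorics.Permutations"
    "HOL-Computational_Algebra.Polynomial"
    "HOL-Library.Poly_Mapping"
    "HOL-Library.Function_Algebras"
    Complex_Main
begin

section \<open>Coxeter groups and their Bruhat order\<close>

text \<open>
  All notions below are taken relative to a group \<open>G\<close> with a set \<open>S\<close> of generators; they have their
  usual meaning when \<open>(G, S)\<close> is a Coxeter system.
\<close>

definition word_prod :: "('g, 'm) monoid_scheme \<Rightarrow> 'g list \<Rightarrow> 'g" where
  "word_prod G ws = foldr (\<lambda>x y. x \<otimes>\<^bsub>G\<^esub> y) ws \<one>\<^bsub>G\<^esub>"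

definition cox_length :: "('g, 'm) monoid_scheme \<Rightarrow> 'g set \<Rightarrow> 'g \<Rightarrow> nat" where
  "cox_length G S w = (LEAST k. \<exists>ws\<in>lists S. length ws = k \<and> word_prod G ws = w)"

definition reduced_word :: "('g, 'm) monoid_scheme \<Rightarrow> 'g set \<Rightarrow> 'g \<Rightarrow> 'g list" where
  "reduced_word G S w =
     (SOME ws. ws \<in> lists S \<and> length ws = cox_length G S w \<and> word_prod G ws = w)"

definition cox_sign :: "('g, 'm) monoid_scheme \<Rightarrow> 'g set \<Rightarrow> 'g \<Rightarrow> int" where
  "cox_sign G S w = (- 1) ^ cox_length G S w"

definition cox_reflections :: "('g, 'm) monoid_scheme \<Rightarrow> 'g set \<Rightarrow> 'g set" where
  "cox_reflections G S = {g \<otimes>\<^bsub>G\<^esub> s \<otimes>\<^bsub>G\<^esub> inv\<^bsub>G\<^esub> g | g s. g \<in> carrier G \<and> s \<in> S}"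

definition bruhat_le :: "('g, 'm) monoid_scheme \<Rightarrow> 'g set \<Rightarrow> 'g \<Rightarrow> 'g \<Rightarrow> bool" where
  "bruhat_le G S =
     (\<lambda>x y. x \<in> carrier G \<and> (\<exists>t\<in>cox_reflections G S. y = x \<otimes>\<^bsub>G\<^esub> t)
            \<and> cox_length G S x < cox_length G S y)\<^sup>*\<^sup>*"


section \<open>The Hecke algebra\<close>

text \<open>
  \<open>laurent\<close> is the ring \<open>\<int>[v, v\<^sup>-\<^sup>1]\<close> with \<open>v = q\<^sup>1\<^sup>/\<^sup>2\<close>, realised as the group ring of the integers:
  multiplication of finitely supported functions is convolution.  Elements of the Hecke algebra are
  finite \<open>laurent\<close>-combinations of the standard basis \<open>T\<^sub>w\<close>.
\<close>

type_synonym laurent = "int \<Rightarrow>\<^sub>0 int"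
type_synonym 'g hecke = "'g \<Rightarrow>\<^sub>0 laurent"

definition vpow :: "int \<Rightarrow> laurent" where
  "vpow k = Poly_Mapping.single k 1"

abbreviation hecke_q :: laurent where
  "hecke_q \<equiv> vpow 2"

definition laurent_bar :: "laurent \<Rightarrow> laurent" where
  "laurent_bar p = Poly_Mapping.map_key uminus p"

definition laurent_of_poly :: "int poly \<Rightarrow> laurent" where
  "laurent_of_poly p = (\<Sum>i\<le>degree p. Poly_Mapping.single (2 * int i) (coeff p i))"

definition pm_scale :: "'r::mult_zero \<Rightarrow> ('g \<Rightarrow>\<^sub>0 'r) \<Rightarrow> ('g \<Rightarrow>\<^sub>0 'r)" where
  "pm_scale c h = Poly_Mapping.map (\<lambda>d. c * d) h"

definition hecke_T :: "'g \<Rightarrow> 'g hecke" where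
  "hecke_T w = Poly_Mapping.single w 1"

text \<open>
  Left multiplication by \<open>T\<^sub>s\<close> for \<open>s \<in> S\<close>: \<open>T\<^sub>s T\<^sub>w\<close> is \<open>T\<^sub>s\<^sub>w\<close> if \<open>sw\<close> is longer than \<open>w\<close>, and
  \<open>(q - 1) T\<^sub>w + q T\<^sub>s\<^sub>w\<close> otherwise.
\<close>

definition hecke_gen :: "('g, 'm) monoid_scheme \<Rightarrow> 'g set \<Rightarrow> 'g \<Rightarrow> 'g hecke \<Rightarrow> 'g hecke" where
  "hecke_gen G S s h =
     (\<Sum>w\<in>Poly_Mapping.keys h. pm_scale (Poly_Mapping.lookup h w)
        (if cox_length G S w < cox_length G S (s \<otimes>\<^bsub>G\<^esub> w)
         then hecke_T (s \<otimes>\<^bsub>G\<^esub> w)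
         else pm_scale (hecke_q - 1) (hecke_T w) + pm_scale hecke_q (hecke_T (s \<otimes>\<^bsub>G\<^esub> w))))"

text \<open>
  For a reduced word \<open>x = s\<^sub>1 \<dots> s\<^sub>k\<close> one has \<open>T\<^sub>x = T\<^sub>s\<^sub>1 \<dots> T\<^sub>s\<^sub>k\<close>; the product does not depend on the
  reduced word chosen.
\<close>

definition hecke_mult ::
  "('g, 'm) monoid_scheme \<Rightarrow> 'g set \<Rightarrow> 'g hecke \<Rightarrow> 'g hecke \<Rightarrow> 'g hecke" where
  "hecke_mult G S a b =
     (\<Sum>x\<in>Poly_Mapping.keys a. pm_scale (Poly_Mapping.lookup a x)
        (foldr (hecke_gen G S) (reduced_word G S x) b))"

definition hecke_T_inv :: "('g, 'm) monoid_scheme \<Rightarrow> 'g set \<Rightarrow> 'g \<Rightarrow> 'g hecke" where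
  "hecke_T_inv G S x =
     (THE h. Poly_Mapping.keys h \<subseteq> carrier G
             \<and> hecke_mult G S (hecke_T x) h = hecke_T \<one>\<^bsub>G\<^esub>
             \<and> hecke_mult G S h (hecke_T x) = hecke_T \<one>\<^bsub>G\<^esub>)"

text \<open>The bar involution: \<open>v \<mapsto> v\<^sup>-\<^sup>1\<close> on coefficients, and \<open>T\<^sub>x\<close> goes to the inverse of the basis
  element attached to \<open>x\<^sup>-\<^sup>1\<close>.\<close>

definition hecke_bar :: "('g, 'm) monoid_scheme \<Rightarrow> 'g set \<Rightarrow> 'g hecke \<Rightarrow> 'g hecke" where
  "hecke_bar G S h =
     (\<Sum>x\<in>Poly_Mapping.keys h. pm_scale (laurent_bar (Poly_Mapping.lookup h x))
        (hecke_T_inv G S (inv\<^bsub>G\<^esub> x)))"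


section \<open>Kazhdan--Lusztig polynomials and their inverses at \<open>q = 1\<close>\<close>

definition KL_element ::
  "('g, 'm) monoid_scheme \<Rightarrow> 'g set \<Rightarrow> 'g \<Rightarrow> ('g \<Rightarrow> int poly) \<Rightarrow> 'g hecke" where
  "KL_element G S w P =
     (\<Sum>y\<in>{y. bruhat_le G S y w}.
        pm_scale (vpow (- int (cox_length G S w)) * laurent_of_poly (P y)) (hecke_T y))"

text \<open>
  The polynomials \<open>P\<^bsub>y,w\<^esub>\<close> are determined by \<open>P\<^bsub>w,w\<^esub> = 1\<close>, by \<open>deg P\<^bsub>y,w\<^esub> \<le> (\<ell>(w) - \<ell>(y) - 1) / 2\<close>
  for \<open>y \<prec> w\<close> and by the invariance of \<open>q\<^bsup>- \<ell>(w)/2\<^esup> \<Sum>\<^bsub>y \<preceq> w\<^esub> P\<^bsub>y,w\<^esub> T\<^sub>y\<close> under the bar involution; they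
  vanish unless \<open>y \<preceq> w\<close>.
\<close>

definition is_KL_family ::
  "('g, 'm) monoid_scheme \<Rightarrow> 'g set \<Rightarrow> 'g \<Rightarrow> ('g \<Rightarrow> int poly) \<Rightarrow> bool" where
  "is_KL_family G S w P \<longleftrightarrow>
     (\<forall>y. \<not> bruhat_le G S y w \<longrightarrow> P y = 0)
     \<and> P w = 1
     \<and> (\<forall>y. bruhat_le G S y w \<and> y \<noteq> w \<longrightarrow>
           2 * degree (P y) + cox_length G S y + 1 \<le> cox_length G S w)
     \<and> hecke_bar G S (KL_element G S w P) = KL_element G S w P"

definition KL_poly :: "('g, 'm) monoid_scheme \<Rightarrow> 'g set \<Rightarrow> 'g \<Rightarrow> 'g \<Rightarrow> int poly" where
  "KL_poly G S y w = (THE P. is_KL_family G S w P) y"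

text \<open>The element \<open>C\<^sub>w\<close> of the integral group ring, whose elements are finitely supported functions.\<close>

definition KL_C :: "('g, 'm) monoid_scheme \<Rightarrow> 'g set \<Rightarrow> 'g \<Rightarrow> ('g \<Rightarrow>\<^sub>0 int)" where
  "KL_C G S w = (\<Sum>y\<in>{y. bruhat_le G S y w}. Poly_Mapping.single y (poly (KL_poly G S y w) 1))"

text \<open>
  \<open>inv_KL G S v w\<close> is the integer with lower index \<open>v\<close> and upper index \<open>w\<close>; it is \<open>0\<close> unless
  \<open>v \<preceq> w\<close>.
\<close>

definition inv_KL :: "('g, 'm) monoid_scheme \<Rightarrow> 'g set \<Rightarrow> 'g \<Rightarrow> 'g \<Rightarrow> int" where
  "inv_KL G S v w =
     (THE m. (\<forall>u. \<not> bruhat_le G S u w \<longrightarrow> m u = 0)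
             \<and> Poly_Mapping.single w 1 =
                 (\<Sum>u\<in>{u. bruhat_le G S u w}.
                    pm_scale (cox_sign G S (w \<otimes>\<^bsub>G\<^esub> inv\<^bsub>G\<^esub> u) * m u) (KL_C G S u))) v"


section \<open>The affine Weyl group of type \<open>B\<^sub>n\<close>\<close>

text \<open>
  The coroot lattice consists of integer vectors, so vectors of \<open>\<real>\<^sup>n\<close> are only needed with integer
  coordinates: they are functions \<open>nat \<Rightarrow> int\<close> supported in \<open>{1..n}\<close>.
\<close>

type_synonym vec = "nat \<Rightarrow> int"

definition eps :: "nat \<Rightarrow> vec" where
  "eps i = (\<lambda>k. if k = i then 1 else 0)"

definition zscale :: "int \<Rightarrow> vec \<Rightarrow> vec" where
  "zscale c x = (\<lambda>k. c * x k)"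

definition alpha :: "nat \<Rightarrow> vec" where
  "alpha i = eps i - eps (i + 1)"

definition beta :: "nat \<Rightarrow> vec" where
  "beta n = zscale 2 (eps n)"

definition theta :: vec where
  "theta = eps 1 + eps 2"

definition lattice_elt :: "nat \<Rightarrow> (nat \<Rightarrow> int) \<Rightarrow> int \<Rightarrow> vec" where
  "lattice_elt n a b = (\<Sum>i=1..n-1. zscale (a i) (alpha i)) + zscale b (beta n)"

definition coroot_lattice :: "nat \<Rightarrow> vec set" where
  "coroot_lattice n = {lattice_elt n a b | a b. True}"

definition square_length :: "nat \<Rightarrow> (nat \<Rightarrow> int) \<Rightarrow> int \<Rightarrow> int" where
  "square_length n a b =
     (\<Sum>i=1..n-1. (a i)\<^sup>2) + 2 * b\<^sup>2 - ((\<Sum>i=1..n-2. a i * a (i + 1)) + 2 * a (n - 1) * b)"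

text \<open>The Weyl group: signed permutations of the coordinates \<open>1, \<dots>, n\<close>, as linear maps.\<close>

definition weyl :: "nat \<Rightarrow> (vec \<Rightarrow> vec) set" where
  "weyl n = {\<lambda>x k. s k * x (p k) | s p.
     p permutes {1..n} \<and> (\<forall>k\<in>{1..n}. s k \<in> {1, - 1}) \<and> (\<forall>k. k \<notin> {1..n} \<longrightarrow> s k = 1)}"

text \<open>The pair \<open>(\<gamma>, w)\<close> stands for \<open>t\<^sub>\<gamma> w\<close>.\<close>

definition affine_weyl :: "nat \<Rightarrow> (vec \<times> (vec \<Rightarrow> vec)) monoid" where
  "affine_weyl n =
     \<lparr>carrier = coroot_lattice n \<times> weyl n,
      monoid.mult = (\<lambda>(\<gamma>, w) (\<delta>, u). (\<gamma> + w \<delta>, w \<circ> u)),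
      one = (0, id)\<rparr>"

definition transl :: "vec \<Rightarrow> vec \<times> (vec \<Rightarrow> vec)" where
  "transl \<gamma> = (\<gamma>, id)"

definition dot :: "nat \<Rightarrow> vec \<Rightarrow> vec \<Rightarrow> int" where
  "dot n x y = (\<Sum>k=1..n. x k * y k)"

text \<open>The reflection in the coroot \<open>c\<close>; for coroots \<open>\<plusminus>\<epsilon>\<^sub>i \<plusminus> \<epsilon>\<^sub>j\<close> and \<open>\<plusminus>2\<epsilon>\<^sub>i\<close> the division is exact.\<close>

definition coroot_reflection :: "nat \<Rightarrow> vec \<Rightarrow> vec \<Rightarrow> vec" where
  "coroot_reflection n c x = x - zscale (2 * dot n x c div dot n c c) c"

definition simple_reflections :: "nat \<Rightarrow> (vec \<times> (vec \<Rightarrow> vec)) set" where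
  "simple_reflections n =
     {(0, coroot_reflection n (alpha i)) | i. 1 \<le> i \<and> i \<le> n - 1}
     \<union> {(0, coroot_reflection n (beta n)),
        transl theta \<otimes>\<^bsub>affine_weyl n\<^esub> (0, coroot_reflection n theta)}"

definition min_rep :: "nat \<Rightarrow> vec \<Rightarrow> vec \<times> (vec \<Rightarrow> vec)" where
  "min_rep n \<gamma> =
     arg_min (cox_length (affine_weyl n) (simple_reflections n))
       (\<lambda>u. u \<in> transl \<gamma> <#\<^bsub>affine_weyl n\<^esub> ({0} \<times> weyl n))"

definition m_coeff :: "nat \<Rightarrow> vec \<Rightarrow> vec \<Rightarrow> int" where
  "m_coeff n \<delta> \<gamma> = inv_KL (affine_weyl n) (simple_reflections n) (min_rep n \<delta>) (min_rep n \<gamma>)"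

text \<open>
  A pitfall in the choice of lower index: the representative of \<open>2\<epsilon>\<^sub>2\<close> is \<open>s\<close> times that of \<open>2\<epsilon>\<^sub>1\<close>,
  with \<open>s\<close> the reflection in \<open>\<alpha>\<^sub>1\<close>, and is the longer of the two (lengths \<open>2n\<close> and \<open>2n - 1\<close>).  So
  \<open>m_coeff n (zscale 2 (eps 2)) \<gamma>\<close> is \<open>0\<close> at \<open>\<gamma> = 2\<epsilon>\<^sub>1\<close>, where half the square length minus a quarter
  of the number of parity changes is \<open>1\<close>; it is \<open>2\<epsilon>\<^sub>1\<close>, not \<open>2\<epsilon>\<^sub>2\<close>, that belongs to this expression.
\<close>

text \<open>
  The number of \<open>j\<close> with \<open>l \<le> j \<le> n\<close> for which \<open>a\<^bsub>j-1\<^esub>\<close> and \<open>a\<^sub>j\<close> have different parity.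
\<close>

definition parity_changes :: "nat \<Rightarrow> (nat \<Rightarrow> int) \<Rightarrow> nat \<Rightarrow> nat" where
  "parity_changes n a l = card {j. l \<le> j \<and> j \<le> n \<and> a (j - 1) mod 2 \<noteq> a j mod 2}"

end

theory Submission
  imports Defs
begin

text \<open>
  The affine Weyl group acts on the quotient of the antispherical module by the span of
  all \<open>C\<^sub>w\<close> except \<open>C\<^sub>1\<close> and those for which \<open>w\<close> has a unique reduced expression ending in \<open>s\<^sub>0\<close>.
  These exceptional \<open>w\<close> form a tree with \<open>2n + 2\<close> vertices (the root is the identity), the \<open>C\<^sub>w\<close> are a
  basis of the quotient, and a simple reflection acts on it through the adjacency of the tree.  Hence
  the multiplicity of lower index \<open>v\<close> and upper index \<open>w\<close> is, up to sign, the coordinate at \<open>v\<close> of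
  \<open>w\<close> applied to \<open>C\<^sub>1\<close>; it depends only on the coset \<open>w W = t\<^sub>\<gamma> W\<close>, and as a function of \<open>\<gamma>\<close> it is
  determined by its value at \<open>0\<close> and the reflection rule \<open>m\<^sub>v(s \<gamma>) + m\<^sub>v(\<gamma>) = \<Sum> m\<^sub>u(\<gamma>)\<close> over the
  neighbours \<open>u\<close> of \<open>v\<close>, if \<open>s\<close> is the label of \<open>v\<close>, and \<open>m\<^sub>v(s \<gamma>) = m\<^sub>v(\<gamma>)\<close> otherwise.  In terms of the
  coordinates \<open>x\<^sub>j\<close> of \<open>\<gamma>\<close> the stated formulas are sums over \<open>j\<close> of quadratic functions of \<open>x\<^sub>j\<close>
  corrected by the parity of \<open>x\<^sub>j\<close>, and satisfy this rule.
\<close>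

text \<open>No matrix is inverted in closed form: \<open>phi z\<close>, extended linearly, is a
  functional on the group ring with value 1 at the Kazhdan-Lusztig element of \<open>el z\<close>
  and 0 at all others, so applying it to the defining expansion of w isolates one coefficient. This
  duality is proved by induction on length from C_s C_v = C_sv + sum of mu(x,v) C_x. The obstacle is
  a tree element x = \<open>el y\<close> occurring with nonzero mu for some v off the tree. A tree
  element other than 1 has a single left descent, which forces v = t x for a simple reflection t; a
  commutation or braid relation then makes s v shorter than v. The action needs just q = 1, but mu
  is a coefficient of a polynomial and is lost there, so the whole Hecke algebra enters. The objects
  are given by definite descriptions, hence existence and uniqueness of the Kazhdan-Lusztig basis
  have to be established, in a group for which no presentation is at hand. The closed formulas
  contain quarters, so everything is multiplied by 4; divisibility by 4 comes from the even
  coordinate sum of lattice vectors.\<close>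

declare in_lists_conv_set [simp]

section \<open>Coxeter groups given by half-spaces\<close>

text \<open>
  The axioms on \<open>P s\<close>, the set of elements lying on the positive side of the wall of \<open>s\<close>, are those of
  Bourbaki, \<^emph>\<open>Lie Groups\<close> IV.1.7; they replace a presentation of the group.
\<close>

locale halfspace_group = group G for G (structure) +
  fixes S :: "'a set" and P :: "'a \<Rightarrow> 'a set"
  assumes S_carrier: "S \<subseteq> carrier G"
    and S_finite: "finite S"
    and S_invol: "s \<in> S \<Longrightarrow> s \<otimes> s = \<one>"
    and S_generates: "x \<in> carrier G \<Longrightarrow> \<exists>ws\<in>lists S. word_prod G ws = x"
    and P_one: "s \<in> S \<Longrightarrow> \<one> \<in> P s"
    and P_flip: "s \<in> S \<Longrightarrow> x \<in> carrier G \<Longrightarrow> s \<otimes> x \<in> P s \<longleftrightarrow> x \<notin> P s"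
    and P_wall: "s \<in> S \<Longrightarrow> t \<in> S \<Longrightarrow> x \<in> carrier G \<Longrightarrow> x \<in> P s \<Longrightarrow> x \<otimes> t \<notin> P s \<Longrightarrow> s \<otimes> x = x \<otimes> t"
begin

abbreviation len :: "'a \<Rightarrow> nat" where "len \<equiv> cox_length G S"
abbreviation wp :: "'a list \<Rightarrow> 'a" where "wp \<equiv> word_prod G"
abbreviation ble :: "'a \<Rightarrow> 'a \<Rightarrow> bool" where "ble \<equiv> bruhat_le G S"

lemma S_mem [simp]: "s \<in> S \<Longrightarrow> s \<in> carrier G"
  using S_carrier by auto

lemma S_inv [simp]: "s \<in> S \<Longrightarrow> inv s = s"
  using S_invol by (metis S_mem inv_equality)

lemma S_cancel [simp]: "s \<in> S \<Longrightarrow> x \<in> carrier G \<Longrightarrow> s \<otimes> (s \<otimes> x) = x"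
  using S_invol by (metis S_mem l_one m_assoc)

lemma S_cancel_right [simp]: "s \<in> S \<Longrightarrow> x \<in> carrier G \<Longrightarrow> x \<otimes> s \<otimes> s = x"
  using S_invol by (metis S_mem m_assoc r_one)

lemma inv_cancel [simp]:
  "x \<in> carrier G \<Longrightarrow> y \<in> carrier G \<Longrightarrow> inv x \<otimes> (x \<otimes> y) = y"
  "x \<in> carrier G \<Longrightarrow> y \<in> carrier G \<Longrightarrow> x \<otimes> (inv x \<otimes> y) = y"
  by (simp_all add: m_assoc[symmetric])

section \<open>Words and the length function\<close>

lemma wp_Nil [simp]: "wp [] = \<one>"
  and wp_Cons [simp]: "wp (x # xs) = x \<otimes> wp xs"
  by (simp_all add: word_prod_def)

lemma wp_closed [simp]: "ws \<in> lists S \<Longrightarrow> wp ws \<in> carrier G"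
  by (induction ws) auto

lemma wp_append [simp]: "us \<in> lists S \<Longrightarrow> vs \<in> lists S \<Longrightarrow> wp (us @ vs) = wp us \<otimes> wp vs"
  by (induction us) (auto simp: m_assoc)

lemma wp_rev: "ws \<in> lists S \<Longrightarrow> wp (rev ws) = inv (wp ws)"
  by (induction ws) (auto simp: inv_mult_group)

lemma len_attained:
  assumes "x \<in> carrier G"
  shows "\<exists>ws\<in>lists S. length ws = len x \<and> wp ws = x"
  using S_generates[OF assms]
  unfolding cox_length_def by (intro LeastI_ex[of "\<lambda>k. \<exists>ws\<in>lists S. length ws = k \<and> wp ws = x"]) auto

lemma len_le: "ws \<in> lists S \<Longrightarrow> len (wp ws) \<le> length ws"
  unfolding cox_length_def by (rule Least_le) auto

lemma len_one [simp]: "len \<one> = 0"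
  using len_le[of "[]"] by simp

lemma len_eq_0_iff [simp]: "x \<in> carrier G \<Longrightarrow> len x = 0 \<longleftrightarrow> x = \<one>"
  using len_attained[of x] by auto

lemma len_inv_le: "x \<in> carrier G \<Longrightarrow> len (inv x) \<le> len x"
proof -
  assume "x \<in> carrier G"
  then obtain ws where ws: "ws \<in> lists S" "length ws = len x" "wp ws = x" using len_attained by blast
  then show ?thesis using len_le[of "rev ws"] wp_rev[of ws] by auto
qed

lemma len_inv [simp]: "x \<in> carrier G \<Longrightarrow> len (inv x) = len x"
  using len_inv_le[of x] len_inv_le[of "inv x"] by simp

lemma len_mult_le:
  assumes "x \<in> carrier G" "y \<in> carrier G"
  shows "len (x \<otimes> y) \<le> len x + len y"
proof -
  obtain us vs where "us \<in> lists S" "length us = len x" "wp us = x" "vs \<in> lists S" "length vs = len y" "wp vs = y"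
    using assms len_attained by meson
  then show ?thesis using len_le[of "us @ vs"] by auto
qed

lemma len_S_le: "s \<in> S \<Longrightarrow> len s \<le> 1"
  using len_le[of "[s]"] by simp

text \<open>A gallery that ends on the other side of the wall of a reflection crosses that wall somewhere.\<close>

lemma wall_crossing:
  assumes g: "g \<in> carrier G" and s: "s \<in> S" and ws: "ws \<in> lists S"
    and cross: "(inv g \<in> P s) \<noteq> (inv g \<otimes> wp ws \<in> P s)"
  shows "\<exists>us u vs. ws = us @ u # vs \<and> g \<otimes> s \<otimes> inv g \<otimes> wp ws = wp (us @ vs)"
  using ws cross
proof (induction ws rule: rev_induct)
  case Nil
  then show ?case using g by simp
next
  case (snoc t ws)
  then have t: "t \<in> S" and ws: "ws \<in> lists S" by auto
  let ?r = "g \<otimes> s \<otimes> inv g" and ?x = "inv g \<otimes> wp ws"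
  have c: "?r \<in> carrier G" "wp ws \<in> carrier G" "?x \<in> carrier G" using g s t ws by auto
  have w: "wp (ws @ [t]) = wp ws \<otimes> t" using t ws by simp
  show ?case
  proof (cases "(inv g \<in> P s) = (?x \<in> P s)")
    case False
    then obtain us u vs where d: "ws = us @ u # vs" "?r \<otimes> wp ws = wp (us @ vs)"
      using snoc.IH[OF ws] by auto
    have "?r \<otimes> wp (ws @ [t]) = wp (us @ vs) \<otimes> t"
      using c t d(2) by (metis S_mem m_assoc w)
    also have "\<dots> = wp (us @ (vs @ [t]))"
      using d(1) ws t by (simp add: m_assoc)
    finally show ?thesis using d(1) by (metis append.assoc append_Cons)
  next
    case True
    then have "(?x \<in> P s) \<noteq> (?x \<otimes> t \<in> P s)"
      using snoc.prems(2) w g c t by (simp add: m_assoc)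
    moreover have "s \<otimes> ?x = ?x \<otimes> t" if "?x \<in> P s" "?x \<otimes> t \<notin> P s"
      using P_wall that s t c by blast
    moreover have "s \<otimes> ?x = ?x \<otimes> t" if "?x \<notin> P s" "?x \<otimes> t \<in> P s"
      using P_wall[OF s t, of "?x \<otimes> t"] that s t c
      by (metis S_cancel S_cancel_right S_mem m_closed)
    ultimately have e: "s \<otimes> ?x = ?x \<otimes> t" by blast
    have "?r \<otimes> wp ws = g \<otimes> (s \<otimes> ?x)" using g s c by (simp add: m_assoc)
    also have "\<dots> = g \<otimes> (?x \<otimes> t)" by (simp only: e)
    also have "\<dots> = wp ws \<otimes> t" using g t c by (simp add: m_assoc[symmetric])
    \<comment> \<open>The reflection moves the chamber of \<open>wp ws\<close> across the wall to
      \<open>wp ws \<otimes> t\<close>, so applied after the letter \<open>t\<close> it cancels that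
      letter.\<close>
    finally have "?r \<otimes> (wp ws \<otimes> t) = wp ws" using t c by (metis S_cancel_right S_mem m_assoc)
    then show ?thesis using w by (intro exI[of _ ws] exI[of _ t] exI[of _ "[]"]) simp
  qed
qed

section \<open>Reflections, exchange and descents\<close>

definition refls :: "'a set" where "refls = cox_reflections G S"

lemma refls_carrier [simp]: "r \<in> refls \<Longrightarrow> r \<in> carrier G"
  unfolding refls_def cox_reflections_def by auto

lemma S_refls: "s \<in> S \<Longrightarrow> s \<in> refls"
  unfolding refls_def cox_reflections_def
  by (auto intro!: exI[of _ \<one>] exI[of _ s])

lemma refls_conj: "r \<in> refls \<Longrightarrow> x \<in> carrier G \<Longrightarrow> x \<otimes> r \<otimes> inv x \<in> refls"
  unfolding refls_def cox_reflections_def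
proof clarify
  fix g s assume "x \<in> carrier G" "g \<in> carrier G" "s \<in> S"
  then show "\<exists>ga sa. x \<otimes> (g \<otimes> s \<otimes> inv g) \<otimes> inv x = ga \<otimes> sa \<otimes> inv ga \<and> ga \<in> carrier G \<and> sa \<in> S"
    by (intro exI[of _ "x \<otimes> g"] exI[of _ s]) (simp add: m_assoc inv_mult_group)
qed

lemma refls_invol: "r \<in> refls \<Longrightarrow> r \<otimes> r = \<one>"
  unfolding refls_def cox_reflections_def by (auto simp: m_assoc)

lemma refls_cancel [simp]: "r \<in> refls \<Longrightarrow> x \<in> carrier G \<Longrightarrow> r \<otimes> (r \<otimes> x) = x"
  using refls_invol by (metis l_one m_assoc refls_carrier)

text \<open>The wall of \<open>r = g \<otimes> s \<otimes> inv g\<close> is the wall of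
  \<open>s\<close> moved by \<open>g\<close>, so 1 and \<open>x\<close> lie on the same side of it
  iff \<open>inv g\<close> and \<open>inv g \<otimes> x\<close> lie on the same side of the wall of
  \<open>s\<close>. If they are separated, every word for \<open>x\<close> crosses the wall and
  loses a letter. If not, then 1 and \<open>r \<otimes> x\<close> are separated, and the same
  argument shortens \<open>r \<otimes> x\<close> to \<open>x\<close>.\<close>

lemma strong_exchange_or:
  assumes r: "r \<in> refls" and x: "x \<in> carrier G"
  shows "len (r \<otimes> x) < len x \<and>
          (\<forall>ws\<in>lists S. wp ws = x \<longrightarrow> (\<exists>us u vs. ws = us @ u # vs \<and> r \<otimes> x = wp (us @ vs)))
       \<or> len x < len (r \<otimes> x)"
proof -
  obtain g s where gs: "g \<in> carrier G" "s \<in> S" and r_def: "r = g \<otimes> s \<otimes> inv g"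
    using r unfolding refls_def cox_reflections_def by auto
  have drop: "\<exists>us u vs. ws = us @ u # vs \<and> r \<otimes> y = wp (us @ vs)"
    if "(inv g \<in> P s) \<noteq> (inv g \<otimes> y \<in> P s)" "ws \<in> lists S" "wp ws = y" for y ws
    using wall_crossing[OF gs that(2)] that r_def by auto
  have short: "len (r \<otimes> y) < len y"
    if y: "y \<in> carrier G" and c: "(inv g \<in> P s) \<noteq> (inv g \<otimes> y \<in> P s)" for y
  proof -
    obtain ws where ws: "ws \<in> lists S" "length ws = len y" "wp ws = y" using y len_attained by blast
    obtain us u vs where d: "ws = us @ u # vs" "r \<otimes> y = wp (us @ vs)"
      using drop[OF c ws(1,3)] by blast
    have "len (wp (us @ vs)) \<le> length (us @ vs)" using d ws by (intro len_le) auto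
    with d ws show ?thesis by simp
  qed
  show ?thesis
  proof (cases "(inv g \<in> P s) = (inv g \<otimes> x \<in> P s)")
    case False
    then show ?thesis using short[OF x] drop[of x] by blast
  next
    case True
    have "inv g \<otimes> (r \<otimes> x) = s \<otimes> (inv g \<otimes> x)"
      using gs x r_def by (simp add: m_assoc[symmetric])
    then have "(inv g \<in> P s) \<noteq> (inv g \<otimes> (r \<otimes> x) \<in> P s)"
      using True P_flip[of s "inv g \<otimes> x"] gs x by simp
    then have "len (r \<otimes> (r \<otimes> x)) < len (r \<otimes> x)"
      using short[of "r \<otimes> x"] r x by simp
    then show ?thesis using r x by simp
  qed
qed

lemma strong_exchange:
  assumes "r \<in> refls" "ws \<in> lists S" "len (r \<otimes> wp ws) \<le> len (wp ws)"
  shows "\<exists>us u vs. ws = us @ u # vs \<and> r \<otimes> wp ws = wp (us @ vs)"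
  using strong_exchange_or[OF assms(1), of "wp ws"] assms(2,3) by auto

lemma len_refl_neq: "r \<in> refls \<Longrightarrow> x \<in> carrier G \<Longrightarrow> len (r \<otimes> x) \<noteq> len x"
  using strong_exchange_or by (metis less_irrefl)

lemma len_S_cases:
  assumes "s \<in> S" "x \<in> carrier G"
  shows "len (s \<otimes> x) = Suc (len x) \<or> len x = Suc (len (s \<otimes> x))"
proof -
  have "len (s \<otimes> x) \<noteq> len x" using len_refl_neq S_refls assms by blast
  moreover have "len (s \<otimes> x) \<le> len x + 1" using len_mult_le[of s x] len_S_le assms by fastforce
  moreover have "len x \<le> len (s \<otimes> x) + 1"
    using len_mult_le[of s "s \<otimes> x"] len_S_le[of s] assms by simp
  ultimately show ?thesis by linarith
qed

lemma len_S_right_cases: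
  assumes "s \<in> S" "x \<in> carrier G"
  shows "len (x \<otimes> s) = Suc (len x) \<or> len x = Suc (len (x \<otimes> s))"
  using len_S_cases[of s "inv x"] len_inv[of "x \<otimes> s"] assms by (simp add: inv_mult_group)

text \<open>The case \<open>g = \<one>\<close> of \<open>wall_crossing\<close> shortens whatever
  lies on the negative side. Since \<open>P_flip\<close> puts exactly one of \<open>x\<close> and
  \<open>s \<otimes> x\<close> there, this decides both directions.\<close>

lemma descent_iff:
  assumes s: "s \<in> S" and x: "x \<in> carrier G"
  shows "len (s \<otimes> x) < len x \<longleftrightarrow> x \<notin> P s"
proof -
  have short: "len (s \<otimes> y) < len y" if y: "y \<in> carrier G" "y \<notin> P s" for y
  proof -
    obtain ws where ws: "ws \<in> lists S" "length ws = len y" "wp ws = y" using y len_attained by blast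
    obtain us u vs where d: "ws = us @ u # vs" "s \<otimes> y = wp (us @ vs)"
      using wall_crossing[of \<one> s ws] ws s y P_one by auto
    have "len (wp (us @ vs)) \<le> length (us @ vs)" using d ws by (intro len_le) auto
    with d ws show ?thesis by simp
  qed
  show ?thesis
    using short[of x] short[of "s \<otimes> x"] s x P_flip[of s x] by fastforce
qed

text \<open>By \<open>P_wall\<close>, a step on the right can change the side of the wall of
  \<open>s\<close> only when \<open>s \<otimes> x = x \<otimes> t\<close>; descents are sides of
  walls.\<close>

lemma descent_right_stable:
  assumes s: "s \<in> S" and t: "t \<in> S" and x: "x \<in> carrier G" and ne: "s \<otimes> x \<noteq> x \<otimes> t"
  shows "len (s \<otimes> (x \<otimes> t)) < len (x \<otimes> t) \<longleftrightarrow> len (s \<otimes> x) < len x"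
proof -
  have "s \<otimes> (x \<otimes> t) \<noteq> x"
    using ne s t x by (metis S_cancel S_mem m_closed)
  then show ?thesis
    using P_wall[OF s t, of x] P_wall[OF s t, of "x \<otimes> t"] ne s t x descent_iff[OF s, of x] descent_iff[OF s, of "x \<otimes> t"]
    by fastforce
qed

lemma descent_left_stable:
  assumes s: "s \<in> S" and t: "t \<in> S" and x: "x \<in> carrier G" and ne: "s \<otimes> x \<noteq> x \<otimes> t"
  shows "len (s \<otimes> x \<otimes> t) < len (s \<otimes> x) \<longleftrightarrow> len (x \<otimes> t) < len x"
proof -
  have "t \<otimes> inv x \<noteq> inv x \<otimes> s"
    using ne s t x by (metis S_inv S_mem inv_closed inv_inv inv_mult_group)
  then show ?thesis
    using descent_right_stable[of t s "inv x"] s t x len_inv[of "s \<otimes> x \<otimes> t"] len_inv[of "s \<otimes> x"]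
      len_inv[of "x \<otimes> t"] by (simp add: inv_mult_group)
qed

section \<open>Sign character, finiteness of balls, existence of descents\<close>

abbreviation sgn_cox :: "'a \<Rightarrow> int" where "sgn_cox \<equiv> cox_sign G S"

lemma sgn_cox_S: "s \<in> S \<Longrightarrow> x \<in> carrier G \<Longrightarrow> sgn_cox (s \<otimes> x) = - sgn_cox x"
  using len_S_cases[of s x] by (auto simp: cox_sign_def)

lemma sgn_cox_mult:
  assumes "x \<in> carrier G" "y \<in> carrier G"
  shows "sgn_cox (x \<otimes> y) = sgn_cox x * sgn_cox y"
proof -
  have "sgn_cox (wp ws \<otimes> y) = sgn_cox (wp ws) * sgn_cox y" if "ws \<in> lists S" for ws
    using that assms(2)
  proof (induction ws)
    case (Cons s ws)
    then show ?case using sgn_cox_S[of s "wp ws"] sgn_cox_S[of s "wp ws \<otimes> y"] by (simp add: m_assoc)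
  qed (simp add: cox_sign_def)
  then show ?thesis using S_generates[OF assms(1)] by blast
qed

lemma sgn_cox_inv: "x \<in> carrier G \<Longrightarrow> sgn_cox (inv x) = sgn_cox x"
  by (simp add: cox_sign_def)

lemma sgn_cox_sq [simp]: "sgn_cox x * sgn_cox x = 1"
  by (simp add: cox_sign_def flip: power_add)

lemma finite_len: "finite {x \<in> carrier G. len x \<le> k}"
proof (rule finite_subset)
  show "{x \<in> carrier G. len x \<le> k} \<subseteq> wp ` {ws. set ws \<subseteq> S \<and> length ws \<le> k}"
  proof
    fix x assume "x \<in> {x \<in> carrier G. len x \<le> k}"
    then obtain ws where "ws \<in> lists S" "length ws = len x" "wp ws = x" "len x \<le> k"
      using len_attained by blast
    then show "x \<in> wp ` {ws. set ws \<subseteq> S \<and> length ws \<le> k}" by (intro image_eqI[of _ _ ws]) auto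
  qed
  show "finite (wp ` {ws. set ws \<subseteq> S \<and> length ws \<le> k})"
    using finite_lists_length_le[OF S_finite] by auto
qed

lemma exists_descent:
  assumes "x \<in> carrier G" "x \<noteq> \<one>"
  shows "\<exists>s\<in>S. len (s \<otimes> x) < len x"
proof -
  obtain ws where ws: "ws \<in> lists S" "length ws = len x" "wp ws = x" using assms len_attained by blast
  with assms obtain s vs where "ws = s # vs" by (cases ws) auto
  then show ?thesis using ws len_le[of vs] by (intro bexI[of _ s]) auto
qed

section \<open>The Bruhat order and its lifting property\<close>

lemma ble_refl [simp]: "ble x x"
  by (simp add: bruhat_le_def)

lemma ble_trans: "ble x y \<Longrightarrow> ble y z \<Longrightarrow> ble x z"
  unfolding bruhat_le_def by (rule rtranclp_trans)

text \<open>The order is defined by reflections on the right; conjugation by \<open>x\<close> turns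
  them into reflections on the left, which suits left multiplication by generators.
  \<open>ble_induct\<close> makes the same translation for induction along a chain.\<close>

lemma ble_step:
  assumes "x \<in> carrier G" "r \<in> refls" "len x < len (r \<otimes> x)"
  shows "ble x (r \<otimes> x)"
proof -
  have "inv x \<otimes> r \<otimes> inv (inv x) \<in> cox_reflections G S"
    using refls_conj[OF assms(2), of "inv x"] assms(1) by (simp add: refls_def)
  moreover have "x \<otimes> (inv x \<otimes> r \<otimes> inv (inv x)) = r \<otimes> x"
    using assms by (simp add: m_assoc[symmetric])
  ultimately show ?thesis unfolding bruhat_le_def using assms
    by (intro r_into_rtranclp conjI bexI[of _ "inv x \<otimes> r \<otimes> inv (inv x)"]) auto
qed

lemma ble_induct [consumes 1, case_names refl step]:
  assumes "ble x y" and "Q x"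
    and "\<And>u r. ble x u \<Longrightarrow> u \<in> carrier G \<Longrightarrow> r \<in> refls \<Longrightarrow> len u < len (r \<otimes> u) \<Longrightarrow> Q u \<Longrightarrow> Q (r \<otimes> u)"
  shows "Q y"
  using assms(1) unfolding bruhat_le_def
proof (induction rule: rtranclp_induct)
  case base
  show ?case by (rule assms(2))
next
  case (step u z)
  then obtain t where t: "t \<in> cox_reflections G S" "z = u \<otimes> t" "u \<in> carrier G" "len u < len z" by auto
  then have "u \<otimes> t \<otimes> inv u \<in> refls" "t \<in> carrier G" using refls_conj refls_def refls_carrier by auto
  moreover have "u \<otimes> t \<otimes> inv u \<otimes> u = z" using t \<open>t \<in> carrier G\<close> by (simp add: m_assoc)
  ultimately show ?case using assms(3)[of u "u \<otimes> t \<otimes> inv u"] step t unfolding bruhat_le_def by auto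
qed

lemma ble_len: "ble x y \<Longrightarrow> x = y \<or> len x < len y"
  by (induction rule: ble_induct) auto

lemma ble_carrier: "ble x y \<Longrightarrow> y \<in> carrier G \<Longrightarrow> x \<in> carrier G"
  unfolding bruhat_le_def by (erule converse_rtranclpE) auto

lemma ble_antisym: "ble x y \<Longrightarrow> ble y x \<Longrightarrow> x = y"
  using ble_len[of x y] ble_len[of y x] by auto

lemma finite_ble: "y \<in> carrier G \<Longrightarrow> finite {x. ble x y}"
  by (rule finite_subset[OF _ finite_len[of "len y"]]) (use ble_len ble_carrier in fastforce)

lemma ble_S: "s \<in> S \<Longrightarrow> x \<in> carrier G \<Longrightarrow> len x < len (s \<otimes> x) \<Longrightarrow> ble x (s \<otimes> x)"
  using ble_step S_refls by blast

text \<open>Induction along a chain of reflections. In the essential case \<open>s\<close> ascends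
  from \<open>u\<close> and \<open>s \<otimes> u\<close> is not \<open>r \<otimes> u\<close>; then
  the conjugate reflection \<open>r'\<close> carries \<open>s \<otimes> u\<close> to
  \<open>s \<otimes> (r \<otimes> u)\<close> and must go up. Otherwise strong exchange deletes a
  letter of \<open>s # ws\<close>: deleting \<open>s\<close> gives
  \<open>s \<otimes> u = r \<otimes> u\<close>, and deleting a later letter writes
  \<open>r \<otimes> u\<close> with fewer letters than \<open>u\<close> has.\<close>

lemma ble_S_lift:
  assumes s: "s \<in> S" and xy: "ble x y" and y: "y \<in> carrier G"
  shows "ble (s \<otimes> x) y \<or> ble (s \<otimes> x) (s \<otimes> y)"
proof -
  have x: "x \<in> carrier G" using ble_carrier xy y by blast
  show ?thesis using xy
  proof (induction rule: ble_induct)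
    case refl
    then show ?case by simp
  next
    case (step u r)
    note u = \<open>u \<in> carrier G\<close>
    let ?y = "r \<otimes> u"
    have y: "?y \<in> carrier G" using step by simp
    have uy: "ble u ?y" using step ble_step by blast
    have "ble (s \<otimes> u) ?y \<or> ble (s \<otimes> u) (s \<otimes> ?y)"
    proof (cases "len (s \<otimes> u) < len u")
      case True
      then have "ble (s \<otimes> u) u" using ble_S[of s "s \<otimes> u"] s u by simp
      then show ?thesis using uy ble_trans by blast
    next
      case False
      then have lsu: "len (s \<otimes> u) = Suc (len u)" using len_S_cases[OF s u] by auto
      define r' where "r' = s \<otimes> r \<otimes> inv s"
      have r': "r' \<in> refls" using refls_conj[of r s] step s by (simp add: r'_def)
      have sy: "s \<otimes> ?y = r' \<otimes> (s \<otimes> u)" using s u step by (simp add: r'_def m_assoc)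
      show ?thesis
      proof (cases "s \<otimes> u = ?y")
        case ne: False
        have "len (s \<otimes> u) < len (r' \<otimes> (s \<otimes> u))"
        proof (rule ccontr)
          assume "\<not> ?thesis"
          then have le: "len (r' \<otimes> (s \<otimes> u)) \<le> len (s \<otimes> u)" by simp
          obtain ws where ws: "ws \<in> lists S" "length ws = len u" "wp ws = u" using len_attained u by blast
          obtain us t vs where d: "s # ws = us @ t # vs" "r' \<otimes> (s \<otimes> u) = wp (us @ vs)"
            using strong_exchange[OF r', of "s # ws"] ws s le by auto
          show False
          proof (cases us)
            case Nil
            then have "s \<otimes> ?y = u" using d ws sy by auto
            then show False using ne s y by (metis S_cancel)
          next
            case (Cons a us')
            then have "a = s" "us' @ vs \<in> lists S" "length (us' @ vs) < len u" using d ws by auto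
            moreover have "?y = wp (us' @ vs)"
              using d(2) sy Cons \<open>a = s\<close> calculation(2) s y by (metis S_cancel append_Cons wp_Cons wp_closed)
            ultimately show False using len_le[of "us' @ vs"] step by simp
          qed
        qed
        then show ?thesis using ble_step[OF _ r', of "s \<otimes> u"] s u sy by auto
      qed auto
    qed
    moreover have "ble (s \<otimes> u) ?y \<or> ble (s \<otimes> u) (s \<otimes> ?y) \<Longrightarrow> ble (s \<otimes> x) (s \<otimes> u) \<Longrightarrow> ?case"
      using ble_trans by blast
    ultimately show ?case using step uy ble_trans by blast
  qed
qed

lemma ble_S_lift_up:
  assumes "s \<in> S" "ble x y" "y \<in> carrier G" "len y < len (s \<otimes> y)"
  shows "ble x (s \<otimes> y)" "ble (s \<otimes> x) (s \<otimes> y)"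
proof -
  have "ble y (s \<otimes> y)" using assms ble_S by blast
  then show "ble x (s \<otimes> y)" "ble (s \<otimes> x) (s \<otimes> y)"
    using ble_S_lift[OF assms(1-3)] assms(2) ble_trans by blast+
qed

end

section \<open>Laurent polynomials\<close>

lemma lookup_sum_monomials: "p = (\<Sum>k\<in>Poly_Mapping.keys p. Poly_Mapping.single k (Poly_Mapping.lookup p k))"
  by (rule poly_mapping_eqI) (simp add: lookup_sum lookup_single when_def in_keys_iff)

lemma lookup_vpow_mult [simp]: "Poly_Mapping.lookup (vpow a * p) k = Poly_Mapping.lookup p (k - a)"
proof -
  have "vpow a * p = (\<Sum>j\<in>Poly_Mapping.keys p. Poly_Mapping.single (a + j) (Poly_Mapping.lookup p j))"
    by (subst lookup_sum_monomials[of p]) (simp add: sum_distrib_left vpow_def mult_single)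
  then have "Poly_Mapping.lookup (vpow a * p) k
      = (\<Sum>j\<in>Poly_Mapping.keys p. if a + j = k then Poly_Mapping.lookup p j else 0)"
    by (simp add: lookup_sum lookup_single when_def)
  also have "\<dots> = (\<Sum>j\<in>Poly_Mapping.keys p. if j = k - a then Poly_Mapping.lookup p j else 0)"
    by (intro sum.cong) auto
  finally show ?thesis by (simp add: in_keys_iff)
qed

lemma lookup_of_int_mult [simp]:
  "Poly_Mapping.lookup (of_int c * p :: laurent) k = c * Poly_Mapping.lookup p k"
proof -
  have "of_int c = Poly_Mapping.single (0::int) c"
    by (metis single_of_int of_int_eq_id id_apply)
  then have "of_int c * p = Poly_Mapping.map ((*) c) p"
    unfolding mult_map_scale_conv_mult by simp
  then show ?thesis by (simp add: Poly_Mapping.map.rep_eq when_def)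
qed

lemma vpow_0 [simp]: "vpow 0 = 1"
  by (simp add: vpow_def)

lemma vpow_add: "vpow a * vpow b = vpow (a + b)"
  by (simp add: vpow_def mult_single)

lemma vpow_cancel [simp]: "vpow a * (vpow b * p) = vpow (a + b) * p"
  by (simp add: vpow_add flip: mult.assoc)

lemma vpow_neq_0 [simp]: "vpow a \<noteq> 0"
  by (metis lookup_single_eq lookup_zero vpow_def zero_neq_one)

lemma lookup_bar [simp]: "Poly_Mapping.lookup (laurent_bar p) k = Poly_Mapping.lookup p (- k)"
  by (simp add: laurent_bar_def map_key.rep_eq inj_def)

lemma bar_0 [simp]: "laurent_bar 0 = 0"
  and bar_1 [simp]: "laurent_bar 1 = 1"
  and bar_add: "laurent_bar (p + q) = laurent_bar p + laurent_bar q"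
  and bar_minus: "laurent_bar (p - q) = laurent_bar p - laurent_bar q"
  and bar_vpow_mult: "laurent_bar (vpow a * p) = vpow (- a) * laurent_bar p"
  and bar_of_int_mult: "laurent_bar (of_int c * p) = of_int c * laurent_bar p"
  by (rule poly_mapping_eqI; simp add: lookup_add lookup_minus lookup_one when_def)+

text \<open>The specialisation v = 1, hence q = 1. It kills \<open>kap\<close>, so that the
  operators of the Hecke algebra become multiplications in the group ring.\<close>

definition laurent_ev :: "laurent \<Rightarrow> int" where
  "laurent_ev p = (\<Sum>k\<in>Poly_Mapping.keys p. Poly_Mapping.lookup p k)"

lemma laurent_ev_superset:
  "finite A \<Longrightarrow> Poly_Mapping.keys p \<subseteq> A \<Longrightarrow> laurent_ev p = (\<Sum>k\<in>A. Poly_Mapping.lookup p k)"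
  unfolding laurent_ev_def by (rule sum.mono_neutral_left) (auto simp: in_keys_iff)

lemma ev_0 [simp]: "laurent_ev 0 = 0"
  and ev_1 [simp]: "laurent_ev 1 = 1"
  by (simp_all add: laurent_ev_def)

lemma ev_add: "laurent_ev (p + q) = laurent_ev p + laurent_ev q"
proof -
  let ?A = "Poly_Mapping.keys p \<union> Poly_Mapping.keys q"
  have "laurent_ev (p + q) = (\<Sum>k\<in>?A. Poly_Mapping.lookup (p + q) k)"
    by (rule laurent_ev_superset) (use keys_add[of p q] in auto)
  also have "\<dots> = laurent_ev p + laurent_ev q"
    by (subst (1 2) laurent_ev_superset[of ?A]) (auto simp: lookup_add sum.distrib)
  finally show ?thesis .
qed

lemma ev_of_int_mult: "laurent_ev (of_int c * p) = c * laurent_ev p"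
  by (subst laurent_ev_superset[of "Poly_Mapping.keys p"])
     (auto simp: in_keys_iff laurent_ev_def sum_distrib_left)

lemma ev_uminus: "laurent_ev (- p) = - laurent_ev p"
  using ev_of_int_mult[of "-1" p] by simp

lemma ev_minus: "laurent_ev (p - q) = laurent_ev p - laurent_ev q"
  using ev_add[of p "- q"] by (simp add: ev_uminus)

lemma ev_sum: "laurent_ev (sum f A) = (\<Sum>x\<in>A. laurent_ev (f x))"
  by (induction A rule: infinite_finite_induct) (auto simp: ev_add)

lemma ev_vpow_mult [simp]: "laurent_ev (vpow a * p) = laurent_ev p"
proof -
  have "laurent_ev (vpow a * p) = (\<Sum>k\<in>(+) a ` Poly_Mapping.keys p. Poly_Mapping.lookup (vpow a * p) k)"
  proof (rule laurent_ev_superset)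
    show "Poly_Mapping.keys (vpow a * p) \<subseteq> (+) a ` Poly_Mapping.keys p"
    proof
      fix k assume "k \<in> Poly_Mapping.keys (vpow a * p)"
      then have "k - a \<in> Poly_Mapping.keys p" by (simp add: in_keys_iff)
      then show "k \<in> (+) a ` Poly_Mapping.keys p" by (rule rev_image_eqI) simp
    qed
  qed simp
  also have "\<dots> = laurent_ev p"
    by (simp add: sum.reindex laurent_ev_def)
  finally show ?thesis .
qed

lemma lookup_pm_scale [simp]: "Poly_Mapping.lookup (pm_scale c h) x = c * Poly_Mapping.lookup h x"
  by (simp add: pm_scale_def Poly_Mapping.map.rep_eq when_def)

text \<open>The coefficient in the quadratic relation \<open>H_s H_s = 1 + kap H_s\<close> of the
  normalised generators.\<close>

definition kap :: laurent where "kap = vpow 1 - vpow (- 1)"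

lemma bar_kap_mult: "laurent_bar (kap * p) = - kap * laurent_bar p"
  by (simp add: kap_def left_diff_distrib bar_minus bar_vpow_mult)

lemma ev_kap_mult [simp]: "laurent_ev (kap * p) = 0"
  by (simp add: kap_def left_diff_distrib ev_minus)

section \<open>The regular representation of the Hecke algebra\<close>

context halfspace_group
begin

text \<open>
  Elements of the Hecke algebra are handled as coordinate functions with respect to the normalised
  basis \<open>H\<^sub>x = v\<^bsup>-\<ell>(x)\<^esup> T\<^sub>x\<close>; \<open>lmul s\<close> and \<open>rmul s\<close> are the multiplications by \<open>H\<^sub>s\<close>, and \<open>lmuli s\<close> and
  \<open>rmuli s\<close> are those by its inverse \<open>H\<^sub>s - (v - v\<^sup>-\<^sup>1)\<close>.
\<close>

definition nf :: "'a hecke \<Rightarrow> 'a \<Rightarrow> laurent" where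
  "nf h x = vpow (int (len x)) * Poly_Mapping.lookup h x"

definition lmul :: "'a \<Rightarrow> ('a \<Rightarrow> laurent) \<Rightarrow> 'a \<Rightarrow> laurent" where
  "lmul s f x = (if x \<in> carrier G
     then f (s \<otimes> x) + (if len (s \<otimes> x) < len x then kap * f x else 0) else 0)"

definition rmul :: "'a \<Rightarrow> ('a \<Rightarrow> laurent) \<Rightarrow> 'a \<Rightarrow> laurent" where
  "rmul s f x = (if x \<in> carrier G
     then f (x \<otimes> s) + (if len (x \<otimes> s) < len x then kap * f x else 0) else 0)"

definition lmuli :: "'a \<Rightarrow> ('a \<Rightarrow> laurent) \<Rightarrow> 'a \<Rightarrow> laurent" where
  "lmuli s f x = lmul s f x - kap * f x"

definition rmuli :: "'a \<Rightarrow> ('a \<Rightarrow> laurent) \<Rightarrow> 'a \<Rightarrow> laurent" where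
  "rmuli s f x = rmul s f x - kap * f x"

definition supported :: "('a \<Rightarrow> laurent) \<Rightarrow> bool" where
  "supported f \<longleftrightarrow> finite {x. f x \<noteq> 0} \<and> {x. f x \<noteq> 0} \<subseteq> carrier G"

definition dl :: "'a \<Rightarrow> 'a \<Rightarrow> laurent" where
  "dl w x = (if x = w then 1 else 0)"

lemma supported_outside: "supported f \<Longrightarrow> x \<notin> carrier G \<Longrightarrow> f x = 0"
  unfolding supported_def by blast

lemma supported_subset:
  "finite A \<Longrightarrow> A \<subseteq> carrier G \<Longrightarrow> (\<And>x. f x \<noteq> 0 \<Longrightarrow> x \<in> A) \<Longrightarrow> supported f"
  unfolding supported_def by (auto intro: finite_subset[of _ A])

lemma supported_dl [simp]: "w \<in> carrier G \<Longrightarrow> supported (dl w)"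
  by (rule supported_subset[of "{w}"]) (auto simp: dl_def split: if_splits)

lemma supported_lmul:
  assumes "s \<in> S" "supported f"
  shows "supported (lmul s f)"
proof (rule supported_subset[of "{x. f x \<noteq> 0} \<union> (\<otimes>) s ` {x. f x \<noteq> 0}"])
  fix x assume "lmul s f x \<noteq> 0"
  then have "x \<in> carrier G" "f (s \<otimes> x) \<noteq> 0 \<or> f x \<noteq> 0" by (auto simp: lmul_def split: if_splits)
  then show "x \<in> {x. f x \<noteq> 0} \<union> (\<otimes>) s ` {x. f x \<noteq> 0}"
    using assms(1) by (auto intro!: image_eqI[of x _ "s \<otimes> x"])
qed (use assms in \<open>auto simp: supported_def\<close>)

lemma supported_rmul:
  assumes "s \<in> S" "supported f"
  shows "supported (rmul s f)"
proof (rule supported_subset[of "{x. f x \<noteq> 0} \<union> (\<lambda>x. x \<otimes> s) ` {x. f x \<noteq> 0}"])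
  fix x assume "rmul s f x \<noteq> 0"
  then have "x \<in> carrier G" "f (x \<otimes> s) \<noteq> 0 \<or> f x \<noteq> 0" by (auto simp: rmul_def split: if_splits)
  then show "x \<in> {x. f x \<noteq> 0} \<union> (\<lambda>x. x \<otimes> s) ` {x. f x \<noteq> 0}"
    using assms(1) by (auto intro!: image_eqI[of x _ "x \<otimes> s"])
qed (use assms in \<open>auto simp: supported_def\<close>)

lemma supported_add: "supported f \<Longrightarrow> supported g \<Longrightarrow> supported (\<lambda>x. f x + g x)"
  by (rule supported_subset[of "{x. f x \<noteq> 0} \<union> {x. g x \<noteq> 0}"]) (auto simp: supported_def)

lemma supported_minus: "supported f \<Longrightarrow> supported g \<Longrightarrow> supported (\<lambda>x. f x - g x)"
  by (rule supported_subset[of "{x. f x \<noteq> 0} \<union> {x. g x \<noteq> 0}"]) (auto simp: supported_def)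

lemma supported_scale: "supported f \<Longrightarrow> supported (\<lambda>x. c * f x)"
  by (rule supported_subset[of "{x. f x \<noteq> 0}"]) (auto simp: supported_def)

lemma supported_sum: "(\<And>i. i \<in> I \<Longrightarrow> supported (f i)) \<Longrightarrow> supported (\<lambda>x. \<Sum>i\<in>I. f i x)"
proof (induction I rule: infinite_finite_induct)
  case (insert i I)
  then show ?case using supported_add[of "f i"] by simp
qed (auto simp: supported_def)

lemma supported_lmuli: "s \<in> S \<Longrightarrow> supported f \<Longrightarrow> supported (lmuli s f)"
  using supported_minus[OF supported_lmul supported_scale, of s f f kap] by (simp add: lmuli_def[abs_def])

text \<open>Associativity of the Hecke algebra in coordinates. If \<open>s \<otimes> x\<close>
  differs from \<open>x \<otimes> t\<close>, neither multiplication changes the descent seen by the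
  other, so the correction terms match; if they are equal, both operators read the same two
  coordinates and the corrections coincide.\<close>

lemma lmul_rmul:
  assumes s: "s \<in> S" and t: "t \<in> S"
  shows "lmul s (rmul t f) = rmul t (lmul s f)"
proof
  fix x
  show "lmul s (rmul t f) x = rmul t (lmul s f) x"
  proof (cases "x \<in> carrier G")
    case x: True
    have a: "s \<otimes> x \<otimes> t = s \<otimes> (x \<otimes> t)" using s t x by (simp add: m_assoc)
    show ?thesis
    proof (cases "s \<otimes> x = x \<otimes> t")
      case True
      then have "s \<otimes> (x \<otimes> t) = x" using s t x by (metis S_cancel)
      then show ?thesis using True s t x a by (simp add: lmul_def rmul_def algebra_simps)
    next
      case False
      then show ?thesis
        using descent_right_stable[OF s t x False] descent_left_stable[OF s t x False] s t x a
        by (simp add: lmul_def rmul_def algebra_simps)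
    qed
  qed (simp add: lmul_def rmul_def)
qed

lemma lmuli_rmul:
  assumes "s \<in> S" "t \<in> S" "supported f"
  shows "lmuli s (rmul t f) = rmul t (lmuli s f)"
proof
  fix x
  have "lmul s (rmul t f) x = rmul t (lmul s f) x" using lmul_rmul assms by metis
  moreover have "rmul t (lmuli s f) x = rmul t (lmul s f) x - kap * rmul t f x"
    by (simp add: rmul_def lmuli_def algebra_simps)
  ultimately show "lmuli s (rmul t f) x = rmul t (lmuli s f) x"
    by (simp add: lmuli_def)
qed

text \<open>The quadratic relation, checked pointwise: exactly one of \<open>x\<close> and
  \<open>s \<otimes> x\<close> has \<open>s\<close> as a descent, so the two contributions with
  \<open>kap\<close> cancel.\<close>

lemma lmul_lmuli:
  assumes s: "s \<in> S" and f: "supported f"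
  shows "lmul s (lmuli s f) = f" "lmuli s (lmul s f) = f"
proof -
  have c: "len (s \<otimes> x) < len x \<longleftrightarrow> \<not> len x < len (s \<otimes> x)" if "x \<in> carrier G" for x
    using len_S_cases[OF s that] by auto
  show "lmul s (lmuli s f) = f"
  proof
    fix x show "lmul s (lmuli s f) x = f x"
      using s c[of x] supported_outside[OF f, of x] by (auto simp: lmul_def lmuli_def algebra_simps)
  qed
  show "lmuli s (lmul s f) = f"
  proof
    fix x show "lmuli s (lmul s f) x = f x"
      using s c[of x] supported_outside[OF f, of x] by (auto simp: lmul_def lmuli_def algebra_simps)
  qed
qed

lemma rmuli_rmul:
  assumes s: "s \<in> S" and f: "supported f"
  shows "rmuli s (rmul s f) = f"
proof
  fix x
  have "len (x \<otimes> s) < len x \<longleftrightarrow> \<not> len x < len (x \<otimes> s)" if "x \<in> carrier G" for x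
    using len_S_right_cases[OF s that] by auto
  then show "rmuli s (rmul s f) x = f x"
    using s supported_outside[OF f, of x] by (auto simp: rmul_def rmuli_def algebra_simps)
qed

section \<open>Operators attached to words\<close>

abbreviation "lmulw \<equiv> foldr lmul"
abbreviation "lmuliw \<equiv> fold lmuli"
abbreviation "rmulw \<equiv> fold rmul"
abbreviation "rmuliw \<equiv> foldr rmuli"

lemma supported_words:
  assumes "ws \<in> lists S" "supported f"
  shows "supported (lmulw ws f)" "supported (lmuliw ws f)" "supported (rmulw ws f)"
  using assms by (induction ws arbitrary: f) (auto simp: supported_lmul supported_lmuli supported_rmul)

lemma lmuliw_lmulw:
  "ws \<in> lists S \<Longrightarrow> supported f \<Longrightarrow> lmuliw ws (lmulw ws f) = f"
  by (induction ws arbitrary: f) (auto simp: lmul_lmuli supported_words)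

lemma lmulw_lmuliw:
  "ws \<in> lists S \<Longrightarrow> supported f \<Longrightarrow> lmulw ws (lmuliw ws f) = f"
  by (induction ws arbitrary: f) (auto simp: lmul_lmuli supported_words supported_lmuli)

lemma rmuliw_rmulw:
  "ws \<in> lists S \<Longrightarrow> supported f \<Longrightarrow> rmuliw ws (rmulw ws f) = f"
  by (induction ws arbitrary: f) (auto simp: rmuli_rmul supported_rmul)

lemma rmulw_lmul:
  "us \<in> lists S \<Longrightarrow> s \<in> S \<Longrightarrow> supported f \<Longrightarrow> rmulw us (lmul s f) = lmul s (rmulw us f)"
  by (induction us arbitrary: f) (auto simp: supported_rmul simp flip: lmul_rmul)

lemma rmulw_lmuli:
  "us \<in> lists S \<Longrightarrow> s \<in> S \<Longrightarrow> supported f \<Longrightarrow> rmulw us (lmuli s f) = lmuli s (rmulw us f)"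
  by (induction us arbitrary: f) (auto simp: supported_rmul simp flip: lmuli_rmul)

lemma rmulw_lmulw:
  "us \<in> lists S \<Longrightarrow> ws \<in> lists S \<Longrightarrow> supported f \<Longrightarrow> rmulw us (lmulw ws f) = lmulw ws (rmulw us f)"
  by (induction ws arbitrary: f) (auto simp: supported_words rmulw_lmul)

lemma rmulw_lmuliw:
  "us \<in> lists S \<Longrightarrow> ws \<in> lists S \<Longrightarrow> supported f \<Longrightarrow> rmulw us (lmuliw ws f) = lmuliw ws (rmulw us f)"
  by (induction ws arbitrary: f) (auto simp: supported_lmuli rmulw_lmuli)

lemma rmul_sum: "finite A \<Longrightarrow> rmul s (\<lambda>x. \<Sum>i\<in>A. c i * f i x) = (\<lambda>x. \<Sum>i\<in>A. c i * rmul s (f i) x)"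
  by (auto simp: rmul_def fun_eq_iff distrib_left sum.distrib sum_distrib_left mult_ac)

lemma rmulw_sum: "finite A \<Longrightarrow> rmulw us (\<lambda>x. \<Sum>i\<in>A. c i * f i x) = (\<lambda>x. \<Sum>i\<in>A. c i * rmulw us (f i) x)"
  by (induction us arbitrary: f) (auto simp: rmul_sum)

section \<open>Reduced words and inverses of basis elements\<close>

definition reduced :: "'a list \<Rightarrow> bool" where
  "reduced ws \<longleftrightarrow> ws \<in> lists S \<and> length ws = len (wp ws)"

lemma reduced_word_reduced:
  assumes "x \<in> carrier G"
  shows "reduced (reduced_word G S x)" "wp (reduced_word G S x) = x" "reduced_word G S x \<in> lists S"
proof -
  have "\<exists>ws. ws \<in> lists S \<and> length ws = len x \<and> wp ws = x" using len_attained[OF assms] by blast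
  from someI_ex[OF this] show "reduced (reduced_word G S x)" "wp (reduced_word G S x) = x"
    "reduced_word G S x \<in> lists S"
    unfolding reduced_word_def reduced_def by auto
qed

lemma reduced_Cons: "reduced (s # ws) \<Longrightarrow> s \<in> S \<and> reduced ws \<and> len (wp ws) < len (s \<otimes> wp ws)"
  using len_S_cases[of s "wp ws"] len_le[of ws] by (auto simp: reduced_def)

lemma reduced_snoc: "reduced (us @ [t]) \<Longrightarrow> t \<in> S \<and> reduced us \<and> len (wp us) < len (wp us \<otimes> t)"
  using len_S_right_cases[of t "wp us"] len_le[of us] by (auto simp: reduced_def)

lemma lmul_dl:
  assumes "s \<in> S" "w \<in> carrier G" "len w < len (s \<otimes> w)"
  shows "lmul s (dl w) = dl (s \<otimes> w)"
proof
  fix x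
  have "s \<otimes> x = w \<longleftrightarrow> x = s \<otimes> w" if "x \<in> carrier G" using assms that by (metis S_cancel)
  then show "lmul s (dl w) x = dl (s \<otimes> w) x"
    using assms by (auto simp: lmul_def dl_def)
qed

lemma rmul_dl:
  assumes "s \<in> S" "w \<in> carrier G" "len w < len (w \<otimes> s)"
  shows "rmul s (dl w) = dl (w \<otimes> s)"
proof
  fix x
  have "x \<otimes> s = w \<longleftrightarrow> x = w \<otimes> s" if "x \<in> carrier G" using assms that by (metis S_cancel_right)
  then show "rmul s (dl w) x = dl (w \<otimes> s) x"
    using assms by (auto simp: rmul_def dl_def)
qed

lemma lmulw_dl: "reduced ws \<Longrightarrow> lmulw ws (dl \<one>) = dl (wp ws)"
proof (induction ws)
  case (Cons s ws)
  then show ?case using reduced_Cons[of s ws] lmul_dl[of s "wp ws"] by (auto simp: reduced_def)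
qed auto

lemma rmulw_dl: "reduced us \<Longrightarrow> rmulw us (dl \<one>) = dl (wp us)"
proof (induction us rule: rev_induct)
  case (snoc t us)
  then show ?case using reduced_snoc[of us t] rmul_dl[of t "wp us"] by (auto simp: reduced_def)
qed auto

text \<open>
  The inverse of \<open>H\<^sub>x\<close> is both a product of inverses on the left and one on the right, so that it does
  not depend on the reduced word; this replaces Matsumoto's theorem.
\<close>

lemma lmuliw_eq_rmuliw:
  assumes "reduced ws" "reduced us" "wp ws = wp us"
  shows "lmuliw ws (dl \<one>) = rmuliw us (dl \<one>)"
proof -
  have l: "ws \<in> lists S" "us \<in> lists S" using assms by (auto simp: reduced_def)
  have "rmulw us (lmuliw ws (dl \<one>)) = lmuliw ws (lmulw ws (dl \<one>))"
    using rmulw_lmuliw[OF l(2,1)] rmulw_dl[OF assms(2)] lmulw_dl[OF assms(1)] assms(3) by simp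
  also have "\<dots> = dl \<one>" using lmuliw_lmulw[OF l(1)] by simp
  finally show ?thesis
    using rmuliw_rmulw[OF l(2), of "lmuliw ws (dl \<one>)"] supported_words(2)[OF l(1)] by simp
qed

lemma lmuliw_unique:
  assumes "reduced ws" "reduced us" "wp ws = wp us"
  shows "lmuliw ws (dl \<one>) = lmuliw us (dl \<one>)"
  using lmuliw_eq_rmuliw[OF assms] lmuliw_eq_rmuliw[OF assms(2,2)] by simp

text \<open>The image of \<open>H_x\<close> under the bar involution, that is, the inverse of the
  basis element at \<open>inv x\<close>. A left fold over a word of \<open>inv x\<close> applies the
  inverses of its letters in the reverse order of the product, as inversion demands.\<close>

definition rho :: "'a \<Rightarrow> 'a \<Rightarrow> laurent" where
  "rho x = lmuliw (reduced_word G S (inv x)) (dl \<one>)"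

lemma rho_reduced: "reduced ws \<Longrightarrow> wp ws = inv x \<Longrightarrow> x \<in> carrier G \<Longrightarrow> rho x = lmuliw ws (dl \<one>)"
  unfolding rho_def by (rule lmuliw_unique) (auto simp: reduced_word_reduced)

lemma supported_rho: "x \<in> carrier G \<Longrightarrow> supported (rho x)"
  unfolding rho_def by (intro supported_words) (use reduced_word_reduced[of "inv x"] in auto)

lemma rho_one: "rho \<one> = dl \<one>"
  using rho_reduced[of "[]" \<one>] by (simp add: reduced_def)

lemma rho_up:
  assumes s: "s \<in> S" and x: "x \<in> carrier G" and up: "len x < len (s \<otimes> x)"
  shows "rho (s \<otimes> x) = lmuli s (rho x)"
proof -
  define ws where "ws = reduced_word G S (inv x)"
  have ws: "reduced ws" "wp ws = inv x" "ws \<in> lists S"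
    using reduced_word_reduced[of "inv x"] x by (auto simp: ws_def)
  have w: "wp (ws @ [s]) = inv (s \<otimes> x)" using ws s x by (simp add: inv_mult_group)
  moreover have "len (s \<otimes> x) = Suc (len x)" using len_S_cases[OF s x] up by simp
  ultimately have "reduced (ws @ [s])" using ws s x len_inv[of "s \<otimes> x"] unfolding reduced_def by auto
  then show ?thesis
    using rho_reduced[of "ws @ [s]" "s \<otimes> x"] rho_reduced[OF ws(1,2)] w s x by simp
qed

text \<open>The bar image of the rule for multiplying \<open>H_x\<close> by \<open>H_s\<close>; in
  the descending case it is \<open>rho_up\<close> for \<open>s \<otimes> x\<close>, read
  backwards.\<close>

lemma lmuli_rho:
  assumes s: "s \<in> S" and x: "x \<in> carrier G"
  shows "lmuli s (rho x) y = rho (s \<otimes> x) y - (if len (s \<otimes> x) < len x then kap * rho x y else 0)"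
proof (cases "len (s \<otimes> x) < len x")
  case True
  then have "rho x = lmuli s (rho (s \<otimes> x))" using rho_up[of s "s \<otimes> x"] s x by simp
  then have "lmul s (rho x) = rho (s \<otimes> x)" using lmul_lmuli(1)[OF s] supported_rho s x by simp
  then show ?thesis using True by (simp add: lmuli_def)
next
  case False
  then show ?thesis using rho_up[OF s x] len_S_cases[OF s x] by auto
qed

text \<open>Unitriangularity of the bar involution. Write \<open>x = s \<otimes> z\<close> with
  \<open>z\<close> shorter: the coordinate of \<open>rho x\<close> at \<open>y\<close> is that of
  \<open>rho z\<close> at \<open>s \<otimes> y\<close>, because \<open>y\<close> is longer than
  \<open>z\<close> and \<open>rho z\<close> vanishes there, and \<open>s \<otimes> y\<close> is
  still no shorter than \<open>z\<close>.\<close>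

lemma rho_triangular:
  assumes "x \<in> carrier G" "y \<in> carrier G" "len x \<le> len y"
  shows "rho x y = dl x y"
  using assms
proof (induction "len x" arbitrary: x y rule: less_induct)
  case less
  show ?case
  proof (cases "x = \<one>")
    case True
    then show ?thesis by (simp add: rho_one)
  next
    case False
    then obtain s where s: "s \<in> S" "len (s \<otimes> x) < len x" using exists_descent less by blast
    define z where "z = s \<otimes> x"
    have z: "z \<in> carrier G" "x = s \<otimes> z" "len x = Suc (len z)"
      using s less len_S_cases[OF s(1) less(2)] by (auto simp: z_def)
    have ly: "len z \<le> len (s \<otimes> y)" "len z < len y" using len_S_cases[OF s(1) less(3)] less(4) z by auto
    have "rho x y = lmuli s (rho z) y" using rho_up[of s z] s z by simp
    also have "\<dots> = rho z (s \<otimes> y)"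
      using less ly z s by (auto simp: lmuli_def lmul_def dl_def)
    also have "\<dots> = dl z (s \<otimes> y)" using less ly z s by auto
    also have "\<dots> = dl x y" using z s less by (auto simp: dl_def)
    finally show ?thesis .
  qed
qed

section \<open>The bar involution\<close>

lemma nf_eq_0_iff [simp]: "nf h x = 0 \<longleftrightarrow> Poly_Mapping.lookup h x = 0"
  by (simp add: nf_def)

lemma nf_inject: "nf h = nf k \<Longrightarrow> h = k"
  by (rule poly_mapping_eqI) (auto simp: nf_def fun_eq_iff)

lemma supported_nf: "Poly_Mapping.keys h \<subseteq> carrier G \<longleftrightarrow> supported (nf h)"
  by (auto simp: supported_def in_keys_iff)

lemma nf_T: "nf (hecke_T x) = (\<lambda>y. vpow (int (len x)) * dl x y)"
  by (auto simp: nf_def hecke_T_def lookup_single dl_def)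

lemma nf_sum_scale: "nf (\<Sum>i\<in>A. pm_scale (c i) (h i)) x = (\<Sum>i\<in>A. c i * nf (h i) x)"
  by (simp add: nf_def lookup_sum sum_distrib_left mult_ac)

lemma nf_surj: "supported f \<Longrightarrow> \<exists>h. nf h = f"
  by (rule exI[of _ "Abs_poly_mapping (\<lambda>x. vpow (- int (len x)) * f x)"])
     (auto simp: nf_def supported_def)

text \<open>Since \<open>T_s = v H_s\<close>, passing to normalised coordinates turns the relation
  with q - 1 and q into \<open>lmul s\<close> up to the factor \<open>vpow 1\<close>.\<close>

lemma nf_hecke_gen:
  assumes s: "s \<in> S" and h: "Poly_Mapping.keys h \<subseteq> carrier G"
  shows "nf (hecke_gen G S s h) = (\<lambda>x. vpow 1 * lmul s (nf h) x)"
proof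
  fix x
  have f: "finite (Poly_Mapping.keys h)" by simp
  \<comment> \<open>The coefficients of \<open>T_sw\<close> and \<open>T_w\<close> in the product of
    \<open>T_s\<close> and \<open>T_w\<close>.\<close>
  define c where "c w = (if len w < len (s \<otimes> w) then 1 else hecke_q)" for w
  define d where "d w = (if len w < len (s \<otimes> w) then 0 else hecke_q - 1)" for w
  have "Poly_Mapping.lookup (hecke_gen G S s h) x =
      (\<Sum>w\<in>Poly_Mapping.keys h. (if w = x then Poly_Mapping.lookup h w * d w else 0)
         + (if s \<otimes> w = x then Poly_Mapping.lookup h w * c w else 0))"
    unfolding hecke_gen_def lookup_sum
    by (intro sum.cong)
       (auto simp: hecke_T_def lookup_single lookup_add c_def d_def when_def algebra_simps)
  also have "\<dots> = (if x \<in> carrier G then Poly_Mapping.lookup h x * d x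
        + Poly_Mapping.lookup h (s \<otimes> x) * c (s \<otimes> x) else 0)"
  proof (cases "x \<in> carrier G")
    case True
    then have "s \<otimes> w = x \<longleftrightarrow> w = s \<otimes> x" if "w \<in> Poly_Mapping.keys h" for w
      using h s that by (metis S_cancel subset_iff)
    then have "(\<Sum>w\<in>Poly_Mapping.keys h. if s \<otimes> w = x then Poly_Mapping.lookup h w * c w else 0)
       = (\<Sum>w\<in>Poly_Mapping.keys h. if w = s \<otimes> x then Poly_Mapping.lookup h w * c w else 0)"
      by (intro sum.cong) auto
    then show ?thesis using True by (simp add: sum.distrib in_keys_iff)
  next
    case False
    then have "s \<otimes> w \<noteq> x" "w \<noteq> x" if "w \<in> Poly_Mapping.keys h" for w
      using h s that by auto
    then show ?thesis using False by (auto intro!: sum.neutral)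
  qed
  finally have *: "Poly_Mapping.lookup (hecke_gen G S s h) x = \<dots>" .
  show "nf (hecke_gen G S s h) x = vpow 1 * lmul s (nf h) x"
  proof (cases "x \<in> carrier G")
    case True
    from len_S_cases[OF s True] show ?thesis
    proof
      assume "len (s \<otimes> x) = Suc (len x)"
      then show ?thesis using True s *
        by (simp add: nf_def lmul_def c_def d_def vpow_add add.commute)
    next
      assume l: "len x = Suc (len (s \<otimes> x))"
      have "hecke_q - 1 = vpow 1 * kap" by (simp add: kap_def right_diff_distrib vpow_add)
      with l show ?thesis using True s *
        by (simp add: nf_def lmul_def c_def d_def distrib_left)
    qed
  qed (simp add: nf_def lmul_def *)
qed

lemma nf_hecke_gens:
  assumes "ws \<in> lists S" "Poly_Mapping.keys h \<subseteq> carrier G"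
  shows "nf (foldr (hecke_gen G S) ws h) = (\<lambda>x. vpow (int (length ws)) * lmulw ws (nf h) x)"
  using assms
proof (induction ws rule: list.induct)
  case (Cons s ws)
  let ?h = "foldr (hecke_gen G S) ws h"
  have IH: "nf ?h = (\<lambda>x. vpow (int (length ws)) * lmulw ws (nf h) x)" using Cons by simp
  have "ws \<in> lists S" using Cons.prems by simp
  moreover have "supported (nf h)" using Cons.prems by (simp add: supported_nf)
  ultimately have "supported (lmulw ws (nf h))" by (rule supported_words(1))
  then have "supported (nf ?h)" by (simp only: IH supported_scale)
  then have "nf (hecke_gen G S s ?h) = (\<lambda>x. vpow 1 * lmul s (nf ?h) x)"
    using nf_hecke_gen[of s ?h] Cons.prems by (simp add: supported_nf)
  also have "\<dots> = (\<lambda>x. vpow (int (length (s # ws))) * lmulw (s # ws) (nf h) x)"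
    unfolding IH by (auto simp: lmul_def fun_eq_iff distrib_left mult.left_commute[of kap] add_ac)
  finally show ?case by simp
qed auto

lemma nf_mult_T_left:
  assumes "x \<in> carrier G" "Poly_Mapping.keys h \<subseteq> carrier G"
  shows "nf (hecke_mult G S (hecke_T x) h)
       = (\<lambda>y. vpow (int (len x)) * lmulw (reduced_word G S x) (nf h) y)"
proof -
  have "hecke_mult G S (hecke_T x) h = foldr (hecke_gen G S) (reduced_word G S x) h"
    by (rule poly_mapping_eqI) (simp add: hecke_mult_def hecke_T_def lookup_sum)
  then show ?thesis
    using nf_hecke_gens[of "reduced_word G S x" h] reduced_word_reduced[OF assms(1)] assms(2)
    by (simp add: reduced_def)
qed

text \<open>\<open>hecke_mult\<close> lets words of the left factor act, so a product with
  \<open>T_x\<close> on the right is not by definition a right operator. Each basis element of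
  \<open>h\<close> gives \<open>lmulw\<close> applied to \<open>rmulw us (dl \<one>)\<close>, and
  commuting the two exhibits it as \<open>rmulw us\<close> of that basis element.\<close>

lemma nf_mult_T_right:
  assumes x: "x \<in> carrier G" and h: "Poly_Mapping.keys h \<subseteq> carrier G"
    and us: "reduced us" "wp us = x"
  shows "nf (hecke_mult G S h (hecke_T x)) = (\<lambda>y. vpow (int (len x)) * rmulw us (nf h) y)"
proof
  fix y
  have ul: "us \<in> lists S" using us by (simp add: reduced_def)
  have t: "lmulw (reduced_word G S z) (nf (hecke_T x)) = (\<lambda>y. vpow (int (len x)) * rmulw us (dl z) y)"
    if z: "z \<in> carrier G" for z
  proof -
    note r = reduced_word_reduced[OF z]
    have sc: "lmulw ws (\<lambda>y. c * f y) = (\<lambda>y. c * lmulw ws f y)" for ws c f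
      by (induction ws) (auto simp: lmul_def fun_eq_iff distrib_left mult.left_commute)
    have "lmulw (reduced_word G S z) (rmulw us (dl \<one>)) = rmulw us (dl z)"
      using rmulw_lmulw[OF ul r(3), of "dl \<one>"] lmulw_dl[OF r(1)] r by simp
    then show ?thesis using rmulw_dl[OF us(1)] us(2) by (simp add: nf_T sc)
  qed
  have "nf (hecke_mult G S h (hecke_T x)) y = (\<Sum>z\<in>Poly_Mapping.keys h.
      Poly_Mapping.lookup h z * nf (foldr (hecke_gen G S) (reduced_word G S z) (hecke_T x)) y)"
    unfolding hecke_mult_def by (rule nf_sum_scale)
  also have "\<dots> = (\<Sum>z\<in>Poly_Mapping.keys h. nf h z * (vpow (int (len x)) * rmulw us (dl z) y))"
  proof (rule sum.cong)
    fix z assume "z \<in> Poly_Mapping.keys h"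
    then have z: "z \<in> carrier G" using h by auto
    have "Poly_Mapping.keys (hecke_T x :: 'a hecke) \<subseteq> carrier G" using x by (simp add: hecke_T_def)
    then show "Poly_Mapping.lookup h z * nf (foldr (hecke_gen G S) (reduced_word G S z) (hecke_T x)) y
        = nf h z * (vpow (int (len x)) * rmulw us (dl z) y)"
      using nf_hecke_gens[of "reduced_word G S z" "hecke_T x"] reduced_word_reduced[OF z] t[OF z]
      by (simp add: reduced_def nf_def mult_ac)
  qed simp
  also have "\<dots> = vpow (int (len x)) * (\<Sum>z\<in>Poly_Mapping.keys h. nf h z * rmulw us (dl z) y)"
    by (simp add: sum_distrib_left mult_ac)
  also have "(\<Sum>z\<in>Poly_Mapping.keys h. nf h z * rmulw us (dl z) y)
      = rmulw us (\<lambda>y. \<Sum>z\<in>Poly_Mapping.keys h. nf h z * dl z y) y"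
    by (simp add: rmulw_sum)
  also have "(\<lambda>y. \<Sum>z\<in>Poly_Mapping.keys h. nf h z * dl z y) = nf h"
    by (auto simp: dl_def fun_eq_iff in_keys_iff if_distrib[of "(*) _"] cong: if_cong)
  finally show "nf (hecke_mult G S h (hecke_T x)) y = vpow (int (len x)) * rmulw us (nf h) y" .
qed

lemma nf_T_inv:
  assumes x: "x \<in> carrier G"
  shows "nf (hecke_T_inv G S (inv x)) = (\<lambda>y. vpow (- int (len x)) * rho x y)"
proof -
  let ?x = "inv x" and ?ws = "reduced_word G S (inv x)"
  note r = reduced_word_reduced[of ?x]
  have xc: "?x \<in> carrier G" using x by simp
  let ?f = "\<lambda>y. vpow (- int (len x)) * rho x y"
  have "supported ?f" using supported_scale supported_rho x by simp
  then obtain h where h: "nf h = ?f" using nf_surj by blast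
  have hk: "Poly_Mapping.keys h \<subseteq> carrier G" using h \<open>supported ?f\<close> supported_nf by simp
  have lsc: "lmulw ws (\<lambda>y. c * f y) = (\<lambda>y. c * lmulw ws f y)" for ws c f
    by (induction ws) (auto simp: lmul_def fun_eq_iff distrib_left mult.left_commute)
  have rsc: "rmulw ws (\<lambda>y. c * f y) = (\<lambda>y. c * rmulw ws f y)" for ws c f
    using rmulw_sum[of "{()}" ws "\<lambda>_. c" "\<lambda>_. f"] by simp
  have one: "nf (hecke_T \<one>) = dl \<one>" by (simp add: nf_T)
  have l: "hecke_mult G S (hecke_T ?x) k = hecke_T \<one> \<longleftrightarrow> nf k = ?f"
    if k: "Poly_Mapping.keys k \<subseteq> carrier G" for k
  proof
    assume "hecke_mult G S (hecke_T ?x) k = hecke_T \<one>"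
    then have "dl \<one> = lmulw ?ws (\<lambda>y. vpow (int (len x)) * nf k y)"
      using nf_mult_T_left[OF xc k] one x by (simp add: lsc)
    then have "rho x = lmuliw ?ws (lmulw ?ws (\<lambda>y. vpow (int (len x)) * nf k y))"
      by (simp add: rho_def)
    also have "\<dots> = (\<lambda>y. vpow (int (len x)) * nf k y)"
      using k r xc by (intro lmuliw_lmulw supported_scale) (auto simp: supported_nf)
    finally show "nf k = ?f" by (auto simp: fun_eq_iff)
  next
    assume "nf k = ?f"
    then have "nf (hecke_mult G S (hecke_T ?x) k) = lmulw ?ws (rho x)"
      using nf_mult_T_left[OF xc k] x by (simp add: lsc)
    also have "\<dots> = dl \<one>" unfolding rho_def using r xc by (intro lmulw_lmuliw) auto
    finally show "hecke_mult G S (hecke_T ?x) k = hecke_T \<one>" using one nf_inject by metis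
  qed
  \<comment> \<open>The definite description asks for a two-sided inverse. The equation on one side
    determines \<open>h\<close>; the other follows by moving \<open>rmulw\<close> past
    \<open>lmuliw\<close> to the unit, where right and left words give the same basis
    element.\<close>
  have "nf (hecke_mult G S h (hecke_T ?x)) = rmulw ?ws (rho x)"
    using nf_mult_T_right[OF xc hk r(1,2)] x xc by (simp add: h rsc)
  also have "\<dots> = lmuliw ?ws (rmulw ?ws (dl \<one>))"
    unfolding rho_def using r xc by (intro rmulw_lmuliw) auto
  also have "\<dots> = lmuliw ?ws (lmulw ?ws (dl \<one>))"
    using r xc by (simp add: rmulw_dl lmulw_dl)
  also have "\<dots> = dl \<one>" using r xc by (intro lmuliw_lmulw) auto
  finally have "hecke_mult G S h (hecke_T ?x) = hecke_T \<one>" using one nf_inject by metis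
  then have "hecke_T_inv G S ?x = h"
    unfolding hecke_T_inv_def using hk l h nf_inject by (intro the_equality) auto
  then show ?thesis using h by simp
qed

definition Bar :: "('a \<Rightarrow> laurent) \<Rightarrow> 'a \<Rightarrow> laurent" where
  "Bar f x = (\<Sum>y | f y \<noteq> 0. laurent_bar (f y) * rho y x)"

lemma nf_hecke_bar:
  assumes "Poly_Mapping.keys h \<subseteq> carrier G"
  shows "nf (hecke_bar G S h) = Bar (nf h)"
proof
  fix x
  have "nf (hecke_bar G S h) x = (\<Sum>y\<in>Poly_Mapping.keys h.
      laurent_bar (Poly_Mapping.lookup h y) * nf (hecke_T_inv G S (inv y)) x)"
    unfolding hecke_bar_def by (rule nf_sum_scale)
  also have "\<dots> = (\<Sum>y\<in>Poly_Mapping.keys h. laurent_bar (nf h y) * rho y x)"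
  proof (rule sum.cong)
    fix y assume "y \<in> Poly_Mapping.keys h"
    moreover have "laurent_bar (nf h y) = vpow (- int (len y)) * laurent_bar (Poly_Mapping.lookup h y)"
      by (simp add: nf_def bar_vpow_mult)
    ultimately show "laurent_bar (Poly_Mapping.lookup h y) * nf (hecke_T_inv G S (inv y)) x
        = laurent_bar (nf h y) * rho y x"
      using assms by (simp add: nf_T_inv subset_iff mult_ac)
  qed simp
  also have "Poly_Mapping.keys h = {y. nf h y \<noteq> 0}"
    by (auto simp: in_keys_iff)
  finally show "nf (hecke_bar G S h) x = Bar (nf h) x" by (simp add: Bar_def)
qed

lemma Bar_superset:
  assumes "finite A" "\<And>y. f y \<noteq> 0 \<Longrightarrow> y \<in> A"
  shows "Bar f x = (\<Sum>y\<in>A. laurent_bar (f y) * rho y x)"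
  unfolding Bar_def by (rule sum.mono_neutral_left) (use assms in auto)

lemma Bar_add:
  assumes "supported f" "supported g"
  shows "Bar (\<lambda>x. f x + g x) x = Bar f x + Bar g x"
  by (subst (1 2 3) Bar_superset[of "{x. f x \<noteq> 0} \<union> {x. g x \<noteq> 0}"])
     (use assms in \<open>auto simp: supported_def bar_add distrib_right sum.distrib\<close>)

lemma Bar_of_int:
  assumes "supported f"
  shows "Bar (\<lambda>x. of_int c * f x) x = of_int c * Bar f x"
  by (subst (1 2) Bar_superset[of "{x. f x \<noteq> 0}"])
     (use assms in \<open>auto simp: supported_def bar_of_int_mult sum_distrib_left mult_ac\<close>)

lemma Bar_vpow:
  assumes "supported f"
  shows "Bar (\<lambda>x. vpow c * f x) x = vpow (- c) * Bar f x"
  by (subst (1 2) Bar_superset[of "{x. f x \<noteq> 0}"])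
     (use assms in \<open>auto simp: supported_def bar_vpow_mult sum_distrib_left mult_ac\<close>)

lemma Bar_minus:
  assumes "supported f" "supported g"
  shows "Bar (\<lambda>x. f x - g x) x = Bar f x - Bar g x"
  by (subst (1 2 3) Bar_superset[of "{x. f x \<noteq> 0} \<union> {x. g x \<noteq> 0}"])
     (use assms in \<open>auto simp: supported_def bar_minus left_diff_distrib sum_subtractf\<close>)

lemma Bar_sum:
  assumes "finite I" "\<And>i. i \<in> I \<Longrightarrow> supported (f i)"
  shows "Bar (\<lambda>x. \<Sum>i\<in>I. of_int (c i) * f i x) x = (\<Sum>i\<in>I. of_int (c i) * Bar (f i) x)"
  using assms
proof (induction I)
  case empty
  then show ?case by (simp add: Bar_def)
next
  case (insert i I)
  then show ?case
    using Bar_add[OF supported_scale supported_sum[of I "\<lambda>i x. of_int (c i) * f i x"], of "f i" "of_int (c i)" x]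
    by (simp add: supported_scale Bar_of_int)
qed

text \<open>The instance of multiplicativity of the bar involution that the recursion needs: the
  image of \<open>H_s\<close> is its inverse. The sum is reindexed by the involution
  \<open>y \<mapsto> s \<otimes> y\<close> of \<open>A\<close>, after which \<open>lmuli_rho\<close>
  applies termwise.\<close>

lemma Bar_lmul:
  assumes s: "s \<in> S" and f: "supported f"
  shows "Bar (lmul s f) x = lmuli s (Bar f) x"
proof -
  define A where "A = {x. f x \<noteq> 0} \<union> (\<otimes>) s ` {x. f x \<noteq> 0}"
  have A: "finite A" "A \<subseteq> carrier G" "{x. f x \<noteq> 0} \<subseteq> A"
    using f s by (auto simp: A_def supported_def)
  have Ainv: "s \<otimes> y \<in> A" if "y \<in> A" for y
    using that s f by (auto simp: A_def supported_def)
  have bij: "bij_betw ((\<otimes>) s) A A"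
    by (rule bij_betwI[of _ _ _ "(\<otimes>) s"]) (use Ainv A s in auto)
  have "Bar (lmul s f) x = (\<Sum>y\<in>A. laurent_bar (lmul s f y) * rho y x)"
  proof (rule Bar_superset[OF A(1)])
    fix y assume "lmul s f y \<noteq> 0"
    then have "y \<in> carrier G" "f (s \<otimes> y) \<noteq> 0 \<or> f y \<noteq> 0" by (auto simp: lmul_def split: if_splits)
    then show "y \<in> A" using s by (auto simp: A_def intro!: image_eqI[of y _ "s \<otimes> y"])
  qed
  also have "\<dots> = (\<Sum>y\<in>A. laurent_bar (f (s \<otimes> y)) * rho y x)
     - (\<Sum>y\<in>A. laurent_bar (f y) * (if len (s \<otimes> y) < len y then kap * rho y x else 0))"
    unfolding sum_subtractf[symmetric]
  proof (rule sum.cong)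
    fix y assume "y \<in> A"
    then have "y \<in> carrier G" using A by auto
    then show "laurent_bar (lmul s f y) * rho y x = laurent_bar (f (s \<otimes> y)) * rho y x
        - laurent_bar (f y) * (if len (s \<otimes> y) < len y then kap * rho y x else 0)"
      by (simp add: lmul_def bar_add bar_kap_mult algebra_simps)
  qed simp
  also have "(\<Sum>y\<in>A. laurent_bar (f (s \<otimes> y)) * rho y x) = (\<Sum>y\<in>A. laurent_bar (f y) * rho (s \<otimes> y) x)"
    using A s by (subst sum.reindex_bij_betw[OF bij, symmetric]) (auto intro!: sum.cong)
  also have "\<dots> - (\<Sum>y\<in>A. laurent_bar (f y) * (if len (s \<otimes> y) < len y then kap * rho y x else 0))
      = (\<Sum>y\<in>A. laurent_bar (f y) * lmuli s (rho y) x)"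
    unfolding sum_subtractf[symmetric]
    using A s by (intro sum.cong) (auto simp: lmuli_rho algebra_simps)
  also have "\<dots> = lmuli s (Bar f) x"
  proof -
    have B: "Bar f y = (\<Sum>z\<in>A. laurent_bar (f z) * rho z y)" for y
      using A by (intro Bar_superset) auto
    show ?thesis
      unfolding lmuli_def lmul_def B
      by (auto simp: sum_distrib_left sum_subtractf algebra_simps sum.distrib)
  qed
  finally show ?thesis .
qed

end

section \<open>The Kazhdan--Lusztig basis\<close>

context halfspace_group
begin

text \<open>Multiplication by \<open>C'\<^sub>s = H\<^sub>s + v\<^sup>-\<^sup>1\<close>.\<close>

definition cmul :: "'a \<Rightarrow> ('a \<Rightarrow> laurent) \<Rightarrow> 'a \<Rightarrow> laurent" where
  "cmul s f x = lmul s f x + vpow (- 1) * f x"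

text \<open>
  The coordinates of \<open>C'\<^sub>w\<close> in the normalised basis: \<open>f y = v\<^bsup>\<ell>(y) - \<ell>(w)\<^esup> P\<^bsub>y,w\<^esub>(v\<^sup>2)\<close>.
\<close>

definition kl :: "'a \<Rightarrow> ('a \<Rightarrow> laurent) \<Rightarrow> bool" where
  "kl w f \<longleftrightarrow> (\<forall>y. f y \<noteq> 0 \<longrightarrow> ble y w) \<and> f w = 1
     \<and> (\<forall>y k. y \<noteq> w \<longrightarrow> Poly_Mapping.lookup (f y) k \<noteq> 0 \<longrightarrow>
          k < 0 \<and> int (len y) - int (len w) \<le> k \<and> even (k - (int (len y) - int (len w))))
     \<and> Bar f = f"

lemma supported_cmul: "s \<in> S \<Longrightarrow> supported f \<Longrightarrow> supported (cmul s f)"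
  using supported_add[OF supported_lmul supported_scale] by (simp add: cmul_def[abs_def])

lemma cmul_up:
  "x \<in> carrier G \<Longrightarrow> len x < len (s \<otimes> x) \<Longrightarrow> cmul s f x = f (s \<otimes> x) + vpow (- 1) * f x"
  by (simp add: cmul_def lmul_def)

lemma cmul_down:
  "x \<in> carrier G \<Longrightarrow> len (s \<otimes> x) < len x \<Longrightarrow> cmul s f x = f (s \<otimes> x) + vpow 1 * f x"
  by (simp add: cmul_def lmul_def kap_def algebra_simps)

text \<open>The generator \<open>C'_s\<close> is bar invariant, because the inverse of
  \<open>H_s\<close> plus \<open>v\<close> equals \<open>H_s\<close> plus the inverse of
  \<open>v\<close>.\<close>

lemma Bar_cmul:
  assumes "s \<in> S" "supported f"
  shows "Bar (cmul s f) x = cmul s (Bar f) x"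
proof -
  have "Bar (cmul s f) x = lmuli s (Bar f) x + vpow 1 * Bar f x"
    using Bar_add[OF supported_lmul supported_scale, OF assms assms(2), of "vpow (- 1)" x]
      Bar_lmul[OF assms] Bar_vpow[OF assms(2), of "- 1"]
    by (simp add: cmul_def[abs_def])
  then show ?thesis by (simp add: lmuli_def cmul_def kap_def algebra_simps)
qed

section \<open>Uniqueness and existence of the Kazhdan--Lusztig basis\<close>

lemma kl_supported: "kl w f \<Longrightarrow> w \<in> carrier G \<Longrightarrow> supported f"
  by (rule supported_subset[OF finite_ble[of w]]) (auto simp: kl_def ble_carrier)

lemma kl_ble: "kl w f \<Longrightarrow> f y \<noteq> 0 \<Longrightarrow> ble y w"
  by (simp add: kl_def)

lemma kl_self: "kl w f \<Longrightarrow> f w = 1"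
  by (simp add: kl_def)

lemma kl_exponents:
  assumes "kl w f" "y \<noteq> w" "Poly_Mapping.lookup (f y) k \<noteq> 0"
  shows "k < 0" "int (len y) - int (len w) \<le> k" "even (k - (int (len y) - int (len w)))"
  using assms unfolding kl_def by blast+

text \<open>At an element \<open>z\<close> of maximal length in the support, unitriangularity
  reduces bar invariance of \<open>d\<close> to invariance of the Laurent polynomial
  \<open>d z\<close> under inversion of \<open>v\<close>; a nonzero invariant polynomial has an
  exponent that is not negative.\<close>

lemma bar_invariant_negative_zero:
  assumes d: "supported d" and bar: "Bar d = d"
    and neg: "\<And>y k. Poly_Mapping.lookup (d y) k \<noteq> 0 \<Longrightarrow> k < 0"
  shows "d x = 0"
proof (rule ccontr)
  assume "d x \<noteq> 0"
  let ?A = "{x. d x \<noteq> 0}"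
  have A: "finite ?A" "?A \<subseteq> carrier G" using d by (simp_all add: supported_def)
  have "Max (len ` ?A) \<in> len ` ?A" using A \<open>d x \<noteq> 0\<close> by (intro Max_in) auto
  then obtain z where z: "z \<in> ?A" "len z = Max (len ` ?A)" by auto
  have le: "len y \<le> len z" if "y \<in> ?A" for y using that z A by simp
  have "d z = Bar d z" using bar by simp
  also have "\<dots> = (\<Sum>y\<in>?A. if y = z then laurent_bar (d y) else 0)"
    unfolding Bar_def
  proof (rule sum.cong)
    fix y assume y: "y \<in> ?A"
    then have "rho y z = dl y z" using rho_triangular[of y z] le A z by auto
    then show "laurent_bar (d y) * rho y z = (if y = z then laurent_bar (d y) else 0)"
      by (simp add: dl_def)
  qed simp
  also have "\<dots> = laurent_bar (d z)" using A z by simp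
  finally have "Poly_Mapping.lookup (d z) k = Poly_Mapping.lookup (d z) (- k)" for k
    by (metis lookup_bar)
  moreover obtain k where "Poly_Mapping.lookup (d z) k \<noteq> 0"
    using z by (auto simp: poly_mapping_eq_iff fun_eq_iff)
  ultimately show False using neg[of z k] neg[of z "- k"] by fastforce
qed

lemma kl_unique:
  assumes "w \<in> carrier G" "kl w f" "kl w g"
  shows "f = g"
proof
  fix x
  have s: "supported f" "supported g" using kl_supported assms by auto
  have "f x - g x = 0"
  proof (rule bar_invariant_negative_zero[of "\<lambda>x. f x - g x"])
    show "Bar (\<lambda>x. f x - g x) = (\<lambda>x. f x - g x)"
      using Bar_minus[OF s] assms by (auto simp: kl_def fun_eq_iff)
    fix y k assume "Poly_Mapping.lookup (f y - g y) k \<noteq> 0"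
    then have "y \<noteq> w" "Poly_Mapping.lookup (f y) k \<noteq> 0 \<or> Poly_Mapping.lookup (g y) k \<noteq> 0"
      using kl_self[OF assms(2)] kl_self[OF assms(3)] by (auto simp: lookup_minus)
    then show "k < 0" using kl_exponents[OF assms(2)] kl_exponents[OF assms(3)] by blast
  qed (use s supported_minus in auto)
  then show "f x = g x" by simp
qed

text \<open>The recursion of Kazhdan and Lusztig. The product of \<open>C'_s\<close> with the
  element at \<open>v\<close> is bar invariant and correctly supported, but may have constant terms
  at elements \<open>z\<close> that descend under \<open>s\<close>; these constants are the
  mu-coefficients, and subtracting multiples of the elements at such \<open>z\<close> removes
  them.\<close>

lemma kl_step:
  assumes s: "s \<in> S" and v: "v \<in> carrier G" and up: "len v < len (s \<otimes> v)"
    and f: "kl v f"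
    and Z: "Z = {z. ble z v \<and> z \<noteq> v \<and> len (s \<otimes> z) < len z}"
    and g: "\<And>z. z \<in> Z \<Longrightarrow> kl z (g z)"
  shows "kl (s \<otimes> v) (\<lambda>x. cmul s f x - (\<Sum>z\<in>Z. of_int (Poly_Mapping.lookup (f z) (- 1)) * g z x))"
proof -
  define c where "c z = Poly_Mapping.lookup (f z) (- 1)" for z
  define h where "h x = cmul s f x - (\<Sum>z\<in>Z. of_int (c z) * g z x)" for x
  let ?u = "s \<otimes> v"
  have u: "?u \<in> carrier G" "len ?u = Suc (len v)" using s v up len_S_cases[OF s v] by auto
  have fZ: "finite Z" using finite_ble[OF v] by (auto simp: Z intro: finite_subset)
  have Zc: "z \<in> carrier G" "ble z v" "len z < len v" if "z \<in> Z" for z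
    using that ble_carrier[of z v] v ble_len[of z v] by (auto simp: Z)
  have sf: "supported f" using kl_supported f v by blast
  have sg: "supported (g z)" if "z \<in> Z" for z using kl_supported g Zc that by blast
  have gle: "ble y v" "len y \<le> len z" if "z \<in> Z" "g z y \<noteq> 0" for z y
    using kl_ble[OF g[OF that(1)] that(2)] Zc[OF that(1)] ble_trans ble_len by fastforce+
  have supp: "ble y ?u" if "h y \<noteq> 0" for y
  proof -
    from that have "f y \<noteq> 0 \<or> (y \<in> carrier G \<and> f (s \<otimes> y) \<noteq> 0) \<or> (\<exists>z\<in>Z. g z y \<noteq> 0)"
      unfolding h_def cmul_def lmul_def by (auto split: if_splits intro!: sum.neutral)
    then have "ble y v \<or> (y \<in> carrier G \<and> ble (s \<otimes> y) v)"
      using kl_ble[OF f] gle by blast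
    then show ?thesis
      using ble_S_lift_up[OF s _ v up, of y] ble_S_lift_up[OF s _ v up, of "s \<otimes> y"] s by auto
  qed
  have top: "h ?u = 1"
  proof -
    have "f ?u = 0" using kl_ble[OF f] ble_len[of ?u v] up by fastforce
    moreover have "g z ?u = 0" if "z \<in> Z" for z using gle[OF that] ble_len[of ?u v] up by fastforce
    ultimately show ?thesis
      using s v u kl_self[OF f] by (simp add: h_def cmul_down)
  qed
  have low: "k < 0 \<and> int (len y) - int (len ?u) \<le> k \<and> even (k - (int (len y) - int (len ?u)))"
    if y: "y \<noteq> ?u" and k: "Poly_Mapping.lookup (h y) k \<noteq> 0" for y k
  proof -
    have yc: "y \<in> carrier G" using supp[of y] k u ble_carrier by fastforce
    have sy: "s \<otimes> y \<noteq> v" using y s yc by auto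
    have h_lookup: "Poly_Mapping.lookup (h y) k = Poly_Mapping.lookup (cmul s f y) k
        - (\<Sum>z\<in>Z. c z * Poly_Mapping.lookup (g z y) k)" for k
      by (simp add: h_def lookup_minus lookup_sum)
    have nz: "Poly_Mapping.lookup (cmul s f y) k \<noteq> 0 \<or> (\<exists>z\<in>Z. c z * Poly_Mapping.lookup (g z y) k \<noteq> 0)"
    proof (rule ccontr)
      assume n: "\<not> ?thesis"
      then have "(\<Sum>z\<in>Z. c z * Poly_Mapping.lookup (g z y) k) = 0" by (intro sum.neutral) blast
      with n k h_lookup[of k] show False by simp
    qed
    \<comment> \<open>A nonzero mu-coefficient forces the lengths of \<open>z\<close> and
      \<open>v\<close> to differ by an odd number, so exponents of the right parity relative to
      \<open>z\<close> have the right parity relative to \<open>s \<otimes> v\<close> as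
      well.\<close>
    have par: "even (- 1 - (int (len z) - int (len v)))" if "z \<in> Z" "c z \<noteq> 0" for z
      using kl_exponents(3)[OF f, of z "- 1"] that by (auto simp: c_def Z)
    have gterm: "k < 0 \<and> int (len y) - int (len ?u) \<le> k \<and> even (k - (int (len y) - int (len ?u)))"
      if "z \<in> Z" "y \<noteq> z" "c z * Poly_Mapping.lookup (g z y) k \<noteq> 0" for z k
      using kl_exponents[OF g[OF that(1)] that(2), of k] that(3) par[OF that(1)] Zc(3)[OF that(1)] u
      by (auto; presburger)
    have fsy: "k < 0 \<and> int (len y) - int (len ?u) \<le> k \<and> even (k - (int (len y) - int (len ?u)))"
      if "Poly_Mapping.lookup (f (s \<otimes> y)) k \<noteq> 0" for k
      using kl_exponents[OF f sy that] len_S_cases[OF s yc] u by auto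
    show ?thesis
    proof (cases "len y < len (s \<otimes> y)")
      case True
      then have e: "Poly_Mapping.lookup (cmul s f y) k
          = Poly_Mapping.lookup (f (s \<otimes> y)) k + Poly_Mapping.lookup (f y) (k + 1)"
        using yc by (simp add: cmul_up lookup_add)
      have "Poly_Mapping.lookup (f (s \<otimes> y)) k \<noteq> 0 \<or> Poly_Mapping.lookup (f y) (k + 1) \<noteq> 0
          \<or> (\<exists>z\<in>Z. c z * Poly_Mapping.lookup (g z y) k \<noteq> 0)"
        using nz unfolding e by linarith
      then show ?thesis
      proof (elim disjE bexE)
        assume a: "Poly_Mapping.lookup (f y) (k + 1) \<noteq> 0"
        show ?thesis
        proof (cases "y = v")
          case True
          then have "k = - 1" using a kl_self[OF f] by (auto simp: lookup_one when_def split: if_splits)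
          then show ?thesis using True u by simp
        next
          case False
          show ?thesis using kl_exponents[OF f False a] u by auto
        qed
      next
        fix z assume z: "z \<in> Z" and nz: "c z * Poly_Mapping.lookup (g z y) k \<noteq> 0"
        moreover have "y \<noteq> z" using True z by (auto simp: Z)
        ultimately show ?thesis using gterm by blast
      qed (use fsy in blast)
    next
      case False
      then have down: "len (s \<otimes> y) < len y" using len_S_cases[OF s yc] by auto
      then have e: "Poly_Mapping.lookup (cmul s f y) k
          = Poly_Mapping.lookup (f (s \<otimes> y)) k + Poly_Mapping.lookup (f y) (k - 1)" for k
        using yc by (simp add: cmul_down lookup_add)
      have yv: "y \<noteq> v" using down up by auto
      \<comment> \<open>At a descending \<open>y\<close> the factor \<open>v\<close> moves the
        exponent -1 of \<open>f y\<close> to 0. The resulting constant is \<open>c y\<close>, and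
        the subtracted term at \<open>z = y\<close>, whose own coordinate is 1, cancels it.\<close>
      have "k \<noteq> 0"
      proof
        assume "k = 0"
        have gz: "Poly_Mapping.lookup (g z y) 0 = (if z = y then 1 else 0)" if "z \<in> Z" for z
          using kl_self[OF g[OF that]] kl_exponents(1)[OF g[OF that], of y 0] by auto
        then have "(\<Sum>z\<in>Z. c z * Poly_Mapping.lookup (g z y) 0) = (\<Sum>z\<in>Z. if z = y then c z else 0)"
          by (intro sum.cong refl) (simp add: gz)
        also have "\<dots> = c y"
          using fZ down yv kl_ble[OF f, of y] by (cases "f y = 0") (auto simp: Z c_def)
        finally show False
          using k e[of 0] fsy[of 0] \<open>k = 0\<close> unfolding h_lookup by (auto simp: c_def)
      qed
      have "Poly_Mapping.lookup (f (s \<otimes> y)) k \<noteq> 0 \<or> Poly_Mapping.lookup (f y) (k - 1) \<noteq> 0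
          \<or> (\<exists>z\<in>Z. c z * Poly_Mapping.lookup (g z y) k \<noteq> 0)"
        using nz unfolding e by linarith
      then show ?thesis
      proof (elim disjE bexE)
        assume a: "Poly_Mapping.lookup (f y) (k - 1) \<noteq> 0"
        show ?thesis using kl_exponents[OF f yv a] u \<open>k \<noteq> 0\<close> by auto
      next
        fix z assume z: "z \<in> Z" and nz: "c z * Poly_Mapping.lookup (g z y) k \<noteq> 0"
        moreover have "y \<noteq> z"
          using nz \<open>k \<noteq> 0\<close> kl_self[OF g[OF z]] by (auto simp: lookup_one when_def)
        ultimately show ?thesis using gterm by blast
      qed (use fsy in blast)
    qed
  qed
  have "Bar h = h"
  proof
    fix x
    have "Bar h x = Bar (cmul s f) x - Bar (\<lambda>x. \<Sum>z\<in>Z. of_int (c z) * g z x) x"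
      unfolding h_def[abs_def]
      by (intro Bar_minus supported_cmul supported_sum supported_scale) (use s sf sg in auto)
    also have "\<dots> = cmul s f x - (\<Sum>z\<in>Z. of_int (c z) * g z x)"
      using Bar_cmul[OF s sf] Bar_sum[of Z g c x] fZ sg f g by (simp add: kl_def)
    finally show "Bar h x = h x" by (simp add: h_def)
  qed
  then have "kl ?u h" unfolding kl_def using supp top low by blast
  then show ?thesis unfolding h_def[abs_def] c_def .
qed

lemma kl_exists: "w \<in> carrier G \<Longrightarrow> \<exists>f. kl w f"
proof (induction "len w" arbitrary: w rule: less_induct)
  case less
  show ?case
  proof (cases "w = \<one>")
    case True
    have "Bar (dl \<one>) = dl \<one>"
    proof
      fix x show "Bar (dl \<one>) x = dl \<one> x"
        by (subst Bar_superset[of "{\<one>}"]) (simp_all add: dl_def rho_one split: if_splits)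
    qed
    then have "kl \<one> (dl \<one>)" by (auto simp: kl_def dl_def)
    then show ?thesis using True by blast
  next
    case False
    then obtain s where s: "s \<in> S" "len (s \<otimes> w) < len w" using exists_descent less by blast
    define v where "v = s \<otimes> w"
    have v: "v \<in> carrier G" "w = s \<otimes> v" "len v < len w" using s less by (auto simp: v_def)
    define Z where "Z = {z. ble z v \<and> z \<noteq> v \<and> len (s \<otimes> z) < len z}"
    obtain f where f: "kl v f" using less v by blast
    have "\<exists>f. kl z f" if "z \<in> Z" for z
      using that ble_len[of z v] ble_carrier[of z v] less v by (auto simp: Z_def)
    then obtain g where "\<And>z. z \<in> Z \<Longrightarrow> kl z (g z)" by metis
    then show ?thesis using kl_step[OF s(1) v(1) _ f Z_def] v by auto
  qed
qed

section \<open>Recursion, descents and mu-coefficients\<close>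

definition klf :: "'a \<Rightarrow> 'a \<Rightarrow> laurent" where
  "klf w = (THE f. kl w f)"

lemma klf_eqI: "w \<in> carrier G \<Longrightarrow> kl w f \<Longrightarrow> klf w = f"
  unfolding klf_def using kl_unique by (intro the_equality) auto

lemma kl_klf: "w \<in> carrier G \<Longrightarrow> kl w (klf w)"
  using kl_exists klf_eqI by metis

lemma klf_one: "klf \<one> = dl \<one>"
proof
  fix x show "klf \<one> x = dl \<one> x"
    using kl_klf[of \<one>] kl_ble[of \<one> "klf \<one>" x] kl_self[of \<one> "klf \<one>"] ble_len[of x \<one>]
    by (auto simp: dl_def)
qed

lemma klf_rec:
  assumes s: "s \<in> S" and v: "v \<in> carrier G" and up: "len v < len (s \<otimes> v)"
  shows "klf (s \<otimes> v) x = cmul s (klf v) x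
    - (\<Sum>z | ble z v \<and> z \<noteq> v \<and> len (s \<otimes> z) < len z. of_int (Poly_Mapping.lookup (klf v z) (- 1)) * klf z x)"
proof -
  have "kl (s \<otimes> v) (\<lambda>x. cmul s (klf v) x
    - (\<Sum>z | ble z v \<and> z \<noteq> v \<and> len (s \<otimes> z) < len z. of_int (Poly_Mapping.lookup (klf v z) (- 1)) * klf z x))"
    using kl_step[OF s v up kl_klf[OF v] refl, of klf] kl_klf ble_carrier v by blast
  from klf_eqI[OF _ this] s v show ?thesis by simp
qed

text \<open>The equality of the Kazhdan--Lusztig polynomials at \<open>x\<close> and
  \<open>s \<otimes> x\<close> when \<open>s\<close> is a left descent of \<open>w\<close>. It
  propagates through the recursion: \<open>cmul s f\<close> has this symmetry for every
  \<open>f\<close>, and the subtracted elements are shorter and have \<open>s\<close> as a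
  descent.\<close>

lemma klf_descent:
  assumes "s \<in> S" "w \<in> carrier G" "len (s \<otimes> w) < len w" "x \<in> carrier G" "len x < len (s \<otimes> x)"
  shows "klf w (s \<otimes> x) = vpow 1 * klf w x"
  using assms
proof (induction "len w" arbitrary: w rule: less_induct)
  case less
  note s = \<open>s \<in> S\<close> and x = \<open>x \<in> carrier G\<close> \<open>len x < len (s \<otimes> x)\<close>
  define v where "v = s \<otimes> w"
  have v: "v \<in> carrier G" "w = s \<otimes> v" "len v < len w" using less by (auto simp: v_def)
  have c: "cmul s f (s \<otimes> x) = vpow 1 * cmul s f x" for f
    using s x by (simp add: cmul_up cmul_down distrib_left)
  let ?Z = "{z. ble z v \<and> z \<noteq> v \<and> len (s \<otimes> z) < len z}"
  have "klf z (s \<otimes> x) = vpow 1 * klf z x" if "z \<in> ?Z" for z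
    using that ble_len[of z v] ble_carrier[of z v] less v by auto
  then show ?case
    using v s c by (simp add: klf_rec right_diff_distrib sum_distrib_left mult.left_commute)
qed

text \<open>By \<open>klf_descent\<close> the coefficient at exponent -1 for \<open>z\<close> is the
  constant coefficient for \<open>t \<otimes> z\<close>, and all exponents off the diagonal are
  negative.\<close>

lemma mu_descent:
  assumes t: "t \<in> S" and v: "v \<in> carrier G" "len (t \<otimes> v) < len v"
    and z: "z \<in> carrier G" "len z < len (t \<otimes> z)"
  shows "Poly_Mapping.lookup (klf v z) (- 1) = (if v = t \<otimes> z then 1 else 0)"
proof -
  have "Poly_Mapping.lookup (klf v z) (- 1) = Poly_Mapping.lookup (klf v (t \<otimes> z)) 0"
    using klf_descent[OF t v z] by simp
  then show ?thesis
    using kl_self[OF kl_klf[OF v(1)]] kl_exponents(1)[OF kl_klf[OF v(1)], of "t \<otimes> z" 0] by auto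
qed

section \<open>Kazhdan--Lusztig polynomials and their inverses\<close>

lemma lookup_laurent_of_poly:
  "Poly_Mapping.lookup (laurent_of_poly p) k = (if even k \<and> 0 \<le> k then coeff p (nat (k div 2)) else 0)"
proof -
  have "Poly_Mapping.lookup (laurent_of_poly p) k = (\<Sum>i\<le>degree p. if 2 * int i = k then coeff p i else 0)"
    by (simp add: laurent_of_poly_def lookup_sum lookup_single when_def)
  also have "\<dots> = (if even k \<and> 0 \<le> k then coeff p (nat (k div 2)) else 0)"
  proof (cases "even k \<and> 0 \<le> k")
    case True
    then obtain m where m: "k = 2 * int m" by (metis evenE zero_le_mult_iff zero_less_numeral not_less nat_0_le)
    have "(\<Sum>i\<le>degree p. if 2 * int i = k then coeff p i else 0)
        = (\<Sum>i\<le>degree p. if i = m then coeff p i else 0)"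
      by (rule sum.cong) (auto simp: m)
    then show ?thesis using m by (simp add: coeff_eq_0)
  next
    case False
    then show ?thesis by (auto intro!: sum.neutral)
  qed
  finally show ?thesis .
qed

lemma ev_laurent_of_poly: "laurent_ev (laurent_of_poly p) = poly p 1"
proof -
  have "laurent_ev (Poly_Mapping.single k c) = c" for k c
    by (simp add: laurent_ev_def)
  then show ?thesis by (simp add: laurent_of_poly_def ev_sum poly_altdef)
qed

lemma laurent_of_poly_inject: "laurent_of_poly p = laurent_of_poly q \<Longrightarrow> p = q"
proof (rule poly_eqI)
  fix i assume "laurent_of_poly p = laurent_of_poly q"
  then have "Poly_Mapping.lookup (laurent_of_poly p) (2 * int i) = Poly_Mapping.lookup (laurent_of_poly q) (2 * int i)"
    by simp
  then show "coeff p i = coeff q i" by (simp add: lookup_laurent_of_poly)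
qed

lemma laurent_of_poly_0 [simp]: "laurent_of_poly 0 = 0"
  by (simp add: laurent_of_poly_def)

lemma laurent_of_poly_1 [simp]: "laurent_of_poly 1 = 1"
  by (simp add: laurent_of_poly_def)

definition famf :: "'a \<Rightarrow> ('a \<Rightarrow> int poly) \<Rightarrow> 'a \<Rightarrow> laurent" where
  "famf w p y = vpow (int (len y) - int (len w)) * laurent_of_poly (p y)"

lemma lookup_KL_element:
  assumes "w \<in> carrier G"
  shows "Poly_Mapping.lookup (KL_element G S w p) y
    = (if ble y w then vpow (- int (len w)) * laurent_of_poly (p y) else 0)"
  using finite_ble[OF assms]
  by (simp add: KL_element_def lookup_sum hecke_T_def lookup_single when_def if_distrib[of "(*) _"] cong: if_cong)

lemma nf_KL_element:
  assumes "w \<in> carrier G" "\<And>y. \<not> ble y w \<Longrightarrow> p y = 0"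
  shows "nf (KL_element G S w p) = famf w p"
  using assms(2) by (auto simp: fun_eq_iff nf_def famf_def lookup_KL_element[OF assms(1)])

lemma keys_KL_element: "w \<in> carrier G \<Longrightarrow> Poly_Mapping.keys (KL_element G S w p) \<subseteq> carrier G"
  using ble_carrier by (auto simp: in_keys_iff lookup_KL_element split: if_splits)

text \<open>The shift by \<open>len y - len w\<close> turns the degree bound into negativity of all
  exponents; being a polynomial in q gives the lower bound and the parity.
  \<open>kl_KL_family\<close> reads the same dictionary backwards.\<close>

lemma KL_family_kl:
  assumes w: "w \<in> carrier G" and p: "is_KL_family G S w p"
  shows "kl w (famf w p)"
proof -
  have p': "\<And>y. \<not> ble y w \<Longrightarrow> p y = 0" "p w = 1"
    "\<And>y. ble y w \<Longrightarrow> y \<noteq> w \<Longrightarrow> 2 * degree (p y) + len y + 1 \<le> len w"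
    "hecke_bar G S (KL_element G S w p) = KL_element G S w p"
    using p unfolding is_KL_family_def by auto
  have "Bar (famf w p) = famf w p"
    using nf_hecke_bar[OF keys_KL_element[OF w]] nf_KL_element[of w p] p' w by metis
  moreover have "ble y w" if "famf w p y \<noteq> 0" for y
    using that p'(1)[of y] by (cases "ble y w") (auto simp: famf_def)
  moreover have "k < 0 \<and> int (len y) - int (len w) \<le> k \<and> even (k - (int (len y) - int (len w)))"
    if y: "y \<noteq> w" and k: "Poly_Mapping.lookup (famf w p y) k \<noteq> 0" for y k
  proof -
    let ?j = "k - (int (len y) - int (len w))"
    have j: "even ?j" "0 \<le> ?j" "coeff (p y) (nat (?j div 2)) \<noteq> 0"
      using k by (auto simp: famf_def lookup_laurent_of_poly split: if_splits)
    then have "nat (?j div 2) \<le> degree (p y)" "p y \<noteq> 0" by (auto intro: le_degree)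
    then have d: "nat (?j div 2) \<le> degree (p y)" and le: "ble y w" using p'(1)[of y] by blast+
    obtain m where m: "?j = 2 * m" using j(1) by (elim evenE)
    then have "m \<le> int (degree (p y))" using d by simp
    then show ?thesis using p'(3)[OF le y] j(1,2) m by simp
  qed
  ultimately show ?thesis using p'(2) by (simp add: kl_def famf_def)
qed

lemma kl_KL_family:
  assumes w: "w \<in> carrier G" and f: "kl w f"
  shows "\<exists>p. is_KL_family G S w p \<and> famf w p = f"
proof -
  \<comment> \<open>The coefficient of the i-th power of q sits at exponent 2i + len y - len w.
    Exponents are at most 0, so i never exceeds \<open>len w\<close>.\<close>
  define p where "p y = (\<Sum>i\<le>len w. monom (Poly_Mapping.lookup (f y) (2 * int i + int (len y) - int (len w))) i)" for y
  have range: "k \<le> 0 \<and> int (len y) - int (len w) \<le> k \<and> even (k - (int (len y) - int (len w)))"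
    if "Poly_Mapping.lookup (f y) k \<noteq> 0" for y k
  proof (cases "y = w")
    case True
    then show ?thesis using that kl_self[OF f] by (simp add: lookup_one when_def split: if_splits)
  next
    case False
    then show ?thesis using kl_exponents[OF f False that] by simp
  qed
  have cf: "coeff (p y) i = Poly_Mapping.lookup (f y) (2 * int i + int (len y) - int (len w))" for y i
  proof -
    have "coeff (p y) i = (if i \<le> len w then Poly_Mapping.lookup (f y) (2 * int i + int (len y) - int (len w)) else 0)"
      by (simp add: p_def coeff_sum)
    moreover have "Poly_Mapping.lookup (f y) (2 * int i + int (len y) - int (len w)) = 0" if "\<not> i \<le> len w"
      by (rule ccontr) (use that range[of y "2 * int i + int (len y) - int (len w)"] in auto)
    ultimately show ?thesis by simp
  qed
  have F: "famf w p = f"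
  proof (rule ext, rule poly_mapping_eqI)
    fix y k
    let ?j = "k - (int (len y) - int (len w))"
    have "2 * int (nat (?j div 2)) + int (len y) - int (len w) = k" if "even ?j" "0 \<le> ?j"
      using that by auto
    then show "Poly_Mapping.lookup (famf w p y) k = Poly_Mapping.lookup (f y) k"
      using range[of y k] by (auto simp: famf_def lookup_laurent_of_poly cf)
  qed
  have p0: "p y = 0" if "\<not> ble y w" for y
    using that kl_ble[OF f, of y] by (cases "f y = 0") (auto simp: p_def)
  have "p w = 1"
  proof (rule laurent_of_poly_inject)
    show "laurent_of_poly (p w) = laurent_of_poly 1"
      using fun_cong[OF F, of w] kl_self[OF f] by (simp add: famf_def)
  qed
  moreover have "2 * degree (p y) + len y + 1 \<le> len w" if y: "ble y w" "y \<noteq> w" for y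
  proof (cases "p y = 0")
    case True
    then show ?thesis using ble_len[OF y(1)] y(2) by simp
  next
    case False
    then have "coeff (p y) (degree (p y)) \<noteq> 0" by simp
    then show ?thesis unfolding cf using kl_exponents(1)[OF f y(2)] by fastforce
  qed
  moreover have "hecke_bar G S (KL_element G S w p) = KL_element G S w p"
  proof (rule nf_inject)
    show "nf (hecke_bar G S (KL_element G S w p)) = nf (KL_element G S w p)"
      using nf_hecke_bar[OF keys_KL_element[OF w]] nf_KL_element[of w p] p0 w F f
      by (simp add: kl_def)
  qed
  ultimately have "is_KL_family G S w p" unfolding is_KL_family_def using p0 by blast
  then show ?thesis using F by blast
qed

lemma klf_KL_poly:
  assumes w: "w \<in> carrier G"
  shows "klf w y = vpow (int (len y) - int (len w)) * laurent_of_poly (KL_poly G S y w)"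
proof -
  obtain p where p: "is_KL_family G S w p" "famf w p = klf w"
    using kl_KL_family[OF w kl_klf[OF w]] by blast
  have "(THE p. is_KL_family G S w p) = p"
  proof (rule the_equality[of "is_KL_family G S w" p, OF p(1)])
    fix p' assume "is_KL_family G S w p'"
    then have "famf w p' = famf w p" using KL_family_kl klf_eqI w p(2) by metis
    then have "laurent_of_poly (p' y) = laurent_of_poly (p y)" for y
      by (auto simp: famf_def fun_eq_iff)
    then show "p' = p" using laurent_of_poly_inject by blast
  qed
  then show ?thesis unfolding KL_poly_def p(2)[symmetric] famf_def by simp
qed

section \<open>Kazhdan--Lusztig polynomials at one and the inverse matrix\<close>

definition klc :: "'a \<Rightarrow> 'a \<Rightarrow> int" where
  "klc w y = laurent_ev (klf w y)"

lemma klc_0: "w \<in> carrier G \<Longrightarrow> \<not> ble y w \<Longrightarrow> klc w y = 0"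
  using kl_ble[OF kl_klf[of w], of y] by (cases "klf w y = 0") (auto simp: klc_def)

lemma klc_self: "w \<in> carrier G \<Longrightarrow> klc w w = 1"
  using kl_self[OF kl_klf[of w]] by (simp add: klc_def)

lemma lookup_KL_C:
  assumes w: "w \<in> carrier G"
  shows "Poly_Mapping.lookup (KL_C G S w) y = klc w y"
proof -
  have "Poly_Mapping.lookup (KL_C G S w) y = (if ble y w then klc w y else 0)"
    using finite_ble[OF w]
    by (simp add: KL_C_def lookup_sum lookup_single when_def klc_def klf_KL_poly[OF w] ev_laurent_of_poly)
  then show ?thesis using klc_0[OF w] by simp
qed

text \<open>Linear independence by unitriangularity: at the longest element with a nonzero
  coefficient no other term contributes.\<close>

lemma klc_combination_zero:
  assumes A: "finite A" "A \<subseteq> carrier G" and z: "\<And>x. (\<Sum>u\<in>A. d u * klc u x) = 0" and u: "u \<in> A"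
  shows "d u = 0"
proof (rule ccontr)
  assume "d u \<noteq> 0"
  let ?B = "{u\<in>A. d u \<noteq> 0}"
  have "Max (len ` ?B) \<in> len ` ?B" using A u \<open>d u \<noteq> 0\<close> by (intro Max_in) auto
  then obtain y where y: "y \<in> ?B" "len y = Max (len ` ?B)" by auto
  have le: "len x \<le> len y" if "x \<in> ?B" for x using that y A by simp
  have "(\<Sum>u\<in>A. d u * klc u y) = (\<Sum>u\<in>A. if u = y then d u else 0)"
  proof (rule sum.cong)
    fix x assume x: "x \<in> A"
    show "d x * klc x y = (if x = y then d x else 0)"
    proof (cases "x = y \<or> d x = 0")
      case True
      then show ?thesis using klc_self[of x] x A by auto
    next
      case False
      then have "\<not> ble y x" using ble_len[of y x] le[of x] x by auto
      then show ?thesis using klc_0[of x y] x A False by auto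
    qed
  qed simp
  with z[of y] y A show False by simp
qed

lemma single_klc_combination:
  assumes "w \<in> carrier G"
  shows "\<exists>c. (\<forall>u. \<not> ble u w \<longrightarrow> c u = 0) \<and> (\<forall>x. (\<Sum>u | ble u w. c u * klc u x) = (if x = w then 1 else 0))"
  using assms
proof (induction "len w" arbitrary: w rule: less_induct)
  case less
  define A where "A = {u. ble u w}"
  define B where "B = A - {w}"
  have fA: "finite A" using finite_ble less by (simp add: A_def)
  have B: "ble y w" "y \<in> carrier G" "len y < len w" if "y \<in> B" for y
    using that ble_len[of y w] ble_carrier[of y w] less by (auto simp: A_def B_def)
  have "\<exists>c. (\<forall>u. \<not> ble u y \<longrightarrow> c u = 0) \<and> (\<forall>x. (\<Sum>u | ble u y. c u * klc u x) = (if x = y then 1 else 0))"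
    if "y \<in> B" for y
    using less B[OF that] by blast
  then obtain c where c0: "\<And>y u. y \<in> B \<Longrightarrow> \<not> ble u y \<Longrightarrow> c y u = 0"
    and c1: "\<And>y x. y \<in> B \<Longrightarrow> (\<Sum>u | ble u y. c y u * klc u x) = (if x = y then 1 else 0)"
    by metis
  \<comment> \<open>This solves C_w = w + sum of the \<open>klc w y\<close> times y over the y below
    w for w, each such y being expanded by the induction hypothesis.\<close>
  define e where "e u = (if u = w then 1 else 0) - (\<Sum>y\<in>B. klc w y * c y u)" for u
  have c2: "(\<Sum>u\<in>A. c y u * klc u x) = (if x = y then 1 else 0)" if y: "y \<in> B" for x y
  proof -
    have "(\<Sum>u\<in>A. c y u * klc u x) = (\<Sum>u | ble u y. c y u * klc u x)"
      using fA ble_trans[of _ y w] B[OF y] c0[OF y]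
      by (intro sum.mono_neutral_right) (auto simp: A_def)
    then show ?thesis using c1[OF y] by simp
  qed
  have "e u = 0" if "\<not> ble u w" for u
  proof -
    have "c y u = 0" if "y \<in> B" for y
      using c0[OF that] B(1)[OF that] ble_trans[of u y w] \<open>\<not> ble u w\<close> by blast
    then show ?thesis using that by (auto simp: e_def)
  qed
  moreover have "(\<Sum>u\<in>A. e u * klc u x) = (if x = w then 1 else 0)" for x
  proof -
    have "(\<Sum>u\<in>A. e u * klc u x) = (\<Sum>u\<in>A. (if u = w then klc u x else 0))
        - (\<Sum>u\<in>A. \<Sum>y\<in>B. klc w y * c y u * klc u x)"
      unfolding sum_subtractf[symmetric]
      by (intro sum.cong) (auto simp: e_def left_diff_distrib sum_distrib_right)
    also have "(\<Sum>u\<in>A. \<Sum>y\<in>B. klc w y * c y u * klc u x) = (\<Sum>y\<in>B. \<Sum>u\<in>A. klc w y * c y u * klc u x)"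
      by (rule sum.swap)
    also have "\<dots> = (\<Sum>y\<in>B. klc w y * (\<Sum>u\<in>A. c y u * klc u x))"
      by (simp add: sum_distrib_left mult.assoc)
    also have "\<dots> = (\<Sum>y\<in>B. if y = x then klc w y else 0)"
      using c2 by (intro sum.cong) auto
    also have "(\<Sum>u\<in>A. (if u = w then klc u x else 0)) - \<dots> = (if x = w then 1 else 0)"
      using fA klc_0[of w x] klc_self[of w] less by (auto simp: A_def B_def)
    finally show ?thesis .
  qed
  ultimately show ?case unfolding A_def by (intro exI[of _ e]) auto
qed

text \<open>The description in \<open>inv_KL\<close> is legitimate: signs are invertible, so
  existence is \<open>single_klc_combination\<close> and uniqueness is
  \<open>klc_combination_zero\<close>.\<close>

lemma inv_KL_spec:
  assumes w: "w \<in> carrier G"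
  shows "\<And>u. \<not> ble u w \<Longrightarrow> inv_KL G S u w = 0"
    and "\<And>x. (\<Sum>u | ble u w. sgn_cox (w \<otimes> inv u) * inv_KL G S u w * klc u x) = (if x = w then 1 else 0)"
proof -
  define A where "A = {u. ble u w}"
  have A: "finite A" "A \<subseteq> carrier G" using finite_ble w ble_carrier by (auto simp: A_def)
  define Q where "Q m \<longleftrightarrow> (\<forall>u. \<not> ble u w \<longrightarrow> m u = 0)
      \<and> Poly_Mapping.single w 1 = (\<Sum>u\<in>{u. ble u w}.
          pm_scale (cox_sign G S (w \<otimes> inv u) * m u) (KL_C G S u))" for m
  have Q: "Q m \<longleftrightarrow> (\<forall>u. \<not> ble u w \<longrightarrow> m u = 0)
      \<and> (\<forall>x. (\<Sum>u\<in>A. sgn_cox (w \<otimes> inv u) * m u * klc u x) = (if x = w then 1 else 0))" for m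
  proof -
    have "Poly_Mapping.lookup (\<Sum>u\<in>{u. ble u w}. pm_scale (cox_sign G S (w \<otimes> inv u) * m u) (KL_C G S u)) x
        = (\<Sum>u\<in>A. sgn_cox (w \<otimes> inv u) * m u * klc u x)" for x
      unfolding A_def[symmetric] lookup_sum
      by (rule sum.cong) (use A lookup_KL_C in auto)
    then show ?thesis
      unfolding Q_def poly_mapping_eq_iff fun_eq_iff by (auto simp: lookup_single when_def)
  qed
  obtain c where c: "\<forall>u. \<not> ble u w \<longrightarrow> c u = 0"
    "\<forall>x. (\<Sum>u\<in>A. c u * klc u x) = (if x = w then 1 else 0)"
    using single_klc_combination[OF w] unfolding A_def by blast
  have "Q (\<lambda>u. sgn_cox (w \<otimes> inv u) * c u)"
    using c by (simp add: Q flip: mult.assoc)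
  moreover have "m = m'" if "Q m" "Q m'" for m m'
  proof
    fix u
    show "m u = m' u"
    proof (cases "ble u w")
      case True
      have "sgn_cox (w \<otimes> inv u) * (m u - m' u) = 0"
      proof (rule klc_combination_zero[OF A, of "\<lambda>u. sgn_cox (w \<otimes> inv u) * (m u - m' u)"])
        show "(\<Sum>u\<in>A. sgn_cox (w \<otimes> inv u) * (m u - m' u) * klc u x) = 0" for x
          using that unfolding Q by (simp add: algebra_simps sum_subtractf)
      qed (use True in \<open>simp add: A_def\<close>)
      then show ?thesis by (auto simp: cox_sign_def)
    qed (use that Q in auto)
  qed
  ultimately have "Q (THE m. Q m)" by (intro theI[of Q]) auto
  moreover have "inv_KL G S u w = (THE m. Q m) u" for u
    unfolding inv_KL_def Q_def by simp
  ultimately have "Q (\<lambda>u. inv_KL G S u w)" by simp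
  then show "\<And>u. \<not> ble u w \<Longrightarrow> inv_KL G S u w = 0"
    "\<And>x. (\<Sum>u | ble u w. sgn_cox (w \<otimes> inv u) * inv_KL G S u w * klc u x) = (if x = w then 1 else 0)"
    by (simp_all add: Q A_def)
qed

lemma inv_KL_self:
  assumes w: "w \<in> carrier G"
  shows "inv_KL G S w w = 1"
proof -
  have "(\<Sum>u | ble u w. sgn_cox (w \<otimes> inv u) * inv_KL G S u w * klc u w)
      = (\<Sum>u | ble u w. if u = w then inv_KL G S u w else 0)"
  proof (rule sum.cong)
    fix u assume "u \<in> {u. ble u w}"
    then have u: "ble u w" "u \<in> carrier G" using ble_carrier w by auto
    show "sgn_cox (w \<otimes> inv u) * inv_KL G S u w * klc u w = (if u = w then inv_KL G S u w else 0)"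
      using klc_self[OF w] klc_0[OF u(2), of w] ble_antisym[OF u(1)] w by (auto simp: cox_sign_def)
  qed simp
  then show ?thesis using inv_KL_spec(2)[OF w, of w] finite_ble[OF w] by simp
qed

end

section \<open>A cell with a tree as W-graph\<close>

text \<open>
  The vertex \<open>z\<close> stands for the element \<open>el z\<close>, the product of the labels on the path from \<open>z\<close> to the
  root; the root stands for the identity.  The last axiom makes the span of the remaining \<open>C\<^sub>w\<close> a
  left ideal.
\<close>

locale cell_tree = halfspace_group +
  fixes V :: "'z set" and root :: 'z and lab :: "'z \<Rightarrow> 'a" and par :: "'z \<Rightarrow> 'z" and dep :: "'z \<Rightarrow> nat"
  assumes V_finite: "finite V" and root_V: "root \<in> V" and dep_root: "dep root = 0"
    and lab_S: "z \<in> V \<Longrightarrow> z \<noteq> root \<Longrightarrow> lab z \<in> S"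
    and par_V: "z \<in> V \<Longrightarrow> z \<noteq> root \<Longrightarrow> par z \<in> V"
    and dep_par: "z \<in> V \<Longrightarrow> z \<noteq> root \<Longrightarrow> dep z = Suc (dep (par z))"
    and siblings: "y \<in> V \<Longrightarrow> z \<in> V \<Longrightarrow> y \<noteq> root \<Longrightarrow> z \<noteq> root \<Longrightarrow> par y = par z \<Longrightarrow> lab y = lab z \<Longrightarrow> y = z"
    and lab_alternates: "z \<in> V \<Longrightarrow> z \<noteq> root \<Longrightarrow> par z \<noteq> root \<Longrightarrow> lab (par z) \<noteq> lab z"
    and tree_closed: "z \<in> V \<Longrightarrow> z \<noteq> root \<Longrightarrow> t \<in> S \<Longrightarrow> t \<noteq> lab z \<Longrightarrow>
      lab z \<otimes> t = t \<otimes> lab z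
      \<or> (\<exists>y\<in>V. y \<noteq> root \<and> par y = z \<and> lab y = t)
      \<or> (par z \<noteq> root \<and> lab (par z) = t \<and> lab z \<otimes> (t \<otimes> lab z) = t \<otimes> (lab z \<otimes> t))
      \<or> (par z \<noteq> root \<and> par (par z) \<noteq> root \<and> lab (par z) = t \<and> lab (par (par z)) = lab z
          \<and> lab z \<otimes> (t \<otimes> (lab z \<otimes> t)) = t \<otimes> (lab z \<otimes> (t \<otimes> lab z)))"
begin

primrec path_prod :: "nat \<Rightarrow> 'z \<Rightarrow> 'a" where
  "path_prod 0 z = \<one>"
| "path_prod (Suc k) z = lab z \<otimes> path_prod k (par z)"

definition el :: "'z \<Rightarrow> 'a" where
  "el z = path_prod (dep z) z"

abbreviation children :: "'z \<Rightarrow> 'z set" where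
  "children z \<equiv> {y\<in>V. y \<noteq> root \<and> par y = z}"

lemma el_root [simp]: "el root = \<one>"
  by (simp add: el_def dep_root)

lemma el_par: "z \<in> V \<Longrightarrow> z \<noteq> root \<Longrightarrow> el z = lab z \<otimes> el (par z)"
  by (simp add: el_def dep_par)

lemma el_carrier [simp]: "z \<in> V \<Longrightarrow> el z \<in> carrier G"
proof (induction "dep z" arbitrary: z)
  case 0
  then show ?case by (cases "z = root") (auto simp: dep_par)
next
  case (Suc k)
  then show ?case using dep_par par_V lab_S el_par by (cases "z = root") auto
qed

end

text \<open>
  \<open>mm z g\<close> is the coordinate at \<open>z\<close> of \<open>g\<close> applied to the root, in the representation attached to the
  W-graph, up to signs.
\<close>

locale cell_tree_module = cell_tree G S P V root lab par dep
  for G (structure) and S :: "'a set" and P and V :: "'z set" and root lab par dep +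
  fixes mm :: "'z \<Rightarrow> 'a \<Rightarrow> int"
  assumes mm_one: "z \<in> V \<Longrightarrow> mm z \<one> = (if z = root then 1 else 0)"
    and mm_fixed: "z \<in> V \<Longrightarrow> s \<in> S \<Longrightarrow> g \<in> carrier G \<Longrightarrow> z = root \<or> lab z \<noteq> s \<Longrightarrow> mm z (s \<otimes> g) = mm z g"
    and mm_moved: "z \<in> V \<Longrightarrow> z \<noteq> root \<Longrightarrow> g \<in> carrier G \<Longrightarrow>
      mm z (lab z \<otimes> g) + mm z g = mm (par z) g + (\<Sum>y\<in>children z. mm y g)"
begin

text \<open>The signs removed in \<open>mm\<close> are restored. The factor \<open>sgn_cox g\<close>
  is the one in the definition of the inverse coefficients; the power of -1 alternates along edges
  and makes all coefficients in the action of s + 1 positive.\<close>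

definition phi :: "'z \<Rightarrow> 'a \<Rightarrow> int" where
  "phi z g = sgn_cox g * (- 1) ^ dep z * mm z g"

definition act :: "('a \<Rightarrow> laurent) \<Rightarrow> 'z \<Rightarrow> int" where
  "act f z = (\<Sum>y | f y \<noteq> 0. laurent_ev (f y) * phi z y)"

lemma act_superset:
  assumes "finite A" "\<And>y. f y \<noteq> 0 \<Longrightarrow> y \<in> A"
  shows "act f z = (\<Sum>y\<in>A. laurent_ev (f y) * phi z y)"
  unfolding act_def by (rule sum.mono_neutral_left) (use assms in auto)

lemma act_minus:
  assumes "supported f" "supported g"
  shows "act (\<lambda>x. f x - g x) z = act f z - act g z"
  by (subst (1 2 3) act_superset[of "{x. f x \<noteq> 0} \<union> {x. g x \<noteq> 0}"])
     (use assms in \<open>auto simp: supported_def ev_minus left_diff_distrib sum_subtractf\<close>)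

lemma act_add:
  assumes "supported f" "supported g"
  shows "act (\<lambda>x. f x + g x) z = act f z + act g z"
  by (subst (1 2 3) act_superset[of "{x. f x \<noteq> 0} \<union> {x. g x \<noteq> 0}"])
     (use assms in \<open>auto simp: supported_def ev_add distrib_right sum.distrib\<close>)

lemma act_of_int:
  assumes "supported f"
  shows "act (\<lambda>x. of_int c * f x) z = c * act f z"
  by (subst (1 2) act_superset[of "{x. f x \<noteq> 0}"])
     (use assms in \<open>auto simp: supported_def ev_of_int_mult sum_distrib_left mult_ac\<close>)

lemma act_sum:
  assumes "finite I" "\<And>i. i \<in> I \<Longrightarrow> supported (f i)"
  shows "act (\<lambda>x. \<Sum>i\<in>I. of_int (c i) * f i x) z = (\<Sum>i\<in>I. c i * act (f i) z)"
  using assms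
proof (induction I)
  case empty
  then show ?case by (simp add: act_def)
next
  case (insert i I)
  then show ?case
    using act_add[OF supported_scale supported_sum[of I "\<lambda>i x. of_int (c i) * f i x"], of "f i" "of_int (c i)" z]
    by (simp add: supported_scale act_of_int)
qed

lemma phi_S:
  assumes s: "s \<in> S" and g: "g \<in> carrier G" and z: "z \<in> V"
  shows "phi z (s \<otimes> g) + phi z g
    = (if z \<noteq> root \<and> lab z = s then 2 * phi z g + phi (par z) g + (\<Sum>y\<in>children z. phi y g) else 0)"
proof (cases "z \<noteq> root \<and> lab z = s")
  case True
  define K where "K = sgn_cox g * (- 1) ^ dep z"
  have c: "(\<Sum>y\<in>children z. phi y g) = - K * (\<Sum>y\<in>children z. mm y g)"
    unfolding sum_distrib_left by (rule sum.cong) (auto simp: phi_def dep_par K_def)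
  have p: "phi (par z) g = - K * mm (par z) g"
    using True z by (simp add: phi_def dep_par K_def)
  have "mm z (s \<otimes> g) = mm (par z) g + (\<Sum>y\<in>children z. mm y g) - mm z g"
    using mm_moved[OF z _ g] True by auto
  moreover have "phi z (s \<otimes> g) + phi z g = K * (mm z g - mm z (s \<otimes> g))"
    using s g by (simp add: phi_def sgn_cox_S K_def right_diff_distrib)
  ultimately have "phi z (s \<otimes> g) + phi z g
      = 2 * (K * mm z g) + (- K * mm (par z) g) + (- K * (\<Sum>y\<in>children z. mm y g))"
    by (simp only:) (simp add: algebra_simps)
  then show ?thesis
    using True by (simp add: c p) (simp add: phi_def K_def)
next
  case False
  then show ?thesis using mm_fixed[OF z s g] s g by (auto simp: phi_def sgn_cox_S)
qed

text \<open>At v = 1 the operator \<open>cmul s\<close> is multiplication by s + 1. In tree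
  coordinates its image is concentrated at the vertices labelled \<open>s\<close>, with coefficient
  2 on the diagonal and 1 along each edge.\<close>

lemma act_cmul:
  assumes s: "s \<in> S" and f: "supported f" and z: "z \<in> V"
  shows "act (cmul s f) z
    = (if z \<noteq> root \<and> lab z = s then 2 * act f z + act f (par z) + (\<Sum>y\<in>children z. act f y) else 0)"
proof -
  define A where "A = {x. f x \<noteq> 0} \<union> (\<otimes>) s ` {x. f x \<noteq> 0}"
  have A: "finite A" "A \<subseteq> carrier G" "{x. f x \<noteq> 0} \<subseteq> A"
    using f s by (auto simp: A_def supported_def)
  have Ainv: "s \<otimes> y \<in> A" if "y \<in> A" for y
    using that s f by (auto simp: A_def supported_def)
  have bij: "bij_betw ((\<otimes>) s) A A"
    by (rule bij_betwI[of _ _ _ "(\<otimes>) s"]) (use Ainv A s in auto)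
  have B: "act f z = (\<Sum>y\<in>A. laurent_ev (f y) * phi z y)" for z
    using A by (intro act_superset) auto
  have "act (cmul s f) z = (\<Sum>y\<in>A. laurent_ev (cmul s f y) * phi z y)"
  proof (rule act_superset[OF A(1)])
    fix y assume y: "cmul s f y \<noteq> 0"
    then have "f y \<noteq> 0 \<or> (y \<in> carrier G \<and> f (s \<otimes> y) \<noteq> 0)"
      by (auto simp: cmul_def lmul_def split: if_splits)
    then show "y \<in> A" using s by (auto simp: A_def intro!: image_eqI[of y _ "s \<otimes> y"])
  qed
  also have "\<dots> = (\<Sum>y\<in>A. laurent_ev (f (s \<otimes> y)) * phi z y) + (\<Sum>y\<in>A. laurent_ev (f y) * phi z y)"
    unfolding sum.distrib[symmetric]
    by (rule sum.cong) (use A in \<open>auto simp: cmul_def lmul_def ev_add distrib_right\<close>)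
  also have "(\<Sum>y\<in>A. laurent_ev (f (s \<otimes> y)) * phi z y) = (\<Sum>y\<in>A. laurent_ev (f y) * phi z (s \<otimes> y))"
    using A s by (subst sum.reindex_bij_betw[OF bij, symmetric]) (auto intro!: sum.cong)
  also have "\<dots> + (\<Sum>y\<in>A. laurent_ev (f y) * phi z y)
      = (\<Sum>y\<in>A. laurent_ev (f y) * (phi z (s \<otimes> y) + phi z y))"
    by (simp add: distrib_left sum.distrib)
  also have "\<dots> = (\<Sum>y\<in>A. laurent_ev (f y) * (if z \<noteq> root \<and> lab z = s
      then 2 * phi z y + phi (par z) y + (\<Sum>x\<in>children z. phi x y) else 0))"
    using A phi_S[OF s _ z] by (intro sum.cong) (auto simp: subset_iff)
  also have "\<dots> = (if z \<noteq> root \<and> lab z = s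
      then 2 * act f z + act f (par z) + (\<Sum>y\<in>children z. act f y) else 0)"
  proof -
    have "(\<Sum>y\<in>A. laurent_ev (f y) * (\<Sum>x\<in>children z. phi x y)) = (\<Sum>x\<in>children z. act f x)"
      unfolding B sum_distrib_left by (rule sum.swap)
    then show ?thesis
      by (simp add: B distrib_left sum.distrib sum_distrib_left mult.left_commute)
  qed
  finally show ?thesis .
qed

text \<open>The value of the functional \<open>phi z\<close> at the Kazhdan--Lusztig element of
  \<open>w\<close>; the goal is that it is the Kronecker delta of \<open>w\<close> and
  \<open>el z\<close>.\<close>

definition coord :: "'a \<Rightarrow> 'z \<Rightarrow> int" where
  "coord w z = act (klf w) z"

lemma supported_klf: "w \<in> carrier G \<Longrightarrow> supported (klf w)"
  using kl_supported kl_klf by blast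

lemma coord_one: "z \<in> V \<Longrightarrow> coord \<one> z = (if z = root then 1 else 0)"
  unfolding coord_def klf_one
  by (subst act_superset[of "{\<one>}"])
     (simp_all add: dl_def phi_def mm_one cox_sign_def dep_root split: if_splits)

lemma coord_rec:
  assumes s: "s \<in> S" and v: "v \<in> carrier G" and up: "len v < len (s \<otimes> v)"
  shows "coord (s \<otimes> v) z = act (cmul s (klf v)) z
    - (\<Sum>x | ble x v \<and> x \<noteq> v \<and> len (s \<otimes> x) < len x. Poly_Mapping.lookup (klf v x) (- 1) * coord x z)"
proof -
  let ?Z = "{x. ble x v \<and> x \<noteq> v \<and> len (s \<otimes> x) < len x}"
  have Z: "finite ?Z" "\<And>x. x \<in> ?Z \<Longrightarrow> supported (klf x)"
    using finite_ble[OF v] ble_carrier[OF _ v] supported_klf by (auto intro: finite_subset)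
  have "coord (s \<otimes> v) z = act (\<lambda>x. cmul s (klf v) x
      - (\<Sum>y\<in>?Z. of_int (Poly_Mapping.lookup (klf v y) (- 1)) * klf y x)) z"
    unfolding coord_def using klf_rec[OF assms] by presburger
  also have "\<dots> = act (cmul s (klf v)) z
      - act (\<lambda>x. \<Sum>y\<in>?Z. of_int (Poly_Mapping.lookup (klf v y) (- 1)) * klf y x) z"
    by (intro act_minus supported_cmul supported_sum supported_scale s supported_klf[OF v] Z(2))
  finally show ?thesis using act_sum[OF Z] by (simp add: coord_def)
qed

lemma coord_descent:
  assumes s: "s \<in> S" and w: "w \<in> carrier G" "len (s \<otimes> w) < len w" and z: "z \<in> V"
    and nz: "coord w z \<noteq> 0"
  shows "z \<noteq> root \<and> lab z = s"
proof -
  \<comment> \<open>For a left descent \<open>s\<close> of \<open>w\<close>, multiplication by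
    \<open>C'_s\<close> is the scalar v plus its inverse, which becomes 2 at v = 1. The coordinates
    of \<open>w\<close> therefore live on the image of s + 1.\<close>
  have e: "cmul s (klf w) x = vpow 1 * klf w x + vpow (- 1) * klf w x" for x
  proof (cases "x \<in> carrier G")
    case x: True
    from len_S_cases[OF s x] show ?thesis
    proof
      assume "len (s \<otimes> x) = Suc (len x)"
      then show ?thesis using klf_descent[OF s w x] x by (simp add: cmul_up)
    next
      assume "len x = Suc (len (s \<otimes> x))"
      then show ?thesis using klf_descent[OF s w, of "s \<otimes> x"] x s by (simp add: cmul_down)
    qed
  next
    case False
    then show ?thesis using supported_outside[OF supported_klf[OF w(1)]] by (simp add: cmul_def lmul_def)
  qed
  have "act (cmul s (klf w)) z = (\<Sum>y | klf w y \<noteq> 0. laurent_ev (cmul s (klf w) y) * phi z y)"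
    by (rule act_superset) (use supported_klf[OF w(1)] in \<open>auto simp: supported_def e\<close>)
  also have "\<dots> = 2 * coord w z"
    by (simp add: e ev_add coord_def act_def sum_distrib_left algebra_simps)
  finally show ?thesis using act_cmul[OF s supported_klf[OF w(1)] z] nz by (auto split: if_splits)
qed

text \<open>The duality up to length \<open>k\<close>, coupled with the reducedness of the tree
  paths: both are needed at once, since lengths of the \<open>el z\<close> decide which terms of the
  recursion are shorter.\<close>

definition good :: "nat \<Rightarrow> bool" where
  "good k \<longleftrightarrow> (\<forall>z\<in>V. dep z \<le> k \<longrightarrow> len (el z) = dep z \<and> (\<forall>y\<in>V. coord (el z) y = (if y = z then 1 else 0)))
     \<and> (\<forall>w\<in>carrier G. len w \<le> k \<longrightarrow> w \<notin> el ` {z\<in>V. dep z \<le> k} \<longrightarrow> (\<forall>y\<in>V. coord w y = 0))"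

lemma good_el:
  assumes "good k" "z \<in> V" "dep z \<le> k"
  shows "len (el z) = dep z" "y \<in> V \<Longrightarrow> coord (el z) y = (if y = z then 1 else 0)"
  using assms unfolding good_def by auto

lemma good_other:
  assumes "good k" "w \<in> carrier G" "len w \<le> k" "\<And>z. z \<in> V \<Longrightarrow> dep z \<le> k \<Longrightarrow> w \<noteq> el z" "y \<in> V"
  shows "coord w y = 0"
  using assms unfolding good_def by (auto simp: image_iff)

lemma good_inj:
  assumes "good k" "y \<in> V" "z \<in> V" "dep y \<le> k" "dep z \<le> k" "el y = el z"
  shows "y = z"
  using good_el(2)[OF assms(1,2,4), of y] good_el(2)[OF assms(1,3,5), of y] assms(2,6)
  by (simp split: if_splits)

text \<open>The coordinate of \<open>el z\<close> at \<open>z\<close> is 1, so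
  \<open>coord_descent\<close> forces each left descent of \<open>el z\<close> to be the label of
  \<open>z\<close>.\<close>

lemma good_descent:
  assumes k: "good k" and z: "z \<in> V" "dep z \<le> k" and s: "s \<in> S"
  shows "len (s \<otimes> el z) < len (el z) \<longleftrightarrow> z \<noteq> root \<and> lab z = s"
proof
  assume "len (s \<otimes> el z) < len (el z)"
  then show "z \<noteq> root \<and> lab z = s"
    using coord_descent[OF s _ _ z(1), of "el z"] good_el(2)[OF k z z(1)] z by simp
next
  assume a: "z \<noteq> root \<and> lab z = s"
  then have "s \<otimes> el z = el (par z)" using el_par[OF z(1)] par_V z(1) s by simp
  then show "len (s \<otimes> el z) < len (el z)"
    using good_el(1)[OF k z] good_el(1)[OF k, of "par z"] a par_V dep_par[OF z(1)] z by simp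
qed

text \<open>Among the subtracted elements only \<open>el y\<close> has a coordinate at
  \<open>y\<close>, so the whole sum is a single mu-coefficient, and that coefficient is 0 or
  1.\<close>

lemma coord_step:
  assumes k: "good k" and s: "s \<in> S" and v: "v \<in> carrier G" "len v = k" "len (s \<otimes> v) = Suc k"
    and y: "y \<in> V"
  shows "coord (s \<otimes> v) y = act (cmul s (klf v)) y
    - (if y \<noteq> root \<and> lab y = s \<and> dep y < k \<and> (\<exists>t\<in>S. v = t \<otimes> el y) then 1 else 0)"
proof -
  let ?Z = "{x. ble x v \<and> x \<noteq> v \<and> len (s \<otimes> x) < len x}"
  define mu where "mu x = Poly_Mapping.lookup (klf v x) (- 1)" for x
  have Z: "x \<in> carrier G" "len x < k" if "x \<in> ?Z" for x
    using that ble_carrier[of x v] ble_len[of x v] v by auto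
  have fZ: "finite ?Z" using finite_ble[OF v(1)] by (auto intro: finite_subset)
  have "mu x * coord x y = (if x = el y then (if dep y \<le> k then mu x else 0) else 0)" if x: "x \<in> ?Z" for x
  proof (cases "\<exists>z\<in>V. dep z \<le> k \<and> x = el z")
    case True
    then obtain z where z: "z \<in> V" "dep z \<le> k" "x = el z" by blast
    then have "x = el y \<and> dep y \<le> k \<longleftrightarrow> y = z" using good_inj[OF k, of z y] y by auto
    then show ?thesis using good_el(2)[OF k z(1,2) y] z by auto
  next
    case False
    then show ?thesis using good_other[OF k Z(1)[OF x] _ _ y] Z(2)[OF x] y by auto
  qed
  then have "(\<Sum>x\<in>?Z. mu x * coord x y)
      = (\<Sum>x\<in>?Z. if x = el y then (if dep y \<le> k then mu x else 0) else 0)"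
    by (intro sum.cong) auto
  also have "\<dots> = (if el y \<in> ?Z \<and> dep y \<le> k then mu (el y) else 0)" using fZ by simp
  also have "\<dots> = (if y \<noteq> root \<and> lab y = s \<and> dep y < k \<and> (\<exists>t\<in>S. v = t \<otimes> el y) then 1 else 0)"
  proof (cases "y \<noteq> root \<and> lab y = s \<and> dep y < k")
    case True
    then have l: "len (el y) = dep y" "dep y \<le> k" using good_el(1)[OF k y] by auto
    \<comment> \<open>A left descent \<open>t\<close> of \<open>v\<close> differs from
      \<open>s\<close>, while \<open>s\<close> is the only descent of \<open>el y\<close>. Hence
      \<open>mu_descent\<close> applies with \<open>t\<close> and leaves
      \<open>v = t \<otimes> el y\<close> as the only possibility.\<close>
    have "\<one> \<noteq> v" using v True by auto
    then obtain t where t: "t \<in> S" "len (t \<otimes> v) < len v" using exists_descent[OF v(1)] by blast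
    then have "t \<noteq> s" using v by auto
    then have up: "len (el y) < len (t \<otimes> el y)"
      using good_descent[OF k y l(2) t(1)] True len_S_cases[OF t(1), of "el y"] y by auto
    have mu: "mu (el y) = (if v = t \<otimes> el y then 1 else 0)"
      unfolding mu_def using mu_descent[OF t(1) v(1) t(2) _ up] y by simp
    have d: "len (s \<otimes> el y) < len (el y)" using good_descent[OF k y l(2) s] True by simp
    show ?thesis
    proof (cases "\<exists>t\<in>S. v = t \<otimes> el y")
      case ex: True
      then obtain t' where t': "t' \<in> S" "v = t' \<otimes> el y" by blast
      then have b: "ble (el y) v" using ble_S[OF t'(1), of "el y"] y l True v by simp
      have up': "len (el y) < len (t' \<otimes> el y)" using t' v l True by simp
      have "mu (el y) = 1"
        unfolding mu_def using mu_descent[OF t'(1) v(1) _ _ up'] t' up' y by simp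
      then show ?thesis using True ex b d l v by auto
    next
      case False
      then show ?thesis using mu t by auto
    qed
  next
    case False
    moreover have "y \<noteq> root \<and> lab y = s \<and> dep y < k" if "el y \<in> ?Z" "dep y \<le> k"
      using that good_descent[OF k y that(2) s] good_el(1)[OF k y that(2)] Z(2)[OF that(1)] by auto
    ultimately show ?thesis by auto
  qed
  finally show ?thesis using coord_rec[OF s v(1), of y] v by (simp add: mu_def)
qed

text \<open>Multiplication by s + 1 sends \<open>x\<close> to its neighbours labelled
  \<open>s\<close>, children and parent alike; the parent contributes exactly the mu-term that the
  recursion subtracts, so the child survives.\<close>

lemma coord_step_inside:
  assumes k: "good k" and s: "s \<in> S" and x: "x \<in> V" "dep x = k" and up: "len (s \<otimes> el x) = Suc k"
    and y: "y \<in> V"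
  shows "coord (s \<otimes> el x) y = (if y \<noteq> root \<and> lab y = s \<and> par y = x then 1 else 0)"
proof -
  have lx: "len (el x) = k" using good_el(1)[OF k x(1)] x by simp
  have c: "act (klf (el x)) z = (if z = x then 1 else 0)" if "z \<in> V" for z
    using good_el(2)[OF k x(1) _ that] x by (simp add: coord_def)
  have xs: "\<not> (x \<noteq> root \<and> lab x = s)"
    using good_descent[OF k x(1) _ s] x lx up by auto
  have eq: "(y \<noteq> root \<and> lab y = s \<and> dep y < k \<and> (\<exists>t\<in>S. el x = t \<otimes> el y))
      \<longleftrightarrow> (y \<noteq> root \<and> lab y = s \<and> x \<noteq> root \<and> par x = y)"
  proof
    assume a: "y \<noteq> root \<and> lab y = s \<and> dep y < k \<and> (\<exists>t\<in>S. el x = t \<otimes> el y)"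
    then obtain t where t: "t \<in> S" "el x = t \<otimes> el y" by blast
    then have ty: "t \<otimes> el x = el y" using y by simp
    have "len (el y) = dep y" using good_el(1)[OF k y] a by simp
    then have x': "x \<noteq> root \<and> lab x = t" using good_descent[OF k x(1) _ t(1)] x ty lx a by auto
    then have "el (par x) = el y" using el_par[OF x(1)] ty t(1) par_V x(1) by auto
    moreover have "dep (par x) \<le> k" "par x \<in> V" using x' dep_par[OF x(1)] par_V[OF x(1)] x(2) by simp_all
    ultimately have "par x = y" using good_inj[OF k _ y] a by simp
    with a x' show "y \<noteq> root \<and> lab y = s \<and> x \<noteq> root \<and> par x = y" by blast
  next
    assume "y \<noteq> root \<and> lab y = s \<and> x \<noteq> root \<and> par x = y"
    then show "y \<noteq> root \<and> lab y = s \<and> dep y < k \<and> (\<exists>t\<in>S. el x = t \<otimes> el y)"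
      using el_par[OF x(1)] lab_S[OF x(1)] dep_par[OF x(1)] x by auto
  qed
  have "act (cmul s (klf (el x))) y = (if y \<noteq> root \<and> lab y = s
      then (if par y = x then 1 else 0) + (if x \<noteq> root \<and> par x = y then 1 else 0) else 0)"
  proof (cases "y \<noteq> root \<and> lab y = s")
    case True
    then have "y \<noteq> x" using xs by auto
    have "(\<Sum>z\<in>children y. act (klf (el x)) z) = (\<Sum>z\<in>children y. if z = x then 1 else 0)"
      using c by (intro sum.cong) auto
    also have "\<dots> = (if x \<noteq> root \<and> par x = y then 1 else 0)"
      using V_finite x by simp
    finally show ?thesis
      using act_cmul[OF s supported_klf y] c[OF y] c[of "par y"] par_V[OF y] x True \<open>y \<noteq> x\<close> by simp
  next
    case False
    then show ?thesis using act_cmul[OF s supported_klf y] x by auto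
  qed
  then show ?thesis
    using coord_step[OF k s _ lx up y] x unfolding eq by auto
qed

text \<open>A nonzero correction needs \<open>v = t \<otimes> el y\<close> with
  \<open>lab y = s\<close>. The alternatives of \<open>tree_closed\<close> exclude this: a child
  labelled \<open>t\<close> would place \<open>v\<close> in the tree. With \<open>s\<close> and
  \<open>t\<close> commuting, \<open>s \<otimes> v\<close> collapses to
  \<open>t \<otimes> el (par y)\<close>; a braid relation of length 3 or 4 also lets one letter
  cancel. In these cases \<open>s \<otimes> v\<close> is shorter than \<open>v\<close>.\<close>

lemma coord_step_outside:
  assumes k: "good k" and s: "s \<in> S" and v: "v \<in> carrier G" "len v = k" "len (s \<otimes> v) = Suc k"
    and out: "\<And>z. z \<in> V \<Longrightarrow> dep z \<le> k \<Longrightarrow> v \<noteq> el z" and y: "y \<in> V"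
  shows "coord (s \<otimes> v) y = 0"
proof -
  have c: "act (klf v) z = 0" if "z \<in> V" for z
    using good_other[OF k v(1) _ out that] v by (simp add: coord_def)
  have "act (cmul s (klf v)) y = 0"
    using act_cmul[OF s supported_klf[OF v(1)] y] c[OF y] c[OF par_V[OF y]] c by auto
  moreover have False if a: "y \<noteq> root" "lab y = s" "dep y < k" and t: "t \<in> S" "v = t \<otimes> el y" for t
  proof -
    have ly: "len (el z) = dep z" if "z \<in> V" "dep z \<le> dep y" for z
      using good_el(1)[OF k that(1)] that a by simp
    have dy: "k = Suc (dep y)"
      using len_S_cases[OF t(1), of "el y"] ly[OF y] t v a y by auto
    have ts: "t \<noteq> lab y"
    proof
      assume "t = lab y"
      then have "len v < len (el y)" using good_descent[OF k y _ t(1)] a t by simp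
      then show False using ly[OF y] dy v by simp
    qed
    note p = par_V[OF y a(1)] dep_par[OF y a(1)] el_par[OF y a(1)]
    have small: "\<not> len (s \<otimes> v) < k" using v by simp
    from tree_closed[OF y a(1) t(1) ts] show False
    proof (elim disjE)
      assume "lab y \<otimes> t = t \<otimes> lab y"
      then have "s \<otimes> v = t \<otimes> el (par y)"
        using p a t s by (metis S_cancel S_mem el_carrier m_assoc y)
      then show False
        using len_mult_le[of t "el (par y)"] len_S_le[OF t(1)] ly[of "par y"] p t dy v by simp
    next
      assume "\<exists>z\<in>V. z \<noteq> root \<and> par z = y \<and> lab z = t"
      then obtain z where z: "z \<in> V" "z \<noteq> root" "par z = y" "lab z = t" by blast
      then show False using out[OF z(1)] el_par[OF z(1,2)] dep_par[OF z(1,2)] t dy by auto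
    next
      let ?p = "par y"
      assume b: "?p \<noteq> root \<and> lab ?p = t \<and> lab y \<otimes> (t \<otimes> lab y) = t \<otimes> (lab y \<otimes> t)"
      note q = par_V[OF p(1)] dep_par[OF p(1)] el_par[OF p(1)]
      let ?x = "el (par ?p)"
      have x: "?x \<in> carrier G" using q b by simp
      have "v = t \<otimes> (s \<otimes> (t \<otimes> ?x))" using p q b a t by simp
      then have "s \<otimes> v = (s \<otimes> (t \<otimes> s)) \<otimes> (t \<otimes> ?x)" using t s x by (simp add: m_assoc)
      also have "s \<otimes> (t \<otimes> s) = t \<otimes> (s \<otimes> t)" using b a by simp
      also have "\<dots> \<otimes> (t \<otimes> ?x) = t \<otimes> (s \<otimes> ?x)" using t s x by (simp add: m_assoc)
      finally have "len (s \<otimes> v) \<le> len t + (len s + len ?x)"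
        using len_mult_le[of t "s \<otimes> ?x"] len_mult_le[of s ?x] t s x by simp
      then show False
        using len_S_le[OF t(1)] len_S_le[OF s] ly[of "par ?p"] p q b dy v by simp
    next
      let ?p = "par y"
      assume b: "?p \<noteq> root \<and> par ?p \<noteq> root \<and> lab ?p = t \<and> lab (par ?p) = lab y
          \<and> lab y \<otimes> (t \<otimes> (lab y \<otimes> t)) = t \<otimes> (lab y \<otimes> (t \<otimes> lab y))"
      then have b': "?p \<noteq> root" "par ?p \<noteq> root" by auto
      note q = par_V[OF p(1) b'(1)] dep_par[OF p(1) b'(1)] el_par[OF p(1) b'(1)]
      note r = par_V[OF q(1) b'(2)] dep_par[OF q(1) b'(2)] el_par[OF q(1) b'(2)]
      let ?x = "el (par (par ?p))"
      have x: "?x \<in> carrier G" using r by simp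
      have "v = t \<otimes> (s \<otimes> (t \<otimes> (s \<otimes> ?x)))" using p q r b a t by simp
      then have "v = (t \<otimes> (s \<otimes> (t \<otimes> s))) \<otimes> ?x" using t s x by (simp add: m_assoc)
      also have "t \<otimes> (s \<otimes> (t \<otimes> s)) = s \<otimes> (t \<otimes> (s \<otimes> t))" using b a by simp
      finally have "s \<otimes> v = t \<otimes> (s \<otimes> (t \<otimes> ?x))" using t s x by (simp add: m_assoc)
      then have "len (s \<otimes> v) \<le> len t + (len s + (len t + len ?x))"
        using len_mult_le[of t "s \<otimes> (t \<otimes> ?x)"] len_mult_le[of s "t \<otimes> ?x"] len_mult_le[of t ?x] t s x
        by simp
      then show False
        using len_S_le[OF t(1)] len_S_le[OF s] ly[of "par (par ?p)"] p q r dy v by simp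
    qed
  qed
  ultimately show ?thesis using coord_step[OF k s v y] by auto
qed

lemma good: "good k"
proof (induction k)
  case 0
  have r: "z = root" if "z \<in> V" "dep z \<le> 0" for z using that dep_par[of z] by (cases "z = root") auto
  show ?case unfolding good_def
  proof (intro conjI ballI impI)
    fix z y assume z: "z \<in> V" "dep z \<le> 0"
    then show "len (el z) = dep z" using r[of z] by (simp add: dep_root)
    assume "y \<in> V"
    then show "coord (el z) y = (if y = z then 1 else 0)" using r[OF z] by (simp add: coord_one)
  next
    fix w y assume w: "w \<in> carrier G" "len w \<le> 0" "w \<notin> el ` {z \<in> V. dep z \<le> 0}"
    then have "w = el root" by simp
    moreover have "root \<in> {z \<in> V. dep z \<le> 0}" using root_V dep_root by simp
    ultimately show "coord w y = 0" using w(3) by blast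
  qed
next
  case (Suc k)
  have l: "len (el z) = Suc k" if z: "z \<in> V" "dep z = Suc k" for z
  proof -
    have r: "z \<noteq> root" using z dep_root by auto
    note p = par_V[OF z(1) r] dep_par[OF z(1) r] el_par[OF z(1) r] lab_S[OF z(1) r]
    have d: "dep (par z) \<le> k" using z p by simp
    have "\<not> len (lab z \<otimes> el (par z)) < len (el (par z))"
      using good_descent[OF Suc p(1) d p(4)] lab_alternates[OF z(1) r] by auto
    then show ?thesis
      using len_S_cases[OF p(4), of "el (par z)"] good_el(1)[OF Suc p(1) d] p z by auto
  qed
  have c: "coord (el z) y = (if y = z then 1 else 0)" if z: "z \<in> V" "dep z = Suc k" and y: "y \<in> V" for z y
  proof -
    have r: "z \<noteq> root" using z dep_root by auto
    note p = par_V[OF z(1) r] dep_par[OF z(1) r] el_par[OF z(1) r] lab_S[OF z(1) r]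
    have "coord (el z) y = (if y \<noteq> root \<and> lab y = lab z \<and> par y = par z then 1 else 0)"
      using coord_step_inside[OF Suc p(4) p(1) _ _ y] l[OF z] p z by simp
    then show ?thesis using siblings[OF y z(1) _ r] r by auto
  qed
  have o: "coord w y = 0" if w: "w \<in> carrier G" "len w = Suc k" "w \<notin> el ` {z\<in>V. dep z \<le> Suc k}" and y: "y \<in> V" for w y
  proof -
    have "w \<noteq> \<one>" using w by auto
    then obtain s where s: "s \<in> S" "len (s \<otimes> w) < len w" using exists_descent w by blast
    define v where "v = s \<otimes> w"
    have v: "v \<in> carrier G" "s \<otimes> v = w" "len v = k" using s w len_S_cases[OF s(1) w(1)] by (auto simp: v_def)
    show ?thesis
    proof (cases "\<exists>x\<in>V. dep x \<le> k \<and> v = el x")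
      case True
      then obtain x where x: "x \<in> V" "dep x \<le> k" "v = el x" by blast
      then have dx: "dep x = k" using good_el(1)[OF Suc x(1,2)] v by simp
      have "\<not> (y \<noteq> root \<and> lab y = s \<and> par y = x)"
      proof
        assume a: "y \<noteq> root \<and> lab y = s \<and> par y = x"
        then have "el y = w" "dep y = Suc k" using el_par[OF y] dep_par[OF y] x v dx by auto
        then show False using w(3) y by auto
      qed
      then show ?thesis using coord_step_inside[OF Suc s(1) x(1) dx _ y] x v w by auto
    next
      case False
      then show ?thesis using coord_step_outside[OF Suc s(1) v(1,3) _ _ y] v w by auto
    qed
  qed
  show ?case unfolding good_def
  proof (intro conjI ballI impI)
    fix z assume z: "z \<in> V" "dep z \<le> Suc k"
    then show "len (el z) = dep z" using l[of z] good_el(1)[OF Suc, of z] by (cases "dep z = Suc k") auto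
    fix y assume "y \<in> V"
    then show "coord (el z) y = (if y = z then 1 else 0)"
      using c[OF z(1) _, of y] good_el(2)[OF Suc z(1), of y] z by (cases "dep z = Suc k") auto
  next
    fix w y assume w: "w \<in> carrier G" "len w \<le> Suc k" "w \<notin> el ` {z \<in> V. dep z \<le> Suc k}" and y: "y \<in> V"
    show "coord w y = 0"
    proof (cases "len w = Suc k")
      case True
      then show ?thesis using o w y by blast
    next
      case False
      then show ?thesis using good_other[OF Suc w(1) _ _ y] w by force
    qed
  qed
qed

lemma len_el: "z \<in> V \<Longrightarrow> len (el z) = dep z"
  using good_el(1)[OF good] by blast

lemma coord_el:
  assumes "u \<in> carrier G" "z \<in> V"
  shows "coord u z = (if u = el z then 1 else 0)"
proof -
  \<comment> \<open>The bound covers the length of \<open>u\<close> and every depth, so that both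
    halves of \<open>good\<close> are available.\<close>
  define k where "k = Max (insert (len u) (dep ` V))"
  have k: "len u \<le> k" "dep y \<le> k" if "y \<in> V" for y
    using V_finite that by (auto simp: k_def)
  show ?thesis
  proof (cases "\<exists>y\<in>V. u = el y")
    case True
    then obtain y where y: "y \<in> V" "u = el y" by blast
    then show ?thesis
      using good_el(2)[OF good[of k] y(1) k(2)[OF y(1)] assms(2)]
        good_inj[OF good y(1) assms(2) k(2) k(2)] assms(2) by auto
  next
    case False
    then show ?thesis using good_other[OF good assms(1) k(1) _ assms(2)] assms(2) by auto
  qed
qed

text \<open>Applying \<open>phi z\<close> to the expansion of \<open>w\<close> in the
  Kazhdan--Lusztig elements leaves the single term at \<open>el z\<close>. Its sign is that of
  \<open>w\<close> times -1 to the power \<open>dep z\<close>, because \<open>el z\<close> has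
  length \<open>dep z\<close>; the same sign occurs in \<open>phi z w\<close> and cancels.\<close>

theorem inv_KL_el:
  assumes z: "z \<in> V" and w: "w \<in> carrier G"
  shows "inv_KL G S (el z) w = mm z w"
proof -
  let ?A = "{u. ble u w}"
  define m where "m u = inv_KL G S u w" for u
  have A: "finite ?A" "\<And>u. u \<in> ?A \<Longrightarrow> u \<in> carrier G" using finite_ble[OF w] ble_carrier[OF _ w] by auto
  have co: "(\<Sum>x\<in>?A. klc u x * phi z x) = coord u z" if u: "u \<in> ?A" for u
    unfolding coord_def klc_def
    by (rule act_superset[symmetric])
       (use A u kl_ble[OF kl_klf[OF A(2)[OF u]]] ble_trans in blast)+
  have "phi z w = (\<Sum>x\<in>?A. (if x = w then 1 else 0) * phi z x)"
    using A by (simp add: if_distrib[of "\<lambda>c. c * _"] cong: if_cong)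
  also have "\<dots> = (\<Sum>x\<in>?A. (\<Sum>u\<in>?A. sgn_cox (w \<otimes> inv u) * m u * klc u x) * phi z x)"
    unfolding m_def inv_KL_spec(2)[OF w] ..
  also have "\<dots> = (\<Sum>x\<in>?A. \<Sum>u\<in>?A. sgn_cox (w \<otimes> inv u) * m u * (klc u x * phi z x))"
    by (simp add: sum_distrib_right mult.assoc)
  also have "\<dots> = (\<Sum>u\<in>?A. \<Sum>x\<in>?A. sgn_cox (w \<otimes> inv u) * m u * (klc u x * phi z x))"
    by (rule sum.swap)
  also have "\<dots> = (\<Sum>u\<in>?A. if u = el z then sgn_cox (w \<otimes> inv u) * m u else 0)"
    unfolding sum_distrib_left[symmetric]
    by (intro sum.cong) (use A(2) co coord_el z in auto)
  also have "\<dots> = sgn_cox (w \<otimes> inv (el z)) * m (el z)"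
    using A inv_KL_spec(1)[OF w, of "el z"] by (simp add: m_def)
  also have "sgn_cox (w \<otimes> inv (el z)) = sgn_cox w * (- 1) ^ dep z"
    using w z by (simp add: sgn_cox_mult sgn_cox_inv) (simp add: cox_sign_def len_el)
  finally show ?thesis by (simp add: phi_def m_def cox_sign_def)
qed

end

section \<open>The affine Weyl group as a group of motions\<close>

lemma sum_fun_apply: "(\<Sum>i\<in>A. f i) x = (\<Sum>i\<in>A. f i x)" for f :: "'i \<Rightarrow> nat \<Rightarrow> int"
  by (induction A rule: infinite_finite_induct) auto

lemma lattice_elt_apply:
  assumes "1 \<le> n"
  shows "lattice_elt n a b k = (if 1 \<le> k \<and> k \<le> n - 1 then a k else 0)
    - (if 2 \<le> k \<and> k \<le> n then a (k - 1) else 0) + (if k = n then 2 * b else 0)"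
proof -
  have "lattice_elt n a b k = (\<Sum>i=1..n-1. (if k = i then a i else 0) - (if i = k - 1 \<and> k \<noteq> 0 then a i else 0))
      + (if k = n then 2 * b else 0)"
    unfolding lattice_elt_def plus_fun_apply sum_fun_apply
    by (intro arg_cong2[of _ _ _ _ "(+)"] sum.cong)
       (auto simp: zscale_def alpha_def beta_def eps_def right_diff_distrib)
  also have "(\<Sum>i=1..n-1. (if k = i then a i else 0) - (if i = k - 1 \<and> k \<noteq> 0 then a i else 0))
      = (if 1 \<le> k \<and> k \<le> n - 1 then a k else 0) - (if 2 \<le> k \<and> k \<le> n then a (k - 1) else 0)"
    using assms by (cases "k = 0") (auto simp: sum_subtractf)
  finally show ?thesis .
qed

text \<open>The coefficients of a vector are its partial coordinate sums, and the full sum is 2b;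
  evenness of that sum is the only integrality condition.\<close>

lemma coroot_lattice_iff:
  assumes "2 \<le> n"
  shows "x \<in> coroot_lattice n \<longleftrightarrow> (\<forall>k. k \<notin> {1..n} \<longrightarrow> x k = 0) \<and> even (\<Sum>k=1..n. x k)"
proof
  assume "x \<in> coroot_lattice n"
  then obtain a b where x: "x = lattice_elt n a b" by (auto simp: coroot_lattice_def)
  have e: "m \<le> n - 1 \<Longrightarrow> (\<Sum>k=1..m. x k) = (if m = 0 then 0 else a m)" for m
    by (induction m) (use assms in \<open>auto simp: x lattice_elt_apply\<close>)
  have "(\<Sum>k=1..n. x k) = (\<Sum>k=1..n-1. x k) + x n"
    using assms by (cases n) auto
  then have "(\<Sum>k=1..n. x k) = 2 * b"
    using e[of "n - 1"] assms by (simp add: x lattice_elt_apply)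
  moreover have "x k = 0" if "k \<notin> {1..n}" for k
    using that assms by (auto simp: x lattice_elt_apply)
  ultimately show "(\<forall>k. k \<notin> {1..n} \<longrightarrow> x k = 0) \<and> even (\<Sum>k=1..n. x k)" by simp
next
  assume x: "(\<forall>k. k \<notin> {1..n} \<longrightarrow> x k = 0) \<and> even (\<Sum>k=1..n. x k)"
  define a where "a i = (\<Sum>k=1..i. x k)" for i
  define b where "b = a n div 2"
  have b: "2 * b = a n" using x by (simp add: b_def a_def)
  have a: "a k = a (k - 1) + x k" if "1 \<le> k" for k
    using that by (cases k) (auto simp: a_def)
  have "x = lattice_elt n a b"
  proof
    fix k
    show "x k = lattice_elt n a b k"
    proof (cases "k \<in> {1..n}")
      case True
      then show ?thesis using assms a[of k] b a[of 1]
        by (cases "k = 1") (auto simp: lattice_elt_apply a_def)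
    next
      case False
      then show ?thesis using x assms by (auto simp: lattice_elt_apply)
    qed
  qed
  then show "x \<in> coroot_lattice n" unfolding coroot_lattice_def by blast
qed

section \<open>Signed permutations\<close>

lemma weylE:
  assumes "w \<in> weyl n"
  obtains s p where "w = (\<lambda>x k. s k * x (p k))" "p permutes {1..n}"
    "\<And>k. k \<in> {1..n} \<Longrightarrow> s k = 1 \<or> s k = - 1" "\<And>k. k \<notin> {1..n} \<Longrightarrow> s k = 1"
  using assms unfolding weyl_def by auto

lemma weylI:
  "p permutes {1..n} \<Longrightarrow> (\<And>k. k \<in> {1..n} \<Longrightarrow> s k = 1 \<or> s k = - 1) \<Longrightarrow> (\<And>k. k \<notin> {1..n} \<Longrightarrow> s k = 1)
    \<Longrightarrow> (\<lambda>x k. s k * x (p k)) \<in> weyl n"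
  unfolding weyl_def by blast

lemma weyl_id: "id \<in> weyl n"
proof -
  have "(\<lambda>x k. 1 * x (id k)) \<in> weyl n" by (rule weylI[OF permutes_id]) auto
  then show ?thesis by (simp add: id_def)
qed

lemma weyl_comp:
  assumes "w \<in> weyl n" "u \<in> weyl n"
  shows "w \<circ> u \<in> weyl n"
proof -
  obtain s p where w: "w = (\<lambda>x k. s k * x (p k))" "p permutes {1..n}"
    "\<And>k. k \<in> {1..n} \<Longrightarrow> s k = 1 \<or> s k = - 1" "\<And>k. k \<notin> {1..n} \<Longrightarrow> s k = 1"
    by (rule weylE[OF assms(1)]) (rule that, assumption, assumption, blast, blast)
  obtain s' p' where u: "u = (\<lambda>x k. s' k * x (p' k))" "p' permutes {1..n}"
    "\<And>k. k \<in> {1..n} \<Longrightarrow> s' k = 1 \<or> s' k = - 1" "\<And>k. k \<notin> {1..n} \<Longrightarrow> s' k = 1"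
    by (rule weylE[OF assms(2)]) (rule that, assumption, assumption, blast, blast)
  have "(\<lambda>x k. (s k * s' (p k)) * x ((p' \<circ> p) k)) \<in> weyl n"
  proof (rule weylI)
    show "p' \<circ> p permutes {1..n}" using w u permutes_compose by blast
    show "s k * s' (p k) = 1 \<or> s k * s' (p k) = - 1" if "k \<in> {1..n}" for k
      using w(3)[OF that] u(3)[of "p k"] permutes_in_image[OF w(2), of k] that by auto
    show "s k * s' (p k) = 1" if "k \<notin> {1..n}" for k
      using w(4)[OF that] u(4)[of "p k"] permutes_in_image[OF w(2), of k] that by auto
  qed
  moreover have "w \<circ> u = (\<lambda>x k. (s k * s' (p k)) * x ((p' \<circ> p) k))"
    by (simp add: fun_eq_iff w u)
  ultimately show ?thesis by simp
qed

lemma weyl_inverse: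
  assumes "w \<in> weyl n"
  shows "\<exists>u\<in>weyl n. u \<circ> w = id"
proof -
  obtain s p where w: "w = (\<lambda>x k. s k * x (p k))" "p permutes {1..n}"
    "\<And>k. k \<in> {1..n} \<Longrightarrow> s k = 1 \<or> s k = - 1" "\<And>k. k \<notin> {1..n} \<Longrightarrow> s k = 1"
    by (rule weylE[OF assms]) (rule that, assumption, assumption, blast, blast)
  let ?q = "inv_into UNIV p"
  have q: "?q permutes {1..n}" using w(2) by (rule permutes_inv)
  have "(\<lambda>x k. s (?q k) * x (?q k)) \<in> weyl n"
    by (rule weylI[OF q]) (use w(3,4) permutes_in_image[OF q] in blast)+
  moreover have "s k * s k = 1" for k using w(3,4)[of k] by (cases "k \<in> {1..n}") auto
  then have "(\<lambda>x k. s (?q k) * x (?q k)) \<circ> w = id"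
    using permutes_inverses[OF w(2)] by (simp add: fun_eq_iff w(1) flip: mult.assoc)
  ultimately show ?thesis by blast
qed

lemma weyl_add: "w \<in> weyl n \<Longrightarrow> w (x + y) = w x + w y"
  by (elim weylE) (simp add: fun_eq_iff distrib_left)

lemma weyl_lattice:
  assumes "2 \<le> n" "w \<in> weyl n" "x \<in> coroot_lattice n"
  shows "w x \<in> coroot_lattice n"
proof -
  obtain s p where w: "w = (\<lambda>x k. s k * x (p k))" "p permutes {1..n}"
    "\<And>k. k \<in> {1..n} \<Longrightarrow> s k = 1 \<or> s k = - 1" "\<And>k. k \<notin> {1..n} \<Longrightarrow> s k = 1"
    by (rule weylE[OF assms(2)]) (rule that, assumption, assumption, blast, blast)
  have x: "\<And>k. k \<notin> {1..n} \<Longrightarrow> x k = 0" "even (\<Sum>k=1..n. x k)"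
    using assms by (auto simp: coroot_lattice_iff)
  have "even (s k * x (p k) - x (p k))" if "k \<in> {1..n}" for k
    using w(3)[OF that] by auto
  then have "even (\<Sum>k=1..n. s k * x (p k) - x (p k))"
    by (intro dvd_sum) auto
  moreover have "(\<Sum>k=1..n. x (p k)) = (\<Sum>k=1..n. x k)"
    using sum.permute[OF w(2), of x] by (simp add: o_def)
  ultimately have "even (\<Sum>k=1..n. s k * x (p k))"
    using x(2) by (simp add: sum_subtractf)
  moreover have "s k * x (p k) = 0" if "k \<notin> {1..n}" for k
    using x(1)[of "p k"] permutes_in_image[OF w(2), of k] that by auto
  ultimately show ?thesis using assms(1) by (auto simp: coroot_lattice_iff w(1))
qed

text \<open>
  The motion attached to the node \<open>i\<close> of the affine diagram, in units in which the coroot lattice is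
  scaled by \<open>N\<close>; the node \<open>0\<close> is the affine one.
\<close>

definition smap :: "int \<Rightarrow> nat \<Rightarrow> nat \<Rightarrow> vec \<Rightarrow> vec" where
  "smap N n i x k =
    (if i = 0 then (if k = 1 then N - x 2 else if k = 2 then N - x 1 else x k)
     else if i = n then (if k = n then - x n else x k)
     else (if k = i then x (i + 1) else if k = i + 1 then x i else x k))"

definition sref :: "nat \<Rightarrow> nat \<Rightarrow> vec \<times> (vec \<Rightarrow> vec)" where
  "sref n i = (if i = 0 then theta else 0, smap 0 n i)"

text \<open>The point \<open>(n, n - 1, \<dots>, 1)\<close> lies in the fundamental alcove for the lattice scaled by \<open>2n\<close>.\<close>

definition base :: "nat \<Rightarrow> vec" where
  "base n k = (if k \<in> {1..n} then int n + 1 - int k else 0)"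

text \<open>The image of the base point under the motion \<open>g\<close> in the scaled units;
  elements of the group are identified with these integer points.\<close>

definition pt :: "nat \<Rightarrow> vec \<times> (vec \<Rightarrow> vec) \<Rightarrow> vec" where
  "pt n g k = 2 * int n * fst g k + snd g (base n) k"

text \<open>The affine function vanishing on the wall of node \<open>i\<close> and positive on the
  fundamental alcove; for node 0 it measures the distance to the wall where the pairing with
  \<open>theta\<close> equals 2n.\<close>

definition wall :: "nat \<Rightarrow> nat \<Rightarrow> vec \<Rightarrow> int" where
  "wall n i x = (if i = 0 then 2 * int n - x 1 - x 2 else if i = n then x n else x i - x (i + 1))"

locale affine_B =
  fixes n :: nat
  assumes n3: "3 \<le> n"
begin

abbreviation GG where "GG \<equiv> affine_weyl n"
abbreviation SS where "SS \<equiv> simple_reflections n"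

section \<open>The group and its simple reflections\<close>

lemma carrier_GG: "g \<in> carrier GG \<longleftrightarrow> fst g \<in> coroot_lattice n \<and> snd g \<in> weyl n"
  by (cases g) (simp add: affine_weyl_def)

lemma mult_GG: "g \<otimes>\<^bsub>GG\<^esub> h = (fst g + snd g (fst h), snd g \<circ> snd h)"
  by (cases g; cases h) (simp add: affine_weyl_def)

lemma one_GG: "\<one>\<^bsub>GG\<^esub> = (0, id)"
  by (simp add: affine_weyl_def)

lemma lattice_add: "x \<in> coroot_lattice n \<Longrightarrow> y \<in> coroot_lattice n \<Longrightarrow> x + y \<in> coroot_lattice n"
  using n3 by (auto simp: coroot_lattice_iff sum.distrib)

lemma lattice_uminus: "x \<in> coroot_lattice n \<Longrightarrow> - x \<in> coroot_lattice n"
  using n3 by (auto simp: coroot_lattice_iff sum_negf)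

lemma lattice_zero: "0 \<in> coroot_lattice n"
  using n3 by (auto simp: coroot_lattice_iff)

lemma group_GG: "group GG"
proof (rule groupI)
  fix x y assume "x \<in> carrier GG" "y \<in> carrier GG"
  then show "x \<otimes>\<^bsub>GG\<^esub> y \<in> carrier GG"
    using n3 by (simp add: carrier_GG mult_GG lattice_add weyl_lattice weyl_comp)
next
  show "\<one>\<^bsub>GG\<^esub> \<in> carrier GG" by (simp add: carrier_GG one_GG lattice_zero weyl_id)
next
  fix x y z assume "x \<in> carrier GG" "y \<in> carrier GG" "z \<in> carrier GG"
  then show "x \<otimes>\<^bsub>GG\<^esub> y \<otimes>\<^bsub>GG\<^esub> z = x \<otimes>\<^bsub>GG\<^esub> (y \<otimes>\<^bsub>GG\<^esub> z)"
    by (auto simp: carrier_GG mult_GG weyl_add[of _ n] o_assoc add.assoc)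
next
  fix x assume "x \<in> carrier GG"
  then show "\<one>\<^bsub>GG\<^esub> \<otimes>\<^bsub>GG\<^esub> x = x" by (simp add: mult_GG one_GG)
next
  fix x assume x: "x \<in> carrier GG"
  then obtain u where u: "u \<in> weyl n" "u \<circ> snd x = id" using weyl_inverse carrier_GG by blast
  have "(- u (fst x), u) \<in> carrier GG"
    using x u n3 by (simp add: carrier_GG lattice_uminus weyl_lattice)
  moreover have "(- u (fst x), u) \<otimes>\<^bsub>GG\<^esub> x = \<one>\<^bsub>GG\<^esub>" using u by (simp add: mult_GG one_GG)
  ultimately show "\<exists>y\<in>carrier GG. y \<otimes>\<^bsub>GG\<^esub> x = \<one>\<^bsub>GG\<^esub>" by blast
qed

lemma theta_apply: "theta k = (if k = 1 \<or> k = 2 then 1 else 0)"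
  by (simp add: theta_def eps_def)

lemma smap_shift: "smap N n i x = (\<lambda>k. N * (if i = 0 then theta k else 0) + smap 0 n i x k)"
  by (auto simp: smap_def theta_apply fun_eq_iff)

lemma smap_weyl:
  assumes "i \<le> n"
  shows "smap 0 n i \<in> weyl n"
proof -
  consider "i = 0" | "i = n" "i \<noteq> 0" | "1 \<le> i" "i < n" using assms by linarith
  then show ?thesis
  proof cases
    case 1
    have "(\<lambda>x k. (if k = 1 \<or> k = 2 then - 1 else 1) * x (transpose 1 2 k)) \<in> weyl n"
      using n3 by (intro weylI permutes_swap_id) auto
    also have "(\<lambda>x k. (if k = 1 \<or> k = 2 then - 1 else 1) * x (transpose 1 2 k)) = smap 0 n i"
      using 1 by (auto simp: fun_eq_iff smap_def transpose_def)
    finally show ?thesis .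
  next
    case 2
    have "(\<lambda>x k. (if k = n then - 1 else 1) * x (id k)) \<in> weyl n"
      using n3 by (intro weylI permutes_id) auto
    also have "(\<lambda>x k. (if k = n then - 1 else 1) * x (id k)) = smap 0 n i"
      using 2 by (auto simp: fun_eq_iff smap_def)
    finally show ?thesis .
  next
    case 3
    have "(\<lambda>x k. 1 * x (transpose i (i + 1) k)) \<in> weyl n"
      using 3 by (intro weylI permutes_swap_id) auto
    also have "(\<lambda>x k. 1 * x (transpose i (i + 1) k)) = smap 0 n i"
      using 3 by (auto simp: fun_eq_iff smap_def transpose_def)
    finally show ?thesis .
  qed
qed

lemma theta_lattice: "theta \<in> coroot_lattice n"
proof -
  have "(\<Sum>k=1..n. theta k) = (\<Sum>k=1..n. (if k = 1 then 1 else 0) + (if k = 2 then 1 else 0))"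
    by (rule sum.cong) (auto simp: theta_apply)
  also have "\<dots> = 2" using n3 by (simp add: sum.distrib)
  finally show ?thesis using n3 by (auto simp: coroot_lattice_iff theta_apply)
qed

lemma sref_carrier: "i \<le> n \<Longrightarrow> sref n i \<in> carrier GG"
  by (simp add: carrier_GG sref_def smap_weyl theta_lattice lattice_zero)

lemma dot_eps:
  "i \<in> {1..n} \<Longrightarrow> dot n x (zscale c (eps i)) = c * x i"
  "i \<in> {1..n} \<Longrightarrow> dot n x (eps i) = x i"
  "dot n x (y + z) = dot n x y + dot n x z"
  "dot n x (y - z) = dot n x y - dot n x z"
  by (simp_all add: dot_def zscale_def eps_def distrib_left right_diff_distrib sum.distrib sum_subtractf
      if_distrib[of "(*) _"] mult.commute cong: if_cong)

lemma coroot_reflection_alpha: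
  assumes "1 \<le> i" "i \<le> n - 1"
  shows "coroot_reflection n (alpha i) = smap 0 n i"
proof -
  have "dot n x (alpha i) = x i - x (i + 1)" for x
    using assms by (simp add: alpha_def dot_eps)
  moreover from this have "dot n (alpha i) (alpha i) = 2"
    by (simp add: alpha_def eps_def)
  ultimately show ?thesis using assms
    by (auto simp: fun_eq_iff coroot_reflection_def smap_def zscale_def alpha_def eps_def)
qed

lemma coroot_reflection_beta: "coroot_reflection n (beta n) = smap 0 n n"
proof -
  have d: "dot n x (beta n) = 2 * x n" for x
    using n3 by (simp add: beta_def dot_eps)
  moreover from this have "dot n (beta n) (beta n) = 4"
    by (simp add: beta_def zscale_def eps_def)
  ultimately show ?thesis using n3
    by (auto simp: fun_eq_iff coroot_reflection_def smap_def zscale_def beta_def eps_def)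
qed

lemma coroot_reflection_theta: "coroot_reflection n theta = smap 0 n 0"
proof -
  have "dot n x theta = x 1 + x 2" for x
    using n3 by (simp add: theta_def dot_eps)
  moreover from this have "dot n theta theta = 2"
    by (simp add: theta_apply)
  ultimately show ?thesis
    by (auto simp: fun_eq_iff coroot_reflection_def smap_def zscale_def theta_apply)
qed

lemma SS_sref: "SS = sref n ` {0..n}"
proof -
  have "{0..n} = {1..n-1} \<union> {n, 0}" using n3 by auto
  moreover have "sref n ` {1..n-1} = {(0, coroot_reflection n (alpha i)) |i. 1 \<le> i \<and> i \<le> n - 1}"
  proof -
    have "sref n i = (0, coroot_reflection n (alpha i))" if "i \<in> {1..n-1}" for i
      using that coroot_reflection_alpha[of i] by (simp add: sref_def)
    then show ?thesis by (auto simp: image_iff)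
  qed
  moreover have "sref n n = (0, coroot_reflection n (beta n))"
    using n3 by (simp add: sref_def coroot_reflection_beta)
  moreover have "sref n 0 = transl theta \<otimes>\<^bsub>GG\<^esub> (0, coroot_reflection n theta)"
    by (simp add: sref_def coroot_reflection_theta transl_def mult_GG)
  ultimately show ?thesis unfolding simple_reflections_def by (simp add: image_Un)
qed

lemma sref_inj:
  assumes "i \<le> n" "j \<le> n" "sref n i = sref n j"
  shows "i = j"
proof -
  have z: "i = 0 \<longleftrightarrow> j = 0"
    using arg_cong[OF assms(3), of "\<lambda>g. fst g 1"] by (auto simp: sref_def theta_apply split: if_splits)
  \<comment> \<open>The test vector \<open>int\<close> has distinct coordinates: the smaller of two
    positive nodes moves the coordinate carrying its own index, the larger one fixes it.\<close>
  have "smap 0 n i int l \<noteq> int l \<and> smap 0 n j int l = int l" if "0 < i" "i < j" "j \<le> n" "l = i" for i j l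
    using that by (auto simp: smap_def)
  moreover have "smap 0 n i int = smap 0 n j int" using assms(3) by (simp add: sref_def)
  ultimately show ?thesis using z assms by (metis bot_nat_0.not_eq_extremum linorder_neqE_nat)
qed

lemma fst_sref_mult:
  "i \<le> n \<Longrightarrow> fst (sref n i \<otimes>\<^bsub>GG\<^esub> g) = smap 1 n i (fst g)"
  by (subst smap_shift) (auto simp: mult_GG sref_def fun_eq_iff)

lemma pt_mult:
  assumes "g \<in> carrier GG"
  shows "pt n (g \<otimes>\<^bsub>GG\<^esub> h) = (\<lambda>k. 2 * int n * fst g k + snd g (pt n h) k)"
  using assms unfolding carrier_GG
  by (elim conjE weylE) (auto simp: pt_def mult_GG fun_eq_iff algebra_simps)

lemma pt_one: "pt n \<one>\<^bsub>GG\<^esub> = base n"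
  by (simp add: pt_def one_GG fun_eq_iff)

lemma pt_sref_mult:
  assumes "i \<le> n"
  shows "pt n (sref n i \<otimes>\<^bsub>GG\<^esub> g) = smap (2 * int n) n i (pt n g)"
  using pt_mult[OF sref_carrier[OF assms], of g]
  by (subst smap_shift) (auto simp: sref_def fun_eq_iff)

section \<open>Image points modulo 2n\<close>

definition sgnperm :: "vec \<times> (vec \<Rightarrow> vec) \<Rightarrow> (nat \<Rightarrow> int) \<times> (nat \<Rightarrow> nat)" where
  "sgnperm g = (SOME sp. snd g = (\<lambda>x k. fst sp k * x (snd sp k)) \<and> snd sp permutes {1..n}
     \<and> (\<forall>k. fst sp k = 1 \<or> fst sp k = - 1) \<and> (\<forall>k. k \<notin> {1..n} \<longrightarrow> fst sp k = 1))"

lemma pt_form: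
  assumes g: "g \<in> carrier GG" and s: "s = fst (sgnperm g)" and p: "p = snd (sgnperm g)"
  shows "snd g = (\<lambda>x k. s k * x (p k))" "p permutes {1..n}" "\<And>k. s k = 1 \<or> s k = - 1"
    "\<And>k. pt n g k = 2 * int n * fst g k + s k * base n (p k)"
    "\<And>k. k \<in> {1..n} \<Longrightarrow> 1 \<le> base n (p k) \<and> base n (p k) \<le> int n"
    "\<And>k l. k \<in> {1..n} \<Longrightarrow> l \<in> {1..n} \<Longrightarrow> k \<noteq> l \<Longrightarrow> base n (p k) \<noteq> base n (p l)"
    "\<And>k. k \<in> {1..n} \<Longrightarrow> p k \<in> {1..n}" "\<And>k. k \<notin> {1..n} \<Longrightarrow> p k = k"
    "\<And>k l. p k = p l \<longleftrightarrow> k = l" "\<And>k. k \<notin> {1..n} \<Longrightarrow> s k = 1"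
proof -
  let ?Q = "\<lambda>sp. snd g = (\<lambda>x k. fst sp k * x (snd sp k)) \<and> snd sp permutes {1..n}
     \<and> (\<forall>k. fst sp k = 1 \<or> fst sp k = - 1) \<and> (\<forall>k. k \<notin> {1..n} \<longrightarrow> fst sp k = 1)"
  have "snd g \<in> weyl n" using g carrier_GG by blast
  then have "\<exists>sp. ?Q sp"
  proof (rule weylE)
    fix s p assume w: "snd g = (\<lambda>x k. s k * x (p k))" "p permutes {1..n}"
      "\<And>k. k \<in> {1..n} \<Longrightarrow> s k = 1 \<or> s k = - 1" "\<And>k. k \<notin> {1..n} \<Longrightarrow> s k = 1"
    then have "\<forall>k. s k = 1 \<or> s k = - 1" by blast
    with w(1,2,4) show "\<exists>sp. ?Q sp" by (intro exI[of _ "(s, p)"]) simp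
  qed
  then have "?Q (sgnperm g)" unfolding sgnperm_def by (rule someI_ex)
  then have w: "snd g = (\<lambda>x k. s k * x (p k))" "p permutes {1..n}" "\<And>k. s k = 1 \<or> s k = - 1"
    "\<And>k. k \<notin> {1..n} \<Longrightarrow> s k = 1"
    unfolding s p by blast+
  then show "snd g = (\<lambda>x k. s k * x (p k))" "p permutes {1..n}" "\<And>k. s k = 1 \<or> s k = - 1"
    "\<And>k. k \<notin> {1..n} \<Longrightarrow> s k = 1" by blast+
  show "pt n g k = 2 * int n * fst g k + s k * base n (p k)" for k
    by (simp add: pt_def w(1))
  show pin: "p k \<in> {1..n}" if "k \<in> {1..n}" for k using permutes_in_image[OF w(2)] that by blast
  show pe: "p k = p l \<longleftrightarrow> k = l" for k l using permutes_inj[OF w(2)] by (auto dest: injD)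
  show "p k = k" if "k \<notin> {1..n}" for k using w(2) that unfolding permutes_def by blast
  show "1 \<le> base n (p k) \<and> base n (p k) \<le> int n" if "k \<in> {1..n}" for k
    using pin[OF that] by (auto simp: base_def)
  show "base n (p k) \<noteq> base n (p l)" if "k \<in> {1..n}" "l \<in> {1..n}" "k \<noteq> l" for k l
  proof -
    have "p k \<noteq> p l" using pe that by simp
    then show ?thesis using pin[OF that(1)] pin[OF that(2)] by (auto simp: base_def)
  qed
qed

lemma pt_outside:
  assumes g: "g \<in> carrier GG" and k: "k \<notin> {1..n}"
  shows "pt n g k = 0"
proof -
  have "fst g k = 0" using g k n3 by (simp add: carrier_GG coroot_lattice_iff)
  moreover have "base n k = 0" using k by (auto simp: base_def)
  ultimately show ?thesis using pt_form(4)[OF g refl refl, of k] pt_form(8)[OF g refl refl k] by simp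
qed

lemma small_multiple:
  fixes c :: int
  assumes "2 * int n * m + c = 0" "\<bar>c\<bar> < 2 * int n"
  shows "c = 0"
proof -
  have "2 * int n dvd c" using assms(1) by (metis dvd_add_right_iff dvd_0_right dvd_triv_left)
  then show ?thesis using assms(2) dvd_imp_le_int[of c "2 * int n"] by auto
qed

lemma pt_not_multiple:
  assumes g: "g \<in> carrier GG" and k: "k \<in> {1..n}"
  shows "pt n g k \<noteq> 2 * int n * m"
proof
  assume e: "pt n g k = 2 * int n * m"
  define s where "s = fst (sgnperm g)"
  define p where "p = snd (sgnperm g)"
  note w = pt_form[OF g s_def p_def]
  have "2 * int n * (fst g k - m) + s k * base n (p k) = 0"
    using e w(4)[of k] by (simp add: algebra_simps)
  then show False using small_multiple w(3)[of k] w(5)[OF k] n3 by fastforce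
qed

text \<open>Modulo 2n two coordinates of an image point are plus or minus distinct numbers between 1
  and n. Their sums and differences are nonzero and of absolute value below 2n, so no image point
  lies on a wall.\<close>

lemma pt_sum_diff_not_multiple:
  assumes g: "g \<in> carrier GG" and k: "k \<in> {1..n}" "l \<in> {1..n}" "k \<noteq> l"
  shows "pt n g k + pt n g l \<noteq> 2 * int n * m" "pt n g k - pt n g l \<noteq> 0"
proof -
  define s where "s = fst (sgnperm g)"
  define p where "p = snd (sgnperm g)"
  note w = pt_form[OF g s_def p_def]
  note b = w(3)[of k] w(3)[of l] w(5)[OF k(1)] w(5)[OF k(2)] w(6)[OF k]
  show "pt n g k + pt n g l \<noteq> 2 * int n * m"
  proof
    assume "pt n g k + pt n g l = 2 * int n * m"
    then have "2 * int n * (fst g k + fst g l - m) + (s k * base n (p k) + s l * base n (p l)) = 0"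
      using w(4)[of k] w(4)[of l] by (simp add: algebra_simps)
    moreover have "\<bar>s k * base n (p k) + s l * base n (p l)\<bar> < 2 * int n" using b by auto
    ultimately have "s k * base n (p k) + s l * base n (p l) = 0" by (rule small_multiple)
    then show False using b by auto
  qed
  show "pt n g k - pt n g l \<noteq> 0"
  proof
    assume "pt n g k - pt n g l = 0"
    then have "2 * int n * (fst g k - fst g l) + (s k * base n (p k) - s l * base n (p l)) = 0"
      using w(4)[of k] w(4)[of l] by (simp add: algebra_simps)
    moreover have "\<bar>s k * base n (p k) - s l * base n (p l)\<bar> < 2 * int n" using b by auto
    ultimately have "s k * base n (p k) - s l * base n (p l) = 0" by (rule small_multiple)
    then show False using b by auto
  qed
qed

lemma wall_nonzero:
  assumes "g \<in> carrier GG" "i \<le> n"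
  shows "wall n i (pt n g) \<noteq> 0"
  using pt_sum_diff_not_multiple(1)[OF assms(1), of 1 2 1] pt_not_multiple[OF assms(1), of n 0]
    pt_sum_diff_not_multiple(2)[OF assms(1), of i "i + 1"] n3 assms(2)
  by (auto simp: wall_def)

lemma wall_smap: "i \<le> n \<Longrightarrow> wall n i (smap (2 * int n) n i x) = - wall n i x"
  by (auto simp: wall_def smap_def)

lemma wall_base: "i \<le> n \<Longrightarrow> wall n i (base n) = 1"
  using n3 by (auto simp: wall_def base_def)

text \<open>
  Changing the sign of the first coordinate of the base point translates it by \<open>- 2n \<epsilon>\<^sub>1\<close>; this is the
  only ambiguity, and \<open>- \<epsilon>\<^sub>1\<close> is not in the coroot lattice.
\<close>

lemma pt_inj:
  assumes g: "g \<in> carrier GG" and h: "h \<in> carrier GG" and e: "pt n g = pt n h"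
  shows "g = h"
proof -
  define s where "s = fst (sgnperm g)"
  define p where "p = snd (sgnperm g)"
  note w = pt_form[OF g s_def p_def]
  define s' where "s' = fst (sgnperm h)"
  define p' where "p' = snd (sgnperm h)"
  note w' = pt_form[OF h s'_def p'_def]
  have out: "fst g k = fst h k" if "k \<notin> {1..n}" for k
    using g h that n3 by (simp add: carrier_GG coroot_lattice_iff)
  have step: "p k = p' k \<and> (p k \<noteq> 1 \<longrightarrow> fst g k = fst h k) \<and> (fst g k = fst h k \<longrightarrow> s k = s' k)"
    if k: "k \<in> {1..n}" for k
  proof -
    define d where "d = s k * base n (p k) - s' k * base n (p' k)"
    have z: "2 * int n * (fst g k - fst h k) + d = 0"
      using fun_cong[OF e, of k] w(4)[of k] w'(4)[of k] by (simp add: d_def algebra_simps)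
    note b = w(3)[of k] w'(3)[of k] w(5)[OF k] w'(5)[OF k]
    note pin = w(7)[OF k] w'(7)[OF k]
    have beq: "p k = p' k" if "base n (p k) = base n (p' k)"
      using that pin by (auto simp: base_def)
    show ?thesis
    proof (cases "d = 0")
      case True
      then have "s k = s' k" "base n (p k) = base n (p' k)" using b by (auto simp: d_def)
      moreover have "fst g k = fst h k" using True z n3 by simp
      ultimately show ?thesis using beq by blast
    next
      case False
      then have "\<not> \<bar>d\<bar> < 2 * int n" using small_multiple[OF z] by blast
      \<comment> \<open>Both terms of \<open>d\<close> have absolute value at most n, so a
        difference of size 2n forces both to be n, an entry that \<open>base n\<close> takes at
        coordinate 1 alone.\<close>
      then have "base n (p k) = int n" "base n (p' k) = int n" using b by (auto simp: d_def)
      then have "p k = 1" "p k = p' k" using pin beq by (auto simp: base_def)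
      moreover have "fst g k \<noteq> fst h k" using False z by auto
      ultimately show ?thesis by blast
    qed
  qed
  have "surj p" using permutes_surj[OF w(2)] .
  then obtain l where l1: "p l = 1" by (metis surjD)
  then have l: "l \<in> {1..n}" "p l = 1" using w(8)[of l] n3 by (auto intro: ccontr)
  have p1: "k = l" if "p k = 1" for k using w(9)[of k l] that l by simp
  have "fst g k = fst h k" for k
  proof (cases "k = l")
    case False
    then show ?thesis using step[of k] p1[of k] out(1)[of k] by blast
  next
    case True
    \<comment> \<open>The translations can differ only at \<open>l\<close>. Lattice vectors have
      even coordinate sum, so the difference there is even, while its absolute value is at most
      1.\<close>
    have "(\<Sum>k=1..n. fst g k - fst h k) = (\<Sum>k=1..n. if k = l then fst g l - fst h l else 0)"
      by (rule sum.cong) (use step p1 in auto)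
    also have "\<dots> = fst g l - fst h l" using l by simp
    finally have "fst g l - fst h l = (\<Sum>k=1..n. fst g k - fst h k)" ..
    moreover have "even (\<Sum>k=1..n. fst g k - fst h k)"
      using g h n3 by (simp add: carrier_GG coroot_lattice_iff sum_subtractf)
    ultimately have "even (fst g l - fst h l)" by metis
    moreover have "2 * int n * (fst g l - fst h l) = s' l * base n (p' l) - s l * base n (p l)"
      using fun_cong[OF e, of l] w(4)[of l] w'(4)[of l] by (simp add: algebra_simps)
    then have "\<bar>2 * int n * (fst g l - fst h l)\<bar> \<le> 2 * int n"
      using w(3)[of l] w'(3)[of l] w(5)[OF l(1)] w'(5)[OF l(1)] by auto
    then have "\<bar>fst g l - fst h l\<bar> \<le> 1" using n3 by (simp add: abs_mult)
    ultimately show ?thesis using True by presburger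
  qed
  then have f: "fst g = fst h" by blast
  have "s k * x (p k) = s' k * x (p' k)" for x :: vec and k
  proof (cases "k \<in> {1..n}")
    case True
    then show ?thesis using step[OF True] f by simp
  next
    case False
    then show ?thesis using w(8)[OF False] w'(8)[OF False] w(10)[OF False] w'(10)[OF False] by simp
  qed
  then have "snd g = snd h" unfolding w(1) w'(1) by blast
  then show ?thesis using f by (simp add: prod_eq_iff)
qed

section \<open>Crossing a wall\<close>

lemma pt_sref_diff:
  assumes "j \<le> n"
  shows "pt n (sref n j) k - base n k =
    (if j = 0 then (if k = 1 \<or> k = 2 then 1 else 0) else if j = n then (if k = n then - 2 else 0)
     else (if k = j then - 1 else if k = j + 1 then 1 else 0))"
proof -
  interpret group GG by (rule group_GG)
  have "pt n (sref n j) = smap (2 * int n) n j (base n)"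
    using pt_sref_mult[OF assms, of "\<one>\<^bsub>GG\<^esub>"] sref_carrier[OF assms] by (simp add: pt_one)
  then show ?thesis using assms n3 by (auto simp: smap_def base_def)
qed

text \<open>Right multiplication by \<open>sref n j\<close> displaces the image point by a signed
  permutation of the small vector \<open>e\<close>. Integrality makes a change of sign of the wall
  function so tight that the displaced point must be the mirror image in wall \<open>i\<close>;
  \<open>pt_inj\<close> converts this into an equation in the group.\<close>

lemma wall_crossing_unique:
  assumes g: "g \<in> carrier GG" and i: "i \<le> n" and j: "j \<le> n"
    and pos: "0 < wall n i (pt n g)" and neg: "wall n i (pt n (g \<otimes>\<^bsub>GG\<^esub> sref n j)) < 0"
  shows "sref n i \<otimes>\<^bsub>GG\<^esub> g = g \<otimes>\<^bsub>GG\<^esub> sref n j"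
proof -
  interpret group GG by (rule group_GG)
  define Y where "Y = pt n g"
  define Y' where "Y' = pt n (g \<otimes>\<^bsub>GG\<^esub> sref n j)"
  define e where "e k = pt n (sref n j) k - base n k" for k
  note e = pt_sref_diff[OF j, folded e_def]
  define s where "s = fst (sgnperm g)"
  define p where "p = snd (sgnperm g)"
  note w = pt_form[OF g s_def p_def]
  have Y': "Y' k = Y k + s k * e (p k)" for k
    using pt_mult[OF g, of "sref n j"] w(4)[of k] by (simp add: Y'_def Y_def e_def w(1) algebra_simps)
  note pe = w(9)
  have nm: "Y k \<noteq> 2 * int n * m" if "k \<in> {1..n}" for k m
    using pt_not_multiple[OF g that] by (simp add: Y_def)
  have last: "Y k = 2 * int n * fst g k + s k" if "p k = n" for k
    using w(4)[of k] that n3 by (simp add: Y_def base_def)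
  have "Y' = smap (2 * int n) n i Y"
  proof (cases "j = n")
    case True
    then have en: "e k = (if k = n then - 2 else 0)" for k using e n3 by simp
    \<comment> \<open>For \<open>j = n\<close> the moving coordinate is congruent to its sign modulo
      2n. Crossing a wall that involves a second coordinate would force that coordinate to be a
      multiple of 2n, so only wall n can be crossed.\<close>
    have no: False if kl: "k \<in> {1..n}" "l \<in> {1..n}" "p k = n" and "Y l = c * Y k + d"
      and "(c = 1 \<and> d = - s k) \<or> (c = - 1 \<and> d = 2 * int n + s k)" for k l c d
      using that(5)
    proof
      assume "c = 1 \<and> d = - s k"
      then have "Y l = 2 * int n * fst g k" using that(4) last[OF kl(3)] by simp
      then show False using nm[OF kl(2)] by blast
    next
      assume "c = - 1 \<and> d = 2 * int n + s k"
      then have "Y l = 2 * int n * (1 - fst g k)" using that(4) last[OF kl(3)] by (simp add: algebra_simps)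
      then show False using nm[OF kl(2)] by blast
    qed
    consider "i = 0" | "i = n" "i \<noteq> 0" | "1 \<le> i" "i < n" using i by linarith
    then show ?thesis
    proof cases
      case 1
      have p: "Y 1 + Y 2 < 2 * int n" "2 * int n < Y' 1 + Y' 2"
        using pos neg 1 by (auto simp: wall_def Y_def Y'_def)
      have "p 1 \<noteq> p 2" using pe by simp
      then consider "p 1 = n" "p 2 \<noteq> n" | "p 2 = n" "p 1 \<noteq> n"
        using p Y'[of 1] Y'[of 2] by (auto simp: en split: if_splits)
      then show ?thesis
      proof cases
        case a: 1
        then have "s 1 = - 1" "Y 2 = - 1 * Y 1 + (2 * int n + s 1)"
          using p Y'[of 1] Y'[of 2] w(3)[of 1] n3 by (auto simp: en)
        then show ?thesis using no[of 1 2 "- 1"] a n3 by simp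
      next
        case a: 2
        then have "s 2 = - 1" "Y 1 = - 1 * Y 2 + (2 * int n + s 2)"
          using p Y'[of 1] Y'[of 2] w(3)[of 2] n3 by (auto simp: en)
        then show ?thesis using no[of 2 1 "- 1"] a n3 by simp
      qed
    next
      case 2
      have p: "0 < Y n" "Y' n < 0"
        using pos neg 2 by (auto simp: wall_def Y_def Y'_def)
      then have "p n = n" "s n = 1" "Y n = 1"
        using Y'[of n] w(3)[of n] n3 by (auto simp: en split: if_splits)
      then show ?thesis
        using 2 Y' pe[of _ n] by (auto simp: fun_eq_iff smap_def en)
    next
      case 3
      have p: "Y (i + 1) < Y i" "Y' i < Y' (i + 1)"
        using pos neg 3 by (auto simp: wall_def Y_def Y'_def)
      have "p i \<noteq> p (i + 1)" using pe by simp
      then consider "p i = n" "p (i + 1) \<noteq> n" | "p (i + 1) = n" "p i \<noteq> n"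
        using p Y'[of i] Y'[of "i + 1"] by (auto simp: en split: if_splits)
      then show ?thesis
      proof cases
        case a: 1
        then have "s i = 1" "Y (i + 1) = 1 * Y i + (- s i)"
          using p Y'[of i] Y'[of "i + 1"] w(3)[of i] 3 by (auto simp: en)
        then show ?thesis using no[of i "i + 1" 1] a 3 by simp
      next
        case a: 2
        then have "s (i + 1) = - 1" "Y i = 1 * Y (i + 1) + (- s (i + 1))"
          using p Y'[of i] Y'[of "i + 1"] w(3)[of "i + 1"] 3 by (auto simp: en)
        then show ?thesis using no[of "i + 1" i 1] a 3 by simp
      qed
    qed
  next
    case False
    have e1: "e k = - 1 \<or> e k = 0 \<or> e k = 1" for k using e False by auto
    note s1 = w(3)
    have se: "s k * e (p k) = - 1 \<or> s k * e (p k) = 0 \<or> s k * e (p k) = 1" for k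
      using e1[of "p k"] s1[of k] by auto
    \<comment> \<open>For \<open>j \<noteq> n\<close> the displacement has exactly two nonzero
      entries; once both are located, every other coordinate is fixed.\<close>
    have e0: "e (p m) = 0" if "e (p k) \<noteq> 0" "e (p l) \<noteq> 0" "k \<noteq> l" "m \<noteq> k" "m \<noteq> l" for k l m
    proof -
      have "p k \<noteq> p l" "p m \<noteq> p k" "p m \<noteq> p l" using that pe by auto
      then show ?thesis using that(1,2) False unfolding e by (auto split: if_splits)
    qed
    consider "i = 0" | "i = n" "i \<noteq> 0" | "1 \<le> i" "i < n" using i by linarith
    then show ?thesis
    proof cases
      case 1
      have p: "Y 1 + Y 2 < 2 * int n" "2 * int n < Y' 1 + Y' 2"
        using pos neg 1 by (auto simp: wall_def Y_def Y'_def)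
      then have a: "s 1 * e (p 1) = 1" "s 2 * e (p 2) = 1" "Y 1 + Y 2 = 2 * int n - 1"
        using Y'[of 1] Y'[of 2] se[of 1] se[of 2] by linarith+
      then have "e (p 1) \<noteq> 0" "e (p 2) \<noteq> 0" by auto
      then have "e (p m) = 0" if "m \<noteq> 1" "m \<noteq> 2" for m using e0[of 1 2 m] that by simp
      then show ?thesis using 1 Y' a by (auto simp: fun_eq_iff smap_def)
    next
      case 2
      have p: "0 < Y n" "Y' n < 0"
        using pos neg 2 by (auto simp: wall_def Y_def Y'_def)
      then show ?thesis using Y'[of n] se[of n] by linarith
    next
      case 3
      have p: "Y (i + 1) < Y i" "Y' i < Y' (i + 1)"
        using pos neg 3 by (auto simp: wall_def Y_def Y'_def)
      then have a: "s i * e (p i) = - 1" "s (i + 1) * e (p (i + 1)) = 1" "Y i = Y (i + 1) + 1"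
        using Y'[of i] Y'[of "i + 1"] se[of i] se[of "i + 1"] by linarith+
      then have "e (p i) \<noteq> 0" "e (p (i + 1)) \<noteq> 0" by auto
      then have "e (p m) = 0" if "m \<noteq> i" "m \<noteq> i + 1" for m using e0[of i "i + 1" m] that by simp
      then show ?thesis using 3 Y' a by (auto simp: fun_eq_iff smap_def)
    qed
  qed
  then have "pt n (g \<otimes>\<^bsub>GG\<^esub> sref n j) = pt n (sref n i \<otimes>\<^bsub>GG\<^esub> g)"
    using pt_sref_mult[OF i, of g] by (simp add: Y_def Y'_def)
  then show ?thesis
    using pt_inj[of "sref n i \<otimes>\<^bsub>GG\<^esub> g" "g \<otimes>\<^bsub>GG\<^esub> sref n j"] g sref_carrier i j by simp
qed

section \<open>Generation by descent towards the base point\<close>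

lemma sum_two:
  fixes F :: "nat \<Rightarrow> int"
  assumes "k \<in> {1..n}" "l \<in> {1..n}" "k \<noteq> l"
  shows "(\<Sum>j=1..n. F j) = F k + F l + (\<Sum>j\<in>{1..n} - {k, l}. F j)"
proof -
  have "{1..n} - {k, l} = {1..n} - {k} - {l}" by auto
  then show ?thesis
    using assms sum.remove[of "{1..n}" k F] sum.remove[of "{1..n} - {k}" l F] by simp
qed

text \<open>Reflecting in a wall that separates \<open>Y\<close> from the base point brings
  \<open>Y\<close> closer to it; this is the decreasing measure for
  \<open>generated\<close>.\<close>

lemma descent_distance:
  assumes i: "i \<le> n" and neg: "wall n i Y < 0"
  shows "(\<Sum>k=1..n. (smap (2 * int n) n i Y k - base n k)\<^sup>2) < (\<Sum>k=1..n. (Y k - base n k)\<^sup>2)"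
proof -
  consider "i = 0" | "i = n" "i \<noteq> 0" | "1 \<le> i" "i < n" using i by linarith
  then show ?thesis
  proof cases
    case 1
    have "(\<Sum>k\<in>{1..n} - {1, 2}. (smap (2 * int n) n i Y k - base n k)\<^sup>2) = (\<Sum>k\<in>{1..n} - {1, 2}. (Y k - base n k)\<^sup>2)"
      by (rule sum.cong) (auto simp: smap_def 1)
    moreover have b: "base n 1 = int n" "base n 2 = int n - 1" using n3 by (auto simp: base_def)
    have "2 * int n < Y 1 + Y 2" using neg 1 by (simp add: wall_def)
    then have "(smap (2 * int n) n i Y 1 - base n 1)\<^sup>2 + (smap (2 * int n) n i Y 2 - base n 2)\<^sup>2
        < (Y 1 - base n 1)\<^sup>2 + (Y 2 - base n 2)\<^sup>2"
      unfolding b using 1 by (simp add: smap_def power2_eq_square algebra_simps)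
    ultimately show ?thesis using n3
      by (subst (1 2) sum_two[of 1 2]) simp_all
  next
    case 2
    have "(\<Sum>k\<in>{1..n} - {n}. (smap (2 * int n) n i Y k - base n k)\<^sup>2) = (\<Sum>k\<in>{1..n} - {n}. (Y k - base n k)\<^sup>2)"
      by (rule sum.cong) (use 2 in \<open>auto simp: smap_def\<close>)
    moreover have "base n n = 1" using n3 by (auto simp: base_def)
    moreover have "Y n < 0" using neg 2 by (simp add: wall_def)
    ultimately show ?thesis using 2 n3
      by (subst (1 2) sum.remove[of _ n]) (simp_all add: smap_def power2_eq_square algebra_simps)
  next
    case 3
    have "(\<Sum>k\<in>{1..n} - {i, i + 1}. (smap (2 * int n) n i Y k - base n k)\<^sup>2)
        = (\<Sum>k\<in>{1..n} - {i, i + 1}. (Y k - base n k)\<^sup>2)"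
      by (rule sum.cong) (use 3 in \<open>auto simp: smap_def\<close>)
    moreover have "base n i = base n (i + 1) + 1" using 3 by (auto simp: base_def)
    moreover have "Y i < Y (i + 1)" using neg 3 by (simp add: wall_def)
    ultimately show ?thesis using 3
      by (subst (1 2) sum_two[of i "i + 1"]) (simp_all add: smap_def power2_eq_square algebra_simps)
  qed
qed

text \<open>The base point is the only integral point inside the scaled alcove: the finite walls
  force each coordinate up to at least its base value, and wall 0 leaves no slack.\<close>

lemma alcove_point:
  assumes pos: "\<And>i. i \<le> n \<Longrightarrow> 0 < wall n i Y" and k: "k \<in> {1..n}"
  shows "Y k = base n k"
proof -
  have Yn: "1 \<le> Y n" using pos[of n] n3 by (simp add: wall_def)
  have dec: "Y (i + 1) + 1 \<le> Y i" if "1 \<le> i" "i < n" for i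
    using pos[of i] that by (simp add: wall_def)
  have Y12: "Y 1 + Y 2 < 2 * int n" using pos[of 0] by (simp add: wall_def)
  have low: "int n + 1 - int i \<le> Y i" if "i \<le> n" "1 \<le> i" for i
    using that
  proof (induction i rule: inc_induct)
    case base
    then show ?case using Yn by simp
  next
    case (step i)
    then show ?case using dec[of i] by simp
  qed
  \<comment> \<open>From \<open>Y 2 + 1 \<le> Y 1\<close> and \<open>Y 1 + Y 2 < 2 * int n\<close>;
    the bound then descends along the remaining coordinates.\<close>
  have Y2: "Y 2 \<le> int n - 1" using dec[of 1] Y12 n3 by (simp add: numeral_2_eq_2)
  have up: "Y i \<le> int n + 1 - int i" if "2 \<le> i" "i \<le> n" for i
    using that
  proof (induction i rule: dec_induct)
    case base
    then show ?case using Y2 by simp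
  next
    case (step i)
    then show ?case using dec[of i] by simp
  qed
  have "Y 1 \<le> int n" using Y12 low[of 2] n3 by simp
  then show ?thesis using k low[of k] up[of k] by (cases "k = 1") (auto simp: base_def)
qed

lemma sref_cancel: "i \<le> n \<Longrightarrow> g \<in> carrier GG \<Longrightarrow> sref n i \<otimes>\<^bsub>GG\<^esub> (sref n i \<otimes>\<^bsub>GG\<^esub> g) = g"
proof -
  assume i: "i \<le> n" and g: "g \<in> carrier GG"
  interpret group GG by (rule group_GG)
  have "smap (2 * int n) n i (smap (2 * int n) n i Y) = Y" for Y
    using i by (auto simp: fun_eq_iff smap_def numeral_2_eq_2)
  then show ?thesis using i g sref_carrier by (intro pt_inj) (simp_all add: pt_sref_mult)
qed

lemma generated: "g \<in> carrier GG \<Longrightarrow> \<exists>ws\<in>lists SS. word_prod GG ws = g"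
proof (induction "nat (\<Sum>k=1..n. (pt n g k - base n k)\<^sup>2)" arbitrary: g rule: less_induct)
  case less
  interpret group GG by (rule group_GG)
  show ?case
  proof (cases "\<forall>i\<le>n. 0 < wall n i (pt n g)")
    case True
    then have "pt n g k = base n k" if "k \<in> {1..n}" for k using alcove_point that by blast
    then have "pt n g = pt n \<one>\<^bsub>GG\<^esub>"
      using pt_outside[OF less(2)] by (auto simp: fun_eq_iff pt_one base_def)
    then have "g = \<one>\<^bsub>GG\<^esub>" using pt_inj less(2) by simp
    then show ?thesis by (intro bexI[of _ "[]"]) (auto simp: word_prod_def)
  next
    case False
    then obtain i where i: "i \<le> n" "wall n i (pt n g) < 0" using wall_nonzero[OF less(2)] by (meson linorder_neqE)
    let ?h = "sref n i \<otimes>\<^bsub>GG\<^esub> g"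
    have h: "?h \<in> carrier GG" using sref_carrier i less(2) by simp
    have lt: "(\<Sum>k=1..n. (pt n ?h k - base n k)\<^sup>2) < (\<Sum>k=1..n. (pt n g k - base n k)\<^sup>2)"
      using descent_distance[OF i] by (simp add: pt_sref_mult[OF i(1)])
    moreover have "0 \<le> (\<Sum>k=1..n. (pt n ?h k - base n k)\<^sup>2)" by (simp add: sum_nonneg)
    ultimately obtain ws where ws: "ws \<in> lists SS" "word_prod GG ws = ?h"
      using less(1)[OF _ h] by auto
    have "word_prod GG (sref n i # ws) = g"
      using ws(2) sref_cancel[OF i(1) less(2)] by (simp add: word_prod_def)
    moreover have "sref n i # ws \<in> lists SS" using ws i SS_sref by auto
    ultimately show ?thesis by blast
  qed
qed

definition PP :: "vec \<times> (vec \<Rightarrow> vec) \<Rightarrow> (vec \<times> (vec \<Rightarrow> vec)) set" where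
  "PP s = {g. \<exists>i\<le>n. s = sref n i \<and> 0 < wall n i (pt n g)}"

lemma PP_sref: "i \<le> n \<Longrightarrow> g \<in> PP (sref n i) \<longleftrightarrow> 0 < wall n i (pt n g)"
  unfolding PP_def using sref_inj by auto

lemma halfspaces: "halfspace_group GG SS PP"
proof -
  interpret group GG by (rule group_GG)
  show ?thesis
  proof unfold_locales
    show "SS \<subseteq> carrier GG" "finite SS" using SS_sref sref_carrier by auto
  next
    fix s assume "s \<in> SS"
    then obtain i where i: "i \<le> n" "s = sref n i" using SS_sref by auto
    show "s \<otimes>\<^bsub>GG\<^esub> s = \<one>\<^bsub>GG\<^esub>" using sref_cancel[OF i(1), of "\<one>\<^bsub>GG\<^esub>"] sref_carrier[OF i(1)] i by simp
    show "\<one>\<^bsub>GG\<^esub> \<in> PP s" using i by (simp add: PP_sref pt_one wall_base)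
    fix x assume x: "x \<in> carrier GG"
    show "s \<otimes>\<^bsub>GG\<^esub> x \<in> PP s \<longleftrightarrow> x \<notin> PP s"
      using i wall_nonzero[OF x i(1)] by (auto simp: PP_sref pt_sref_mult wall_smap)
    fix t assume "t \<in> SS" and P: "x \<in> PP s" "x \<otimes>\<^bsub>GG\<^esub> t \<notin> PP s"
    then obtain j where j: "j \<le> n" "t = sref n j" using SS_sref by auto
    have "x \<otimes>\<^bsub>GG\<^esub> sref n j \<in> carrier GG" using x sref_carrier[OF j(1)] by simp
    then show "s \<otimes>\<^bsub>GG\<^esub> x = x \<otimes>\<^bsub>GG\<^esub> t"
      using wall_crossing_unique[OF x i(1) j(1)] P i j wall_nonzero[OF _ i(1)]
      by (metis PP_sref linorder_neqE)
  qed (use generated in blast)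
qed

end

sublocale affine_B \<subseteq> halfspace_group "affine_weyl n" "simple_reflections n" PP
  by (rule halfspaces)

section \<open>The cell of the elements with a unique reduced expression\<close>

definition od :: "int \<Rightarrow> int" where
  "od y = y mod 2"

lemma od_simps [simp]: "od (- y) = od y" "od (1 - y) = 1 - od y" "od 0 = 0"
  unfolding od_def by presburger+

text \<open>A square is congruent to its parity modulo 4. These congruences account for the
  integrality of the quarter-integral formulas.\<close>

lemma dvd_od: "2 dvd y - od y" "4 dvd y\<^sup>2 - od y" "4 dvd 2 * y\<^sup>2 - 2 * y"
proof -
  show "2 dvd y - od y" by (simp add: od_def)
  have "4 dvd y\<^sup>2 - od y \<and> 4 dvd 2 * y\<^sup>2 - 2 * y"
  proof (cases "even y")
    case True
    then obtain k where "y = 2 * k" by (elim evenE)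
    then show ?thesis by (simp add: od_def power2_eq_square)
  next
    case False
    then obtain k where k: "y = 2 * k + 1" by (elim oddE)
    have "y\<^sup>2 - od y = 4 * (k\<^sup>2 + k)" "2 * y\<^sup>2 - 2 * y = 4 * (2 * k\<^sup>2 + k)"
      by (simp_all add: k od_def power2_eq_square algebra_simps)
    then show ?thesis by simp
  qed
  then show "4 dvd y\<^sup>2 - od y" "4 dvd 2 * y\<^sup>2 - 2 * y" by blast+
qed

context affine_B
begin

section \<open>Relations between simple reflections, verified as identities of motions\<close>

lemma smap_relation:
  assumes "i \<le> n" "j \<le> n"
  shows "(\<And>Y. smap (2 * int n) n i (smap (2 * int n) n j Y) = smap (2 * int n) n j (smap (2 * int n) n i Y))
      \<Longrightarrow> sref n i \<otimes>\<^bsub>GG\<^esub> sref n j = sref n j \<otimes>\<^bsub>GG\<^esub> sref n i"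
    and "(\<And>Y. smap (2 * int n) n i (smap (2 * int n) n j (smap (2 * int n) n i Y))
        = smap (2 * int n) n j (smap (2 * int n) n i (smap (2 * int n) n j Y)))
      \<Longrightarrow> sref n i \<otimes>\<^bsub>GG\<^esub> (sref n j \<otimes>\<^bsub>GG\<^esub> sref n i) = sref n j \<otimes>\<^bsub>GG\<^esub> (sref n i \<otimes>\<^bsub>GG\<^esub> sref n j)"
    and "(\<And>Y. smap (2 * int n) n i (smap (2 * int n) n j (smap (2 * int n) n i (smap (2 * int n) n j Y)))
        = smap (2 * int n) n j (smap (2 * int n) n i (smap (2 * int n) n j (smap (2 * int n) n i Y))))
      \<Longrightarrow> sref n i \<otimes>\<^bsub>GG\<^esub> (sref n j \<otimes>\<^bsub>GG\<^esub> (sref n i \<otimes>\<^bsub>GG\<^esub> sref n j))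
        = sref n j \<otimes>\<^bsub>GG\<^esub> (sref n i \<otimes>\<^bsub>GG\<^esub> (sref n j \<otimes>\<^bsub>GG\<^esub> sref n i))"
proof -
  note c = sref_carrier[OF assms(1)] sref_carrier[OF assms(2)]
  have p: "pt n (sref n i) = smap (2 * int n) n i (base n)" "pt n (sref n j) = smap (2 * int n) n j (base n)"
    using pt_sref_mult[OF assms(1), of "\<one>\<^bsub>GG\<^esub>"] pt_sref_mult[OF assms(2), of "\<one>\<^bsub>GG\<^esub>"] c
    by (simp_all add: pt_one)
  show "sref n i \<otimes>\<^bsub>GG\<^esub> sref n j = sref n j \<otimes>\<^bsub>GG\<^esub> sref n i"
    if "\<And>Y. smap (2 * int n) n i (smap (2 * int n) n j Y) = smap (2 * int n) n j (smap (2 * int n) n i Y)"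
    by (rule pt_inj) (use c that[of "base n"] in \<open>simp_all add: pt_sref_mult assms p\<close>)
  show "sref n i \<otimes>\<^bsub>GG\<^esub> (sref n j \<otimes>\<^bsub>GG\<^esub> sref n i) = sref n j \<otimes>\<^bsub>GG\<^esub> (sref n i \<otimes>\<^bsub>GG\<^esub> sref n j)"
    if "\<And>Y. smap (2 * int n) n i (smap (2 * int n) n j (smap (2 * int n) n i Y))
        = smap (2 * int n) n j (smap (2 * int n) n i (smap (2 * int n) n j Y))"
    by (rule pt_inj) (use c that[of "base n"] in \<open>simp_all add: pt_sref_mult assms p\<close>)
  show "sref n i \<otimes>\<^bsub>GG\<^esub> (sref n j \<otimes>\<^bsub>GG\<^esub> (sref n i \<otimes>\<^bsub>GG\<^esub> sref n j))
        = sref n j \<otimes>\<^bsub>GG\<^esub> (sref n i \<otimes>\<^bsub>GG\<^esub> (sref n j \<otimes>\<^bsub>GG\<^esub> sref n i))"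
    if "\<And>Y. smap (2 * int n) n i (smap (2 * int n) n j (smap (2 * int n) n i (smap (2 * int n) n j Y)))
        = smap (2 * int n) n j (smap (2 * int n) n i (smap (2 * int n) n j (smap (2 * int n) n i Y)))"
    by (rule pt_inj) (use c that[of "base n"] in \<open>simp_all add: pt_sref_mult assms p\<close>)
qed

text \<open>Adjacency in the affine diagram of type B: nodes 0 and 1 are both joined to 2. The
  double bond between n - 1 and n is not marked here; it is treated by
  \<open>sref_braid4\<close>.\<close>

definition adj :: "nat \<Rightarrow> nat \<Rightarrow> bool" where
  "adj i j \<longleftrightarrow> (i = 0 \<and> j = 2) \<or> (i = 2 \<and> j = 0) \<or> (1 \<le> i \<and> j = i + 1) \<or> (1 \<le> j \<and> i = j + 1)"

lemma sref_comm:
  assumes "i \<le> n" "j \<le> n" "i \<noteq> j" "\<not> adj i j"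
  shows "sref n i \<otimes>\<^bsub>GG\<^esub> sref n j = sref n j \<otimes>\<^bsub>GG\<^esub> sref n i"
proof -
  have *: "sref n i \<otimes>\<^bsub>GG\<^esub> sref n j = sref n j \<otimes>\<^bsub>GG\<^esub> sref n i"
    if "i < j" "j \<le> n" "\<not> adj i j" for i j
  proof (rule smap_relation(1))
    fix Y :: vec
    have "(i = 0 \<and> j = 1) \<or> (i = 0 \<and> j = n) \<or> (i = 0 \<and> 3 \<le> j \<and> j < n)
      \<or> (1 \<le> i \<and> i + 1 < j \<and> j = n) \<or> (1 \<le> i \<and> i + 1 < j \<and> j < n)"
    proof (cases "i = 0")
      case True
      then have "j \<noteq> 2" using that(3) by (auto simp: adj_def)
      then show ?thesis using True that(1,2) by linarith
    next
      case False
      then have "j \<noteq> i + 1" using that(3) by (auto simp: adj_def)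
      then show ?thesis using False that(1,2) by linarith
    qed
    then consider "i = 0" "j = 1" | "i = 0" "j = n" | "i = 0" "3 \<le> j" "j < n" | "1 \<le> i" "i + 1 < j" "j = n"
      | "1 \<le> i" "i + 1 < j" "j < n"
      by blast
    then show "smap (2 * int n) n i (smap (2 * int n) n j Y) = smap (2 * int n) n j (smap (2 * int n) n i Y)"
      by cases (use n3 in \<open>auto simp: fun_eq_iff smap_def numeral_2_eq_2\<close>)
  qed (use that in auto)
  have "adj j i \<longleftrightarrow> adj i j" by (auto simp: adj_def)
  then show ?thesis using *[of i j] *[of j i] assms by (cases "i < j") auto
qed

lemma sref_braid3:
  assumes "adj i j" "i < n" "j < n"
  shows "sref n i \<otimes>\<^bsub>GG\<^esub> (sref n j \<otimes>\<^bsub>GG\<^esub> sref n i) = sref n j \<otimes>\<^bsub>GG\<^esub> (sref n i \<otimes>\<^bsub>GG\<^esub> sref n j)"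
proof -
  have *: "sref n i \<otimes>\<^bsub>GG\<^esub> (sref n j \<otimes>\<^bsub>GG\<^esub> sref n i) = sref n j \<otimes>\<^bsub>GG\<^esub> (sref n i \<otimes>\<^bsub>GG\<^esub> sref n j)"
    if "(i = 0 \<and> j = 2) \<or> (1 \<le> i \<and> j = i + 1)" "j < n" for i j
  proof (rule smap_relation(2))
    fix Y :: vec
    show "smap (2 * int n) n i (smap (2 * int n) n j (smap (2 * int n) n i Y))
        = smap (2 * int n) n j (smap (2 * int n) n i (smap (2 * int n) n j Y))"
      using that(1)
    proof
      assume "i = 0 \<and> j = 2"
      then show ?thesis using \<open>j < n\<close> by (auto simp: fun_eq_iff smap_def numeral_2_eq_2)
    next
      assume "1 \<le> i \<and> j = i + 1"
      then show ?thesis using \<open>j < n\<close> by (auto simp: fun_eq_iff smap_def)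
    qed
  qed (use that in auto)
  show ?thesis using *[of i j] *[of j i] assms by (auto simp: adj_def)
qed

lemma sref_braid4:
  "sref n (n - 1) \<otimes>\<^bsub>GG\<^esub> (sref n n \<otimes>\<^bsub>GG\<^esub> (sref n (n - 1) \<otimes>\<^bsub>GG\<^esub> sref n n))
    = sref n n \<otimes>\<^bsub>GG\<^esub> (sref n (n - 1) \<otimes>\<^bsub>GG\<^esub> (sref n n \<otimes>\<^bsub>GG\<^esub> sref n (n - 1)))"
  by (rule smap_relation(3)) (use n3 in \<open>auto simp: fun_eq_iff smap_def\<close>)

text \<open>
  The vertices are \<open>0\<close> for the identity, the path \<open>1, \<dots>, 2n - 1\<close> whose labels run through the nodes
  \<open>0, 2, 3, \<dots>, n, n - 1, \<dots>, 2, 0\<close>, and the two further leaves \<open>2n\<close> and \<open>2n + 1\<close> with label \<open>1\<close>.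
\<close>

definition tpar :: "nat \<Rightarrow> nat" where
  "tpar z = (if z = 2 * n then 2 * n - 2 else if z = 2 * n + 1 then 2 else z - 1)"

definition tnode :: "nat \<Rightarrow> nat" where
  "tnode z = (if z = 1 \<or> z = 2 * n - 1 then 0 else if z = 2 * n \<or> z = 2 * n + 1 then 1
     else if z \<le> n then z else 2 * n - z)"

definition tdep :: "nat \<Rightarrow> nat" where
  "tdep z = (if z = 2 * n then 2 * n - 1 else if z = 2 * n + 1 then 3 else z)"

abbreviation VV where "VV \<equiv> {0..2 * n + 1}"

section \<open>Combinatorics of the tree\<close>

lemma vertex_cases:
  assumes "z \<in> VV" "z \<noteq> 0"
  obtains "z = 1" | "z = 2" | "3 \<le> z" "z < n" | "z = n" | "n < z" "z < 2 * n - 2" | "z = 2 * n - 2"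
    | "z = 2 * n - 1" | "z = 2 * n" | "z = 2 * n + 1"
  using assms by force

lemma tnode_le: "z \<in> VV \<Longrightarrow> tnode z \<le> n"
  using n3 by (auto simp: tnode_def)

lemma tnode_leaf:
  "tnode 1 = 0" "tnode (2 * n - 1) = 0" "tnode (2 * n) = 1" "tnode (2 * n + 1) = 1"
  using n3 by (auto simp: tnode_def)

lemma tpar_leaf:
  "tpar 1 = 0" "tpar (2 * n - 1) = 2 * n - 2" "tpar (2 * n) = 2 * n - 2" "tpar (2 * n + 1) = 2"
  using n3 by (auto simp: tpar_def)

lemma tnode_up: "2 \<le> i \<Longrightarrow> i \<le> n \<Longrightarrow> tnode i = i"
  using n3 by (auto simp: tnode_def)

lemma tnode_down: "2 \<le> i \<Longrightarrow> i \<le> n \<Longrightarrow> tnode (2 * n - i) = i"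
  using n3 by (auto simp: tnode_def)

lemma tpar_up: "2 \<le> i \<Longrightarrow> i \<le> n \<Longrightarrow> tpar i = i - 1"
  using n3 by (auto simp: tpar_def)

lemma tpar_down: "2 \<le> i \<Longrightarrow> i < n \<Longrightarrow> tpar (2 * n - i) = 2 * n - (i + 1)"
  using n3 by (auto simp: tpar_def)

lemma tree_cases:
  assumes "z \<in> VV" "z \<noteq> 0"
  obtains "z = 1" "tnode z = 0" "tpar z = 0"
    | "z = 2" "tnode z = 2" "tpar z = 1" "tnode (tpar z) = 0"
    | "3 \<le> z" "z < n" "tnode z = z" "tpar z = z - 1" "tnode (tpar z) = z - 1"
    | "z = n" "tnode z = n" "tpar z = n - 1" "tnode (tpar z) = n - 1"
    | i where "2 \<le> i" "i < n" "z = 2 * n - i" "tnode z = i" "tpar z = 2 * n - (i + 1)" "tnode (tpar z) = i + 1"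
    | "z = 2 * n - 1" "tnode z = 0" "tpar z = 2 * n - 2" "tnode (tpar z) = 2"
    | "z = 2 * n" "tnode z = 1" "tpar z = 2 * n - 2" "tnode (tpar z) = 2"
    | "z = 2 * n + 1" "tnode z = 1" "tpar z = 2" "tnode (tpar z) = 2"
  using assms
proof (cases rule: vertex_cases)
  case 5
  then show ?thesis
    using that(5)[of "2 * n - z"] tnode_down[of "2 * n - z"] tnode_down[of "2 * n - z + 1"] tpar_down[of "2 * n - z"]
    by simp
next
  case 6
  then show ?thesis using that(5)[of 2] tnode_down[of 2] tnode_down[of 3] tpar_down[of 2] n3 by simp
next
  case 1
  then show ?thesis using that(1) tnode_leaf(1) tpar_leaf(1) by simp
next
  case 2
  then show ?thesis using that(2) tnode_leaf(1) tnode_up[of 2] tpar_up[of 2] n3 by simp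
next
  case 3
  then show ?thesis using that(3) tnode_up[of z] tnode_up[of "z - 1"] tpar_up[of z] by simp
next
  case 4
  then show ?thesis using that(4) tnode_up[of z] tnode_up[of "z - 1"] tpar_up[of z] n3 by simp
next
  case 7
  then show ?thesis using that(6) tnode_leaf(2) tpar_leaf(2) tnode_down[of 2] n3 by simp
next
  case 8
  then show ?thesis using that(7) tnode_leaf(3) tpar_leaf(3) tnode_down[of 2] n3 by simp
next
  case 9
  then show ?thesis using that(8) tnode_leaf(4) tpar_leaf(4) tnode_up[of 2] n3 by simp
qed

lemma tree_children:
  "{y \<in> VV. y \<noteq> 0 \<and> tpar y = z} =
    (if z = 2 then {3, 2 * n + 1} else if z = 2 * n - 2 then {2 * n - 1, 2 * n}
     else if z < 2 * n - 1 then {z + 1} else {})"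
  using n3 by (auto simp: tpar_def split: if_splits)

lemma tree_children_cases:
  "{y \<in> VV. y \<noteq> 0 \<and> tpar y = 2} = {3, 2 * n + 1}"
  "{y \<in> VV. y \<noteq> 0 \<and> tpar y = 2 * n - 2} = {2 * n - 1, 2 * n}"
  "z \<noteq> 2 \<Longrightarrow> z < 2 * n - 2 \<Longrightarrow> {y \<in> VV. y \<noteq> 0 \<and> tpar y = z} = {z + 1}"
  "2 * n - 1 \<le> z \<Longrightarrow> {y \<in> VV. y \<noteq> 0 \<and> tpar y = z} = {}"
proof -
  have "2 * n - 2 \<noteq> 2" using n3 by arith
  then show "{y \<in> VV. y \<noteq> 0 \<and> tpar y = 2} = {3, 2 * n + 1}"
    "{y \<in> VV. y \<noteq> 0 \<and> tpar y = 2 * n - 2} = {2 * n - 1, 2 * n}"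
    unfolding tree_children by simp_all
  show "{y \<in> VV. y \<noteq> 0 \<and> tpar y = z} = {z + 1}" if "z \<noteq> 2" "z < 2 * n - 2"
    unfolding tree_children using that by simp
  show "{y \<in> VV. y \<noteq> 0 \<and> tpar y = z} = {}" if z: "2 * n - 1 \<le> z"
  proof -
    have "z \<noteq> 2" "z \<noteq> 2 * n - 2" using z n3 by arith+
    then show ?thesis unfolding tree_children using z by simp
  qed
qed

text \<open>For the closure axiom, nodes that are not adjacent to the label commute with it. An
  adjacent node is the label of a child, or else the label of the parent, where the bond is simple
  except just after the path has turned back at n.\<close>

lemma tree: "cell_tree GG SS PP VV 0 (\<lambda>z. sref n (tnode z)) tpar tdep"
proof
  show "finite VV" "0 \<in> VV" "tdep 0 = 0" using n3 by (auto simp: tdep_def)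
next
  fix z assume z: "z \<in> VV" "z \<noteq> 0"
  show "sref n (tnode z) \<in> SS" using tnode_le[OF z(1)] SS_sref by auto
  show "tpar z \<in> VV" using z n3 by (auto simp: tpar_def)
  show "tdep z = Suc (tdep (tpar z))" using z n3 by (auto simp: tpar_def tdep_def)
next
  fix y z assume y: "y \<in> VV" "z \<in> VV" "y \<noteq> 0" "z \<noteq> 0" "tpar y = tpar z" "sref n (tnode y) = sref n (tnode z)"
  then have e: "tnode y = tnode z" using sref_inj tnode_le by blast
  have n: "tnode 3 = 3" "tnode (2 * n + 1) = 1" "tnode (2 * n - 1) = 0" "tnode (2 * n) = 1"
    using n3 by (auto simp: tnode_def)
  have "{y, z} \<subseteq> {x \<in> VV. x \<noteq> 0 \<and> tpar x = tpar z}" using y by simp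
  then have "{y, z} \<subseteq> (if tpar z = 2 then {3, 2 * n + 1} else if tpar z = 2 * n - 2 then {2 * n - 1, 2 * n}
     else if tpar z < 2 * n - 1 then {tpar z + 1} else {})"
    by (simp only: tree_children)
  then consider "{y, z} \<subseteq> {3, 2 * n + 1}" | "{y, z} \<subseteq> {2 * n - 1, 2 * n}" | "{y, z} \<subseteq> {tpar z + 1}"
    by (simp split: if_splits)
  then show "y = z" using e n by cases auto
next
  fix z assume z: "z \<in> VV" "z \<noteq> 0" "tpar z \<noteq> 0"
  have "tnode (tpar z) \<noteq> tnode z"
    using z(1,2) by (cases rule: tree_cases) (use n3 z(3) in auto)
  moreover have "tnode (tpar z) \<le> n" using z n3 by (intro tnode_le) (auto simp: tpar_def)
  ultimately show "sref n (tnode (tpar z)) \<noteq> sref n (tnode z)" using sref_inj tnode_le z by blast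
next
  fix z t assume z: "z \<in> VV" "z \<noteq> 0" and "t \<in> SS" and ne: "t \<noteq> sref n (tnode z)"
  then obtain j where j: "j \<le> n" "t = sref n j" using SS_sref by auto
  have i: "tnode z \<le> n" using tnode_le z by blast
  have ij: "tnode z \<noteq> j" using ne j by auto
  let ?child = "\<exists>y\<in>VV. y \<noteq> 0 \<and> tpar y = z \<and> sref n (tnode y) = t"
  let ?braid3 = "tpar z \<noteq> 0 \<and> sref n (tnode (tpar z)) = t
          \<and> sref n (tnode z) \<otimes>\<^bsub>GG\<^esub> (t \<otimes>\<^bsub>GG\<^esub> sref n (tnode z)) = t \<otimes>\<^bsub>GG\<^esub> (sref n (tnode z) \<otimes>\<^bsub>GG\<^esub> t)"
  let ?braid4 = "tpar z \<noteq> 0 \<and> tpar (tpar z) \<noteq> 0 \<and> sref n (tnode (tpar z)) = t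
          \<and> sref n (tnode (tpar (tpar z))) = sref n (tnode z)
          \<and> sref n (tnode z) \<otimes>\<^bsub>GG\<^esub> (t \<otimes>\<^bsub>GG\<^esub> (sref n (tnode z) \<otimes>\<^bsub>GG\<^esub> t))
          = t \<otimes>\<^bsub>GG\<^esub> (sref n (tnode z) \<otimes>\<^bsub>GG\<^esub> (t \<otimes>\<^bsub>GG\<^esub> sref n (tnode z)))"
  have child: ?child if "y \<in> VV" "y \<noteq> 0" "tpar y = z" "tnode y = j" for y
    using that j(2) by blast
  have braid: ?braid3 if "tpar z \<noteq> 0" "tnode (tpar z) = j" "adj (tnode z) j" "tnode z < n" "j < n"
    using that j(2) sref_braid3 by simp
  show "sref n (tnode z) \<otimes>\<^bsub>GG\<^esub> t = t \<otimes>\<^bsub>GG\<^esub> sref n (tnode z) \<or> ?child \<or> ?braid3 \<or> ?braid4"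
  proof (cases "adj (tnode z) j")
    case False
    then show ?thesis using sref_comm[OF i j(1) ij] j(2) by simp
  next
    case True
    from z show ?thesis
    proof (cases rule: tree_cases)
      case 1
      then have "j = 2" using True by (auto simp: adj_def)
      then have ?child using child[of 2] 1 n3 tnode_up[of 2] tpar_up[of 2] by simp
      then show ?thesis by blast
    next
      case 2
      then consider "j = 0" | "j = 1" | "j = 3" using True by (auto simp: adj_def)
      then show ?thesis
      proof cases
        case a: 1
        then have ?braid3 using braid True 2 n3 by simp
        then show ?thesis by blast
      next
        case a: 2
        then have ?child using child[of "2 * n + 1"] tnode_leaf(4) tpar_leaf(4) 2 n3 by simp
        then show ?thesis by blast
      next
        case a: 3
        then have ?child using child[of 3] tnode_up[of 3] tpar_up[of 3] 2 n3 by simp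
        then show ?thesis by blast
      qed
    next
      case 3
      then consider "j = z - 1" | "j = z + 1" using True by (auto simp: adj_def)
      then show ?thesis
      proof cases
        case a: 1
        then have ?braid3 using braid True 3 by simp
        then show ?thesis by blast
      next
        case a: 2
        then have ?child using child[of "z + 1"] tnode_up[of "z + 1"] tpar_up[of "z + 1"] 3 by simp
        then show ?thesis by blast
      qed
    next
      case 4
      then have jn: "j = n - 1" using True n3 j by (auto simp: adj_def)
      have "2 * n - (n - 1) = n + 1" "2 * n - n = n" using n3 by auto
      then have "tnode (n + 1) = n - 1" "tpar (n + 1) = n"
        using tnode_down[of "n - 1"] tpar_down[of "n - 1"] n3 by simp_all
      then have ?child using child[of "n + 1"] 4 jn n3 by simp
      then show ?thesis by blast
    next
      case (5 i)
      have "j = i + 1 \<or> i = j + 1 \<or> (i = 2 \<and> j = 0)"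
        using True unfolding 5(4) adj_def using 5(1) by linarith
      then have "(j = i + 1 \<and> j < n) \<or> (j = i + 1 \<and> j = n) \<or> (i = 2 \<and> j = 0) \<or> (i = 2 \<and> j = 1)
          \<or> (3 \<le> i \<and> j = i - 1)"
        using 5(1) j(1) by linarith
      then consider "j = i + 1" "j < n" | "j = i + 1" "j = n" | "i = 2" "j = 0" | "i = 2" "j = 1" | "3 \<le> i" "j = i - 1"
        by blast
      then show ?thesis
      proof cases
        case a: 1
        then have ?braid3 using braid True 5(1,2,4,5,6) by simp
        then show ?thesis by blast
      next
        \<comment> \<open>Here \<open>z = n + 1\<close>, and the labels towards the root begin n -
          1, n, n - 1; the double bond supplies the relation of length 4.\<close>
        case a: 2
        then have i: "i = n - 1" by simp
        have "2 * n - (i + 1) = n" using a by simp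
        then have p: "tpar z = n" "tpar (tpar z) = n - 1" "tnode (tpar (tpar z)) = n - 1"
          using 5(5) tpar_up[of n] tnode_up[of "n - 1"] n3 by simp_all
        then have ?braid4 using sref_braid4 j(2) a 5(4) i n3 tnode_up[of n] by simp
        then show ?thesis by blast
      next
        case a: 3
        have "tpar (2 * n - 1) = z" "tnode (2 * n - 1) = j"
          unfolding tpar_leaf tnode_leaf using 5(3) a by auto
        then have ?child by (intro child[of "2 * n - 1"]) (use n3 in auto)
        then show ?thesis by blast
      next
        case a: 4
        have "tpar (2 * n) = z" "tnode (2 * n) = j"
          unfolding tpar_leaf tnode_leaf using 5(3) a by auto
        then have ?child by (intro child[of "2 * n"]) (use n3 in auto)
        then show ?thesis by blast
      next
        case a: 5
        have "tpar (2 * n - (i - 1)) = z" "tnode (2 * n - (i - 1)) = j"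
          using tnode_down[of "i - 1"] tpar_down[of "i - 1"] 5(2,3) a by auto
        then have ?child by (intro child[of "2 * n - (i - 1)"]) (use 5(2) in auto)
        then show ?thesis by blast
      qed
    next
      case 6
      then have "j = 2" using True by (auto simp: adj_def)
      then have ?braid3 using braid True 6 n3 by simp
      then show ?thesis by blast
    next
      case 7
      then have "j = 2" using True j(1) ij by (auto simp: adj_def)
      then have ?braid3 using braid True 7 n3 by simp
      then show ?thesis by blast
    next
      case 8
      then have "j = 2" using True j(1) ij by (auto simp: adj_def)
      then have ?braid3 using braid True 8 n3 by simp
      then show ?thesis by blast
    qed
  qed
qed

text \<open>Four times the multiplicity at the vertex \<open>z\<close> is a sum over the coordinates of \<open>\<gamma>\<close> of these terms.\<close>

definition term4 :: "nat \<Rightarrow> nat \<Rightarrow> int \<Rightarrow> int" where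
  "term4 z j y =
    (if z = 1 then y\<^sup>2 + od y
     else if z = 2 * n - 1 then y\<^sup>2 - od y
     else if z = 2 * n then (if j = 1 then y\<^sup>2 - 2 * y + od y else y\<^sup>2 - od y)
     else if z = 2 * n + 1 then (if j = 1 then y\<^sup>2 - 2 * y - od y else y\<^sup>2 + od y)
     else if z \<le> n then (if j \<le> z then 2 * y\<^sup>2 - 2 * y else 2 * y\<^sup>2 + 2 * od y)
     else (if j \<le> 2 * n - z then 2 * y\<^sup>2 - 2 * y else 2 * y\<^sup>2 - 2 * od y))"

lemma term4_leaf:
  "term4 (Suc 0) j y = y\<^sup>2 + od y"
  "term4 (2 * n - 1) j y = y\<^sup>2 - od y"
  "term4 (2 * n) j y = (if j = 1 then y\<^sup>2 - 2 * y + od y else y\<^sup>2 - od y)"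
  "term4 (2 * n + 1) j y = (if j = 1 then y\<^sup>2 - 2 * y - od y else y\<^sup>2 + od y)"
  using n3 by (auto simp: term4_def)

lemma term4_up:
  "2 \<le> z \<Longrightarrow> z \<le> n \<Longrightarrow> term4 z j y = (if j \<le> z then 2 * y\<^sup>2 - 2 * y else 2 * y\<^sup>2 + 2 * od y)"
  using n3 by (auto simp: term4_def)

lemma term4_down:
  "2 \<le> i \<Longrightarrow> i \<le> n \<Longrightarrow> j \<le> n \<Longrightarrow>
    term4 (2 * n - i) j y = (if j \<le> i then 2 * y\<^sup>2 - 2 * y else 2 * y\<^sup>2 - 2 * od y)"
  using n3 by (auto simp: term4_def)

text \<open>The terms for vertices \<open>2\<close> to \<open>2 * n - 2\<close> combine the
  Euclidean square with linear terms up to coordinate i, which add up to the coefficient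
  \<open>a i\<close>, and with parities beyond i, which count parity changes. The root carries the
  constant function 1, hence the 4.\<close>

definition mult4 :: "nat \<Rightarrow> vec \<Rightarrow> int" where
  "mult4 z x = (if z = 0 then 4 else (\<Sum>j=1..n. term4 z j (x j)))"

section \<open>The reflection rule for the multiplicity functions\<close>

lemma sum_local2:
  fixes F H :: "nat \<Rightarrow> int"
  assumes "k \<in> {1..n}" "l \<in> {1..n}" "k \<noteq> l" "\<And>j. j \<in> {1..n} \<Longrightarrow> j \<noteq> k \<Longrightarrow> j \<noteq> l \<Longrightarrow> F j = H j"
  shows "(\<Sum>j=1..n. F j) = (\<Sum>j=1..n. H j) + (F k + F l - H k - H l)"
proof -
  have "(\<Sum>j\<in>{1..n} - {k, l}. F j) = (\<Sum>j\<in>{1..n} - {k, l}. H j)"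
    by (rule sum.cong) (use assms(4) in auto)
  then show ?thesis using sum_two[OF assms(1-3), of F] sum_two[OF assms(1-3), of H] by simp
qed

lemma sum_local1:
  fixes F H :: "nat \<Rightarrow> int"
  assumes "k \<in> {1..n}" "\<And>j. j \<in> {1..n} \<Longrightarrow> j \<noteq> k \<Longrightarrow> F j = H j"
  shows "(\<Sum>j=1..n. F j) = (\<Sum>j=1..n. H j) + (F k - H k)"
proof -
  have "(\<Sum>j\<in>{1..n} - {k}. F j) = (\<Sum>j\<in>{1..n} - {k}. H j)"
    by (rule sum.cong) (use assms(2) in auto)
  then show ?thesis using assms(1) by (simp add: sum.remove[of _ k])
qed

text \<open>For \<open>1 \<le> i < n\<close> the two exchanged coordinates carry the same function;
  for \<open>i = n\<close> the last function is even. For \<open>i = 0\<close> the substitution of 1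
  - y either preserves the function 2y^2 - 2y of the first two coordinates or, at the two leaves
  labelled 1, exchanges their functions.\<close>

lemma mult4_fixed:
  assumes z: "z \<in> VV" "z \<noteq> 0" and i: "i \<le> n" "tnode z \<noteq> i"
  shows "mult4 z (smap 1 n i x) = mult4 z x"
proof -
  let ?F = "\<lambda>j. term4 z j (smap 1 n i x j)" and ?H = "\<lambda>j. term4 z j (x j)"
  consider "i = 0" | "i = n" "i \<noteq> 0" | "1 \<le> i" "i < n" using i by linarith
  then have "(\<Sum>j=1..n. ?F j) = (\<Sum>j=1..n. ?H j)"
  proof cases
    case 1
    have "(\<Sum>j=1..n. ?F j) = (\<Sum>j=1..n. ?H j) + (?F 1 + ?F 2 - ?H 1 - ?H 2)"
      by (rule sum_local2) (use n3 1 in \<open>auto simp: smap_def\<close>)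
    moreover have "?F 1 + ?F 2 - ?H 1 - ?H 2 = 0"
      using z 1 i(2)
      by (cases rule: vertex_cases)
         (use n3 in \<open>auto simp: smap_def term4_def tnode_def power2_eq_square algebra_simps\<close>)
    ultimately show ?thesis by simp
  next
    case 2
    have "(\<Sum>j=1..n. ?F j) = (\<Sum>j=1..n. ?H j) + (?F n - ?H n)"
      by (rule sum_local1) (use n3 2 in \<open>auto simp: smap_def\<close>)
    moreover have "?F n - ?H n = 0"
      using z 2 i(2)
      by (cases rule: vertex_cases)
         (use n3 in \<open>auto simp: smap_def term4_def tnode_def power2_eq_square algebra_simps\<close>)
    ultimately show ?thesis by simp
  next
    case 3
    have "(\<Sum>j=1..n. ?F j) = (\<Sum>j=1..n. ?H j) + (?F i + ?F (i + 1) - ?H i - ?H (i + 1))"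
      by (rule sum_local2) (use n3 3 in \<open>auto simp: smap_def\<close>)
    moreover have "term4 z i y = term4 z (i + 1) y" for y
      using z 3 i(2)
      by (cases rule: vertex_cases) (use n3 in \<open>auto simp: term4_def tnode_def\<close>)
    then have "?F i + ?F (i + 1) - ?H i - ?H (i + 1) = 0"
      using 3 by (simp add: smap_def)
    ultimately show ?thesis by simp
  qed
  then show ?thesis using z by (simp add: mult4_def)
qed

text \<open>A termwise comparison. At coordinates untouched by the reflection, twice the term of
  \<open>z\<close> is the sum of the terms of its neighbours, so only the one or two moved
  coordinates require a computation; \<open>mid\<close>, \<open>aff\<close> and \<open>fin\<close>
  isolate it.\<close>

lemma mult4_moved:
  assumes z: "z \<in> VV" "z \<noteq> 0"
  shows "mult4 z (smap 1 n (tnode z) x) + mult4 z x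
    = mult4 (tpar z) x + (\<Sum>y\<in>{y \<in> VV. y \<noteq> 0 \<and> tpar y = z}. mult4 y x)"
proof -
  define T where "T = (\<lambda>y j. term4 y j (x j))"
  let ?F = "\<lambda>j. term4 z j (smap 1 n (tnode z) x j) + T z j"
  have L: "mult4 z (smap 1 n (tnode z) x) + mult4 z x = (\<Sum>j=1..n. ?F j)"
    using z by (simp add: mult4_def T_def sum.distrib)
  have M: "mult4 y x = (\<Sum>j=1..n. T y j)" if "y \<noteq> 0" for y
    using that by (simp add: mult4_def T_def)
  have mid: "(\<Sum>j=1..n. ?F j) = (\<Sum>j=1..n. H j)"
    if "1 \<le> tnode z" "tnode z < n" "\<And>j. j \<in> {1..n} \<Longrightarrow> j \<noteq> tnode z \<Longrightarrow> j \<noteq> tnode z + 1 \<Longrightarrow> 2 * T z j = H j"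
      "term4 z (tnode z) (x (tnode z + 1)) + term4 z (tnode z + 1) (x (tnode z)) + T z (tnode z) + T z (tnode z + 1)
       = H (tnode z) + H (tnode z + 1)" for H
  proof -
    have "(\<Sum>j=1..n. ?F j) = (\<Sum>j=1..n. H j)
        + (?F (tnode z) + ?F (tnode z + 1) - H (tnode z) - H (tnode z + 1))"
      by (rule sum_local2) (use that in \<open>auto simp: smap_def T_def\<close>)
    then show ?thesis using that by (simp add: smap_def)
  qed
  have aff: "(\<Sum>j=1..n. ?F j) = (\<Sum>j=1..n. H j) + c"
    if "tnode z = 0" "\<And>j. j \<in> {1..n} \<Longrightarrow> j \<noteq> 1 \<Longrightarrow> j \<noteq> 2 \<Longrightarrow> 2 * T z j = H j"
      "term4 z 1 (1 - x 2) + term4 z 2 (1 - x 1) + T z 1 + T z 2 = H 1 + H 2 + c" for H c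
  proof -
    have "(\<Sum>j=1..n. ?F j) = (\<Sum>j=1..n. H j) + (?F 1 + ?F 2 - H 1 - H 2)"
      by (rule sum_local2) (use that n3 in \<open>auto simp: smap_def T_def\<close>)
    then show ?thesis using that by (simp add: smap_def)
  qed
  have fin: ?thesis if p: "tpar z = p" "p \<noteq> 0" and C: "{y \<in> VV. y \<noteq> 0 \<and> tpar y = z} = C"
    and U: "\<And>j. (\<Sum>y\<in>C. T y j) = U j" and eq: "(\<Sum>j=1..n. ?F j) = (\<Sum>j=1..n. T p j + U j)" for p C U
  proof -
    have "(\<Sum>y\<in>C. mult4 y x) = (\<Sum>y\<in>C. \<Sum>j=1..n. T y j)"
      by (rule sum.cong) (use C M in auto)
    also have "\<dots> = (\<Sum>j=1..n. \<Sum>y\<in>C. T y j)" by (rule sum.swap)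
    also have "\<dots> = (\<Sum>j=1..n. U j)" by (simp only: U)
    finally have "(\<Sum>y\<in>C. mult4 y x) = (\<Sum>j=1..n. U j)" .
    then show ?thesis unfolding C L p(1) eq using M[OF p(2)] by (simp only: sum.distrib)
  qed
  from z show ?thesis
  proof (cases rule: vertex_cases)
    case 1
    have tn: "tnode z = 0" using 1 by (simp add: tnode_def)
    have t: "term4 z j y = y\<^sup>2 + od y"
      "term4 2 j y = (if j \<le> 2 then 2 * y\<^sup>2 - 2 * y else 2 * y\<^sup>2 + 2 * od y)" for j y
      using 1 n3 term4_leaf(1) term4_up[of 2] by simp_all
    \<comment> \<open>The constant is the value at the root: each of the two moved coordinates
      leaves 2, one from the square of 1 - y and one from its parity.\<close>
    have e: "(\<Sum>j=1..n. ?F j) = (\<Sum>j=1..n. T 2 j) + 4"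
      by (rule aff) (use tn in \<open>auto simp: t T_def power2_eq_square algebra_simps\<close>)
    have c: "{y \<in> VV. y \<noteq> 0 \<and> tpar y = z} = {2}"
      using tree_children_cases(3)[of 1] 1 n3 by (simp add: numeral_2_eq_2)
    have p: "tpar z = 0" using 1 tpar_leaf(1) by simp
    show ?thesis unfolding L e c p by (simp add: M mult4_def[of 0])
  next
    case 2
    have tn: "tnode z = 2" "2 < n" using 2 n3 by (simp_all add: tnode_def)
    define q where "q = 2 * n + 1"
    have t: "term4 q j y = (if j = 1 then y\<^sup>2 - 2 * y - od y else y\<^sup>2 + od y)"
      "term4 1 j y = y\<^sup>2 + od y"
      "term4 z j y = (if j \<le> 2 then 2 * y\<^sup>2 - 2 * y else 2 * y\<^sup>2 + 2 * od y)"
      "term4 3 j y = (if j \<le> 3 then 2 * y\<^sup>2 - 2 * y else 2 * y\<^sup>2 + 2 * od y)" for j y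
      using 2 n3 term4_up[of 2] term4_up[of 3] term4_leaf(1,4) by (simp_all add: q_def)
    have e: "(\<Sum>j=1..n. ?F j) = (\<Sum>j=1..n. T 1 j + (T 3 j + T q j))"
      by (rule mid) (use tn in \<open>auto simp: t t(2)[simplified] T_def power2_eq_square algebra_simps\<close>)
    have p: "tpar z = 1" using tpar_up[of 2] 2 n3 by simp
    have c: "{y \<in> VV. y \<noteq> 0 \<and> tpar y = z} = {3, q}"
      unfolding 2 q_def by (rule tree_children_cases(1))
    have "3 \<noteq> q" using n3 unfolding q_def by arith
    then have u: "(\<Sum>y\<in>{3, q}. T y j) = T 3 j + T q j" for j by simp
    show ?thesis by (rule fin[OF p one_neq_zero c u e])
  next
    case 3
    have tn: "tnode z = z" using 3 n3 by (simp add: tnode_def)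
    have t: "term4 z j y = (if j \<le> z then 2 * y\<^sup>2 - 2 * y else 2 * y\<^sup>2 + 2 * od y)"
      "term4 (z - 1) j y = (if j \<le> z - 1 then 2 * y\<^sup>2 - 2 * y else 2 * y\<^sup>2 + 2 * od y)"
      "term4 (z + 1) j y = (if j \<le> z + 1 then 2 * y\<^sup>2 - 2 * y else 2 * y\<^sup>2 + 2 * od y)" for j y
      using 3 term4_up by simp_all
    have e: "(\<Sum>j=1..n. ?F j) = (\<Sum>j=1..n. T (z - 1) j + T (z + 1) j)"
      by (rule mid) (use tn 3 in \<open>auto simp: t[simplified] T_def power2_eq_square algebra_simps\<close>)
    have p: "tpar z = z - 1" using tpar_up[of z] 3 by simp
    have r: "z - 1 \<noteq> 0" using 3 by simp
    have c: "{y \<in> VV. y \<noteq> 0 \<and> tpar y = z} = {z + 1}"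
      by (rule tree_children_cases(3)) (use 3 in simp_all)
    have u: "(\<Sum>y\<in>{z + 1}. T y j) = T (z + 1) j" for j by simp
    show ?thesis by (rule fin[OF p r c u e])
  next
    case 4
    have tn: "tnode z = n" using 4 n3 by (simp add: tnode_def)
    have zz: "n - 1 \<le> n" "2 \<le> n - 1" "n + 1 = 2 * n - (n - 1)" using n3 by auto
    have t: "term4 n j y = 2 * y\<^sup>2 - 2 * y"
      "term4 (n - 1) j y = (if j \<le> n - 1 then 2 * y\<^sup>2 - 2 * y else 2 * y\<^sup>2 + 2 * od y)"
      "term4 (n + 1) j y = (if j \<le> n - 1 then 2 * y\<^sup>2 - 2 * y else 2 * y\<^sup>2 - 2 * od y)"
      if "j \<le> n" for j y
      using n3 that term4_up[of n] term4_up[of "n - 1"] term4_down[of "n - 1"] zz by simp_all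
    have "(\<Sum>j=1..n. ?F j) = (\<Sum>j=1..n. T (n - 1) j + T (n + 1) j)
        + (?F n - (T (n - 1) n + T (n + 1) n))"
      by (rule sum_local1) (use tn 4 n3 in \<open>auto simp: t[simplified] T_def smap_def\<close>)
    moreover have "?F n - (T (n - 1) n + T (n + 1) n) = 0"
      using tn 4 n3 t[of n] by (auto simp: T_def smap_def)
    ultimately have e: "(\<Sum>j=1..n. ?F j) = (\<Sum>j=1..n. T (n - 1) j + T (n + 1) j)" by simp
    have p: "tpar z = n - 1" using tpar_up[of n] 4 n3 by simp
    have r: "n - 1 \<noteq> 0" using n3 by simp
    have c: "{y \<in> VV. y \<noteq> 0 \<and> tpar y = z} = {n + 1}"
      unfolding 4 by (rule tree_children_cases(3)) (use n3 in simp_all)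
    have u: "(\<Sum>y\<in>{n + 1}. T y j) = T (n + 1) j" for j by simp
    show ?thesis by (rule fin[OF p r c u e])
  next
    case 5
    define i where "i = 2 * n - z"
    have tn: "tnode z = i" and i: "3 \<le> i" "i < n" "z = 2 * n - i" "z - 1 = 2 * n - (i + 1)" "z + 1 = 2 * n - (i - 1)"
      using 5 n3 by (auto simp: tnode_def i_def)
    have t: "term4 z j y = (if j \<le> i then 2 * y\<^sup>2 - 2 * y else 2 * y\<^sup>2 - 2 * od y)"
      "term4 (z - 1) j y = (if j \<le> i + 1 then 2 * y\<^sup>2 - 2 * y else 2 * y\<^sup>2 - 2 * od y)"
      "term4 (z + 1) j y = (if j \<le> i - 1 then 2 * y\<^sup>2 - 2 * y else 2 * y\<^sup>2 - 2 * od y)"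
      if "j \<le> n" for j y
      using term4_down[of i j y] term4_down[of "i + 1" j y] term4_down[of "i - 1" j y] i(1,2) that
      unfolding i(4,5) by (simp_all add: i(3))
    have e: "(\<Sum>j=1..n. ?F j) = (\<Sum>j=1..n. T (z - 1) j + T (z + 1) j)"
      by (rule mid) (use tn i(1,2) in \<open>auto simp: t[simplified] T_def power2_eq_square algebra_simps\<close>)
    have p: "tpar z = z - 1" using tpar_down[of i] i(1,2) unfolding i(4) by (simp add: i(3))
    have r: "z - 1 \<noteq> 0" using 5 n3 by simp
    have c: "{y \<in> VV. y \<noteq> 0 \<and> tpar y = z} = {z + 1}"
      by (rule tree_children_cases(3)) (use 5 n3 in simp_all)
    have u: "(\<Sum>y\<in>{z + 1}. T y j) = T (z + 1) j" for j by simp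
    show ?thesis by (rule fin[OF p r c u e])
  next
    case 6
    have tn: "tnode z = 2" "2 < n" using 6 n3 by (auto simp: tnode_def)
    have i: "z = 2 * n - 2" "z - 1 = 2 * n - 3" using 6 by auto
    define p where "p = 2 * n - 1"
    define q where "q = 2 * n"
    have t': "term4 p j y = y\<^sup>2 - od y" "term4 q j y = (if j = 1 then y\<^sup>2 - 2 * y + od y else y\<^sup>2 - od y)" for j y
      using term4_leaf(2,3) by (simp_all add: p_def q_def)
    have t: "term4 z j y = (if j \<le> 2 then 2 * y\<^sup>2 - 2 * y else 2 * y\<^sup>2 - 2 * od y)"
      "term4 (z - 1) j y = (if j \<le> 3 then 2 * y\<^sup>2 - 2 * y else 2 * y\<^sup>2 - 2 * od y)"
      if "j \<le> n" for j y
      using term4_down[of 2 j y] term4_down[of 3 j y] n3 that unfolding i(2) by (simp_all add: i(1))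
    have e: "(\<Sum>j=1..n. ?F j) = (\<Sum>j=1..n. T (z - 1) j + (T p j + T q j))"
      by (rule mid) (use tn in \<open>auto simp: t t[simplified] t' T_def power2_eq_square algebra_simps\<close>)
    have par: "tpar z = z - 1" using tpar_down[of 2] n3 unfolding i(2) by (simp add: i(1))
    have r: "z - 1 \<noteq> 0" using 6 n3 by simp
    have c: "{y \<in> VV. y \<noteq> 0 \<and> tpar y = z} = {p, q}"
      unfolding i(1) p_def q_def by (rule tree_children_cases(2))
    have "p \<noteq> q" using n3 unfolding p_def q_def by arith
    then have u: "(\<Sum>y\<in>{p, q}. T y j) = T p j + T q j" for j by simp
    show ?thesis by (rule fin[OF par r c u e])
  next
    case 7
    have tn: "tnode z = 0" using 7 by (simp add: tnode_def)
    have t: "term4 z j y = y\<^sup>2 - od y" for j y using 7 term4_leaf(2) by simp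
    define r where "r = 2 * n - 2"
    have t': "term4 r j y = (if j \<le> 2 then 2 * y\<^sup>2 - 2 * y else 2 * y\<^sup>2 - 2 * od y)"
      if "j \<le> n" for j y
      using n3 that term4_down[of 2] by (simp add: r_def)
    have e: "(\<Sum>j=1..n. ?F j) = (\<Sum>j=1..n. T r j) + 0"
      by (rule aff) (use tn n3 in \<open>auto simp: t t' T_def power2_eq_square algebra_simps\<close>)
    have p: "tpar z = r" using 7 tpar_leaf(2) by (simp only: r_def)
    have r: "r \<noteq> 0" using n3 by (simp add: r_def)
    have c: "{y \<in> VV. y \<noteq> 0 \<and> tpar y = z} = {}"
      by (rule tree_children_cases(4)) (use 7 in simp)
    show ?thesis by (rule fin[OF p r c refl]) (use e in \<open>simp only: sum.empty add_0_right\<close>)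
  next
    case 8
    have tn: "tnode z = 1" using 8 n3 by (simp add: tnode_def)
    have t: "term4 z j y = (if j = 1 then y\<^sup>2 - 2 * y + od y else y\<^sup>2 - od y)" for j y
      using 8 term4_leaf(3) by simp
    define r where "r = 2 * n - 2"
    have t': "term4 r j y = (if j \<le> 2 then 2 * y\<^sup>2 - 2 * y else 2 * y\<^sup>2 - 2 * od y)"
      if "j \<le> n" for j y
      using n3 that term4_down[of 2] by (simp add: r_def)
    have e: "(\<Sum>j=1..n. ?F j) = (\<Sum>j=1..n. T r j)"
      by (rule mid) (use tn n3 in \<open>auto simp: t[simplified] t' T_def power2_eq_square algebra_simps numeral_2_eq_2\<close>)
    have p: "tpar z = r" using 8 tpar_leaf(3) by (simp only: r_def)
    have r: "r \<noteq> 0" using n3 by (simp add: r_def)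
    have c: "{y \<in> VV. y \<noteq> 0 \<and> tpar y = z} = {}"
      by (rule tree_children_cases(4)) (use 8 in simp)
    show ?thesis by (rule fin[OF p r c refl]) (use e in \<open>simp only: sum.empty add_0_right\<close>)
  next
    case 9
    have tn: "tnode z = 1" using 9 n3 by (simp add: tnode_def)
    have t: "term4 z j y = (if j = 1 then y\<^sup>2 - 2 * y - od y else y\<^sup>2 + od y)" for j y
      using 9 term4_leaf(4) by simp
    define r :: nat where "r = 2"
    have t': "term4 r j y = (if j \<le> 2 then 2 * y\<^sup>2 - 2 * y else 2 * y\<^sup>2 + 2 * od y)" for j y
      using n3 term4_up[of 2] by (simp add: r_def)
    have e: "(\<Sum>j=1..n. ?F j) = (\<Sum>j=1..n. T r j)"
      by (rule mid) (use tn n3 in \<open>auto simp: t[simplified] t' T_def power2_eq_square algebra_simps numeral_2_eq_2\<close>)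
    have p: "tpar z = r" using 9 tpar_leaf(4) by (simp only: r_def)
    have r: "r \<noteq> 0" using n3 by (simp add: r_def)
    have c: "{y \<in> VV. y \<noteq> 0 \<and> tpar y = z} = {}"
      by (rule tree_children_cases(4)) (use 9 in simp)
    show ?thesis by (rule fin[OF p r c refl]) (use e in \<open>simp only: sum.empty add_0_right\<close>)
  qed
qed

text \<open>At all vertices but \<open>1\<close> and \<open>2 * n + 1\<close> each term is divisible
  by 4 by itself. At these two a parity enters with the positive sign, and what is missing is twice
  the number of odd coordinates, which is even in the coroot lattice.\<close>

lemma mult4_dvd:
  assumes z: "z \<in> VV" and x: "x \<in> coroot_lattice n"
  shows "4 dvd mult4 z x"
proof (cases "z = 0")
  case False
  have "even (\<Sum>j=1..n. x j)" using x n3 by (simp add: coroot_lattice_iff)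
  moreover have "even (\<Sum>j=1..n. x j - od (x j))" by (intro dvd_sum dvd_od)
  ultimately have "even (\<Sum>j=1..n. od (x j))" by (simp add: sum_subtractf)
  then have o: "4 dvd 2 * (\<Sum>j=1..n. od (x j))"
    using mult_dvd_mono[OF dvd_refl[of "2::int"]] by fastforce
  have q: "4 dvd (\<Sum>j=1..n. (x j)\<^sup>2 - od (x j))" by (intro dvd_sum dvd_od)
  have eq1: "(\<Sum>j=1..n. (x j)\<^sup>2 + od (x j)) = (\<Sum>j=1..n. (x j)\<^sup>2 - od (x j)) + 2 * (\<Sum>j=1..n. od (x j))"
    by (simp add: sum.distrib sum_subtractf)
  have "4 dvd (\<Sum>j=1..n. term4 z j (x j))"
  proof (cases "z = 1 \<or> z = 2 * n + 1")
    case True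
    then show ?thesis
    proof
      assume "z = 1"
      then show ?thesis using o q eq1 by (simp add: term4_def)
    next
      assume z: "z = 2 * n + 1"
      have "(\<Sum>j=1..n. term4 z j (x j)) = (\<Sum>j=1..n. (x j)\<^sup>2 + od (x j))
          + (term4 z 1 (x 1) - ((x 1)\<^sup>2 + od (x 1)))"
        by (rule sum_local1) (use z n3 in \<open>auto simp: term4_def\<close>)
      also have "term4 z 1 (x 1) - ((x 1)\<^sup>2 + od (x 1)) = - 2 * (x 1 - od (x 1)) - 4 * od (x 1)"
        using z n3 by (simp add: term4_def)
      finally have e: "(\<Sum>j=1..n. term4 z j (x j)) = (\<Sum>j=1..n. (x j)\<^sup>2 - od (x j))
          + 2 * (\<Sum>j=1..n. od (x j)) - 2 * (x 1 - od (x 1)) - 4 * od (x 1)"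
        unfolding eq1 by simp
      have "4 dvd 2 * (x 1 - od (x 1))"
        using mult_dvd_mono[OF dvd_refl[of "2::int"] dvd_od(1)[of "x 1"]] by simp
      then show ?thesis unfolding e using o q by (intro dvd_diff dvd_add) auto
    qed
  next
    case False
    have "4 dvd term4 z j y" for j y
    proof -
      have "2 * y\<^sup>2 - 2 * od y = 2 * (y\<^sup>2 - od y)" "2 * y\<^sup>2 + 2 * od y = 2 * (y\<^sup>2 - od y) + 4 * od y"
        "y\<^sup>2 - 2 * y + od y = (y\<^sup>2 - od y) - 2 * (y - od y)"
        by simp_all
      moreover have "4 dvd 2 * (y - od y)"
        using mult_dvd_mono[OF dvd_refl[of "2::int"] dvd_od(1)[of y]] by simp
      ultimately have "4 dvd 2 * y\<^sup>2 - 2 * od y" "4 dvd 2 * y\<^sup>2 + 2 * od y" "4 dvd y\<^sup>2 - 2 * y + od y"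
        using dvd_od(2)[of y] by (metis dvd_add dvd_diff dvd_mult dvd_triv_left)+
      then show ?thesis using False \<open>z \<noteq> 0\<close> dvd_od(2,3)[of y] by (auto simp: term4_def)
    qed
    then show ?thesis by (intro dvd_sum) auto
  qed
  then show ?thesis using False by (simp add: mult4_def)
qed (simp add: mult4_def)

text \<open>Depending on the translation part alone, this is a function on cosets of the finite Weyl
  group.\<close>

definition multz :: "nat \<Rightarrow> vec \<times> (vec \<Rightarrow> vec) \<Rightarrow> int" where
  "multz z g = mult4 z (fst g) div 4"

lemma multz4: "z \<in> VV \<Longrightarrow> g \<in> carrier GG \<Longrightarrow> 4 * multz z g = mult4 z (fst g)"
  using mult4_dvd by (simp add: multz_def carrier_GG)

lemma tree_module: "cell_tree_module GG SS PP VV 0 (\<lambda>z. sref n (tnode z)) tpar tdep multz"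
proof -
  interpret cell_tree GG SS PP VV 0 "\<lambda>z. sref n (tnode z)" tpar tdep by (rule tree)
  show ?thesis
  proof
    fix z assume z: "z \<in> VV"
    show "multz z \<one>\<^bsub>GG\<^esub> = (if z = 0 then 1 else 0)"
    proof -
      have "term4 z j 0 = 0" for j by (simp add: term4_def)
      then show ?thesis by (simp add: multz_def one_GG mult4_def)
    qed
    fix g assume g: "g \<in> carrier GG"
    {
      fix s assume "s \<in> SS" and nz: "z = 0 \<or> sref n (tnode z) \<noteq> s"
      then obtain i where i: "i \<le> n" "s = sref n i" using SS_sref by auto
      show "multz z (s \<otimes>\<^bsub>GG\<^esub> g) = multz z g"
      proof (cases "z = 0")
        case True
        then show ?thesis by (simp add: multz_def mult4_def)
      next
        case False
        then have "tnode z \<noteq> i" using nz i by blast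
        then show ?thesis
          using mult4_fixed[OF z False i(1)] fst_sref_mult[OF i(1), of g] i by (simp add: multz_def)
      qed
    }
    assume z0: "z \<noteq> 0"
    have s: "tnode z \<le> n" "sref n (tnode z) \<otimes>\<^bsub>GG\<^esub> g \<in> carrier GG"
      using tnode_le[OF z] sref_carrier g by auto
    have "4 * (multz z (sref n (tnode z) \<otimes>\<^bsub>GG\<^esub> g) + multz z g)
        = mult4 z (smap 1 n (tnode z) (fst g)) + mult4 z (fst g)"
      using multz4[OF z s(2)] multz4[OF z g] fst_sref_mult[OF s(1), of g] by simp
    also have "\<dots> = mult4 (tpar z) (fst g) + (\<Sum>y\<in>children z. mult4 y (fst g))"
      by (rule mult4_moved[OF z z0])
    also have "(\<Sum>y\<in>children z. mult4 y (fst g)) = (\<Sum>y\<in>children z. 4 * multz y g)"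
      by (rule sum.cong) (auto simp: multz4[OF _ g])
    also have "mult4 (tpar z) (fst g) = 4 * multz (tpar z) g"
      using multz4[OF par_V[OF z z0] g] by simp
    finally show "multz z (sref n (tnode z) \<otimes>\<^bsub>GG\<^esub> g) + multz z g
        = multz (tpar z) g + (\<Sum>y\<in>children z. multz y g)"
      by (simp add: sum_distrib_left[symmetric])
  qed
qed

sublocale cell: cell_tree_module GG SS PP VV 0 "\<lambda>z. sref n (tnode z)" tpar tdep multz
  by (rule tree_module)

text \<open>The translation part of \<open>el z\<close>, obtained by moving 0 along the tree. The
  far end \<open>2 * n - 1\<close> of the path is the coset of twice the first basis vector.\<close>

definition vertex :: "nat \<Rightarrow> vec" where
  "vertex z = (if z = 0 then 0 else if z = 1 then eps 1 + eps 2 else if z = 2 * n - 1 then zscale 2 (eps 1)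
    else if z = 2 * n then - eps 1 + eps 2 else if z = 2 * n + 1 then eps 2 + eps 3
    else if z < n then eps 1 + eps (z + 1) else if z = n then eps 1 - eps n else eps 1 - eps (2 * n - z))"

lemma vertex_leaf:
  "vertex 0 = 0" "vertex 1 = eps 1 + eps 2" "vertex (2 * n - 1) = zscale 2 (eps 1)"
  "vertex (2 * n) = - eps 1 + eps 2" "vertex (2 * n + 1) = eps 2 + eps 3"
  using n3 by (auto simp: vertex_def)

lemma vertex_up: "2 \<le> i \<Longrightarrow> i < n \<Longrightarrow> vertex i = eps 1 + eps (i + 1)"
  using n3 by (auto simp: vertex_def)

lemma vertex_down:
  assumes "2 \<le> i" "i \<le> n"
  shows "vertex (2 * n - i) = eps 1 - eps i"
proof -
  have "2 * n - i \<noteq> 0" "2 * n - i \<noteq> 1" "2 * n - i \<noteq> 2 * n - 1" "2 * n - i \<noteq> 2 * n"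
    "2 * n - i \<noteq> 2 * n + 1" "\<not> 2 * n - i < n" "2 * n - (2 * n - i) = i"
    and "2 * n - i = n \<longleftrightarrow> i = n"
    using assms n3 by arith+
  then show ?thesis unfolding vertex_def by (cases "i = n") (simp_all only: if_False if_True if_cancel)
qed

lemma vertex_step:
  assumes "z \<in> VV" "z \<noteq> 0"
  shows "vertex z = smap 1 n (tnode z) (vertex (tpar z))"
  using assms
proof (cases rule: tree_cases)
  case 1
  show ?thesis unfolding 1(2,3) vertex_leaf(1) unfolding 1(1) vertex_leaf(2)
    by (auto simp: fun_eq_iff smap_def eps_def)
next
  case 2
  have v: "vertex 2 = eps 1 + eps 3" using vertex_up[of 2] n3 by simp
  show ?thesis unfolding 2(2,3) vertex_leaf(2) unfolding 2(1) v
    using n3 by (auto simp: fun_eq_iff smap_def eps_def)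
next
  case 3
  have v: "vertex z = eps 1 + eps (z + 1)" "vertex (z - 1) = eps 1 + eps z"
    using vertex_up[of z] vertex_up[of "z - 1"] 3(1,2) by simp_all
  show ?thesis unfolding 3(3,4) v
    using 3(1,2) by (auto simp: fun_eq_iff smap_def eps_def)
next
  case 4
  have v: "vertex n = eps 1 - eps n" "vertex (n - 1) = eps 1 + eps n"
    using vertex_up[of "n - 1"] vertex_down[of n] n3 by simp_all
  show ?thesis unfolding 4(2,3) unfolding 4(1) v
    using n3 by (auto simp: fun_eq_iff smap_def eps_def)
next
  case (5 i)
  have v: "vertex z = eps 1 - eps i" "vertex (tpar z) = eps 1 - eps (i + 1)"
    unfolding 5(5) unfolding 5(3) using vertex_down[of i] vertex_down[of "i + 1"] 5(1,2) by simp_all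
  show ?thesis unfolding v 5(4)
    using 5(1,2) by (auto simp: fun_eq_iff smap_def eps_def)
next
  case 6
  have v: "vertex (tpar z) = eps 1 - eps 2" unfolding 6(3) using vertex_down[of 2] n3 by simp
  show ?thesis unfolding 6(2) v unfolding 6(1) vertex_leaf(3)
    by (auto simp: fun_eq_iff smap_def eps_def zscale_def)
next
  case 7
  have v: "vertex (tpar z) = eps 1 - eps 2" unfolding 7(3) using vertex_down[of 2] n3 by simp
  show ?thesis unfolding 7(2) v unfolding 7(1) vertex_leaf(4)
    using n3 by (auto simp: fun_eq_iff smap_def eps_def)
next
  case 8
  have v: "vertex (tpar z) = eps 1 + eps 3" unfolding 8(3) using vertex_up[of 2] n3 by simp
  show ?thesis unfolding 8(2) v unfolding 8(1) vertex_leaf(5)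
    using n3 by (auto simp: fun_eq_iff smap_def eps_def)
qed

lemma fst_el: "z \<in> VV \<Longrightarrow> fst (cell.el z) = vertex z"
proof (induction "tdep z" arbitrary: z)
  case 0
  then have "z = 0" using n3 by (auto simp: tdep_def split: if_splits)
  then show ?case by (simp add: vertex_def one_GG)
next
  case (Suc k)
  have z: "z \<noteq> 0"
  proof
    assume "z = 0"
    then show False using Suc(2) n3 by (simp add: tdep_def)
  qed
  then show ?case
    using Suc cell.par_V cell.dep_par cell.el_par fst_sref_mult tnode_le vertex_step by simp
qed

section \<open>Shortest coset representatives\<close>

lemma coset_iff: "u \<in> transl \<gamma> <#\<^bsub>GG\<^esub> ({0} \<times> weyl n) \<longleftrightarrow> fst u = \<gamma> \<and> snd u \<in> weyl n"
proof -
  have "u \<in> transl \<gamma> <#\<^bsub>GG\<^esub> ({0} \<times> weyl n) \<longleftrightarrow> (\<exists>w\<in>weyl n. u = (\<gamma>, w))"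
    by (auto simp: l_coset_def transl_def mult_GG)
  then show ?thesis by (cases u) auto
qed

lemma min_rep:
  shows "fst (min_rep n \<gamma>) = \<gamma>"
    and "\<gamma> \<in> coroot_lattice n \<Longrightarrow> min_rep n \<gamma> \<in> carrier GG"
    and "u \<in> carrier GG \<Longrightarrow> fst u = \<gamma> \<Longrightarrow> len (min_rep n \<gamma>) \<le> len u"
proof -
  let ?P = "\<lambda>u. u \<in> transl \<gamma> <#\<^bsub>GG\<^esub> ({0} \<times> weyl n)"
  have "?P (\<gamma>, id)" by (simp add: coset_iff weyl_id)
  from arg_min_natI[of ?P, OF this, of len] have "?P (min_rep n \<gamma>)" by (simp add: min_rep_def)
  then show "fst (min_rep n \<gamma>) = \<gamma>" "\<gamma> \<in> coroot_lattice n \<Longrightarrow> min_rep n \<gamma> \<in> carrier GG"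
    by (simp_all add: coset_iff carrier_GG)
  show "len (min_rep n \<gamma>) \<le> len u" if "u \<in> carrier GG" "fst u = \<gamma>"
    unfolding min_rep_def by (rule arg_min_nat_le) (use that in \<open>simp add: coset_iff carrier_GG\<close>)
qed

text \<open>
  Since the multiplicities depend only on the coset, the one at the shortest element \<open>v\<close> of the coset
  of \<open>el z\<close> is \<open>1\<close>; hence \<open>el z \<preceq> v\<close>.
\<close>

lemma min_rep_vertex:
  assumes z: "z \<in> VV"
  shows "min_rep n (vertex z) = cell.el z"
proof -
  have e: "cell.el z \<in> carrier GG" using z by simp
  have v: "vertex z \<in> coroot_lattice n" using e fst_el[OF z] carrier_GG by metis
  let ?v = "min_rep n (vertex z)"
  have vc: "?v \<in> carrier GG" using min_rep(2) v by blast
  have "inv_KL GG SS (cell.el z) ?v = inv_KL GG SS (cell.el z) (cell.el z)"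
    using cell.inv_KL_el[OF z vc] cell.inv_KL_el[OF z e] min_rep(1) fst_el[OF z] by (simp add: multz_def)
  then have "ble (cell.el z) ?v"
    using inv_KL_self[OF e] inv_KL_spec(1)[OF vc, of "cell.el z"] by (cases "ble (cell.el z) ?v") auto
  then show ?thesis using ble_len min_rep(3)[OF e fst_el[OF z]] by fastforce
qed

lemma m_coeff_vertex:
  assumes z: "z \<in> VV" and g: "\<gamma> \<in> coroot_lattice n"
  shows "4 * m_coeff n (vertex z) \<gamma> = mult4 z \<gamma>"
  using cell.inv_KL_el[OF z min_rep(2)[OF g]] multz4[OF z min_rep(2)[OF g]] min_rep(1)
  by (simp add: m_coeff_def min_rep_vertex[OF z])

end

section \<open>The multiplicities\<close>

text \<open>Every square of a coefficient arises from two neighbouring differences except the last;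
  the last coordinate \<open>2 * b - a (n - 1)\<close> supplies the missing one when this is used in
  \<open>coordinate_square\<close>.\<close>

lemma square_length_sum:
  fixes a :: "nat \<Rightarrow> int"
  assumes "1 \<le> m" "a 0 = 0"
  shows "(\<Sum>k=1..m. (a k - a (k - 1))\<^sup>2)
    = 2 * (\<Sum>k=1..m. (a k)\<^sup>2) - (a m)\<^sup>2 - 2 * (\<Sum>k=1..m-1. a k * a (k + 1))"
  using assms(1)
proof (induction m rule: dec_induct)
  case base
  then show ?case using assms(2) by simp
next
  case (step m)
  have "(\<Sum>k=1..m. a k * a (k + 1)) = (\<Sum>k=1..m-1. a k * a (k + 1)) + a m * a (m + 1)"
    using step(1) by (cases m) auto
  then show ?case using step by (simp add: power2_eq_square algebra_simps)
qed

context
  fixes n :: nat and a :: "nat \<Rightarrow> int" and b :: int and \<gamma> :: vec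
  assumes n: "3 \<le> n" and \<gamma>: "\<gamma> = lattice_elt n a b" and a0: "a 0 = 0" and an: "a n = 0"
begin

section \<open>Coordinates in terms of the lattice coefficients\<close>

lemma coordinate: "1 \<le> k \<Longrightarrow> k \<le> n \<Longrightarrow> \<gamma> k = (if k = n then 2 * b - a (n - 1) else a k - a (k - 1))"
  using n a0 by (cases "k = 1") (auto simp: \<gamma> lattice_elt_apply)

lemma coordinate_sum: "i \<le> n - 1 \<Longrightarrow> (\<Sum>k=1..i. \<gamma> k) = a i"
  by (induction i) (use n a0 in \<open>auto simp: coordinate\<close>)

lemma coordinate_sum_total: "(\<Sum>k=1..n. \<gamma> k) = 2 * b"
proof -
  have "(\<Sum>k=1..n. \<gamma> k) = (\<Sum>k=1..n-1. \<gamma> k) + \<gamma> n" using n by (cases n) auto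
  then show ?thesis using coordinate_sum[of "n - 1"] coordinate[of n] n by simp
qed

lemma coordinate_square: "(\<Sum>k=1..n. (\<gamma> k)\<^sup>2) = 2 * square_length n a b"
proof -
  have "(\<Sum>k=1..n. (\<gamma> k)\<^sup>2) = (\<Sum>k=1..n-1. (\<gamma> k)\<^sup>2) + (\<gamma> n)\<^sup>2" using n by (cases n) auto
  also have "(\<Sum>k=1..n-1. (\<gamma> k)\<^sup>2) = (\<Sum>k=1..n-1. (a k - a (k - 1))\<^sup>2)"
    by (rule sum.cong) (use n in \<open>auto simp: coordinate\<close>)
  also have "\<dots> = 2 * (\<Sum>k=1..n-1. (a k)\<^sup>2) - (a (n - 1))\<^sup>2 - 2 * (\<Sum>k=1..n-2. a k * a (k + 1))"
    using square_length_sum[of "n - 1" a] n a0 by (simp add: numeral_2_eq_2)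
  also have "\<gamma> n = 2 * b - a (n - 1)" using coordinate[of n] n by simp
  finally show ?thesis by (simp add: square_length_def power2_eq_square algebra_simps)
qed

text \<open>A coordinate is a difference of consecutive coefficients modulo 2, so it is odd exactly
  at a parity change; \<open>a n = 0\<close> makes the last coordinate follow the same rule.\<close>

lemma parity_changes_sum:
  assumes "1 \<le> l"
  shows "int (parity_changes n a l) = (\<Sum>k=l..n. od (\<gamma> k))"
proof -
  have "od (\<gamma> k) = (if a (k - 1) mod 2 \<noteq> a k mod 2 then 1 else 0)" if "k \<in> {l..n}" for k
  proof -
    have c: "\<gamma> k = (if k = n then 2 * b - a (n - 1) else a k - a (k - 1))"
      using coordinate that assms by simp
    show ?thesis
    proof (cases "k = n")
      case True
      then show ?thesis using c an unfolding od_def by simp presburger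
    next
      case False
      then show ?thesis using c unfolding od_def by simp presburger
    qed
  qed
  then have "(\<Sum>k=l..n. od (\<gamma> k)) = (\<Sum>k=l..n. if a (k - 1) mod 2 \<noteq> a k mod 2 then 1 else 0)"
    by (intro sum.cong) auto
  also have "\<dots> = int (card {k \<in> {l..n}. a (k - 1) mod 2 \<noteq> a k mod 2})"
    by (simp add: sum.If_cases Int_def)
  also have "{k \<in> {l..n}. a (k - 1) mod 2 \<noteq> a k mod 2} = {j. l \<le> j \<and> j \<le> n \<and> a (j - 1) mod 2 \<noteq> a j mod 2}"
    by auto
  finally show ?thesis by (simp add: parity_changes_def)
qed

lemma split_sum: "i \<le> n \<Longrightarrow> (\<Sum>k=1..n. F k) = (\<Sum>k=1..i. F k) + (\<Sum>k=i+1..n. F k)" for F :: "nat \<Rightarrow> int"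
  using sum.ub_add_nat[of 1 i F "n - i"] by simp

interpretation affine_B n
  by unfold_locales (rule n)

lemma \<gamma>_lattice: "\<gamma> \<in> coroot_lattice n"
  unfolding coroot_lattice_def \<gamma> by blast

section \<open>Closed formulas at the vertices\<close>

lemma mult4_first: "mult4 1 \<gamma> = 2 * square_length n a b + parity_changes n a 1"
  by (simp add: mult4_def term4_leaf sum.distrib parity_changes_sum coordinate_square[symmetric])

lemma mult4_up:
  assumes "2 \<le> i" "i < n"
  shows "mult4 i \<gamma> = 4 * square_length n a b - 2 * a i + 2 * parity_changes n a (i + 1)"
proof -
  have "mult4 i \<gamma> = (\<Sum>k=1..i. 2 * (\<gamma> k)\<^sup>2 - 2 * \<gamma> k) + (\<Sum>k=i+1..n. 2 * (\<gamma> k)\<^sup>2 + 2 * od (\<gamma> k))"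
    using assms split_sum[of i "\<lambda>k. term4 i k (\<gamma> k)"] by (simp add: mult4_def term4_up)
  also have "\<dots> = 2 * (\<Sum>k=1..n. (\<gamma> k)\<^sup>2) - 2 * (\<Sum>k=1..i. \<gamma> k) + 2 * (\<Sum>k=i+1..n. od (\<gamma> k))"
    using split_sum[of i "\<lambda>k. (\<gamma> k)\<^sup>2"] assms
    by (simp add: sum.distrib sum_subtractf distrib_left flip: sum_distrib_left)
  finally show ?thesis
    using coordinate_square coordinate_sum[of i] parity_changes_sum[of "i + 1"] assms by simp
qed

lemma mult4_middle: "mult4 n \<gamma> = 4 * square_length n a b - 4 * b"
proof -
  have "mult4 n \<gamma> = (\<Sum>k=1..n. 2 * (\<gamma> k)\<^sup>2 - 2 * \<gamma> k)"
    using n by (simp add: mult4_def term4_up)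
  also have "\<dots> = 2 * (\<Sum>k=1..n. (\<gamma> k)\<^sup>2) - 2 * (\<Sum>k=1..n. \<gamma> k)"
    by (simp add: sum_subtractf sum_distrib_left)
  finally show ?thesis using coordinate_square coordinate_sum_total by simp
qed

lemma mult4_down:
  assumes "2 \<le> i" "i < n"
  shows "mult4 (2 * n - i) \<gamma> = 4 * square_length n a b - 2 * a i - 2 * parity_changes n a (i + 1)"
proof -
  have "mult4 (2 * n - i) \<gamma> = (\<Sum>k=1..i. 2 * (\<gamma> k)\<^sup>2 - 2 * \<gamma> k) + (\<Sum>k=i+1..n. 2 * (\<gamma> k)\<^sup>2 - 2 * od (\<gamma> k))"
    using assms split_sum[of i "\<lambda>k. term4 (2 * n - i) k (\<gamma> k)"] by (simp add: mult4_def term4_down)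
  also have "\<dots> = 2 * (\<Sum>k=1..n. (\<gamma> k)\<^sup>2) - 2 * (\<Sum>k=1..i. \<gamma> k) - 2 * (\<Sum>k=i+1..n. od (\<gamma> k))"
    using split_sum[of i "\<lambda>k. (\<gamma> k)\<^sup>2"] assms
    by (simp add: sum.distrib sum_subtractf distrib_left flip: sum_distrib_left)
  finally show ?thesis
    using coordinate_square coordinate_sum[of i] parity_changes_sum[of "i + 1"] assms by simp
qed

lemma square_minus_od: "(\<Sum>k=1..n. (\<gamma> k)\<^sup>2 - od (\<gamma> k)) = 2 * square_length n a b - parity_changes n a 1"
  by (simp add: sum_subtractf parity_changes_sum coordinate_square[symmetric])

lemma square_plus_od: "(\<Sum>k=1..n. (\<gamma> k)\<^sup>2 + od (\<gamma> k)) = 2 * square_length n a b + parity_changes n a 1"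
  by (simp add: sum.distrib parity_changes_sum coordinate_square[symmetric])

lemma mult4_last: "mult4 (2 * n - 1) \<gamma> = 2 * square_length n a b - parity_changes n a 1"
  using n square_minus_od by (simp add: mult4_def term4_leaf[simplified])

lemma coordinate_1: "\<gamma> 1 = a 1"
  using coordinate[of 1] n a0 by simp

text \<open>The terms differ from those of the far end of the path in the first coordinate only, by
  -2 times \<open>a 1\<close> plus twice its parity, which is -4 times the floor of its half. At the
  other leaf, \<open>mult4_leaf_first\<close>, the parity enters with the opposite sign and yields
  the ceiling.\<close>

lemma mult4_leaf_last: "mult4 (2 * n) \<gamma> = 2 * square_length n a b - 4 * (a 1 div 2) - parity_changes n a 1"
proof -
  have "(\<Sum>k=1..n. term4 (2 * n) k (\<gamma> k)) = (\<Sum>k=1..n. (\<gamma> k)\<^sup>2 - od (\<gamma> k))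
      + (term4 (2 * n) 1 (\<gamma> 1) - ((\<gamma> 1)\<^sup>2 - od (\<gamma> 1)))"
    by (rule sum_local1) (use n in \<open>auto simp: term4_leaf term4_leaf(4)[simplified]\<close>)
  also have "term4 (2 * n) 1 (\<gamma> 1) - ((\<gamma> 1)\<^sup>2 - od (\<gamma> 1)) = - 4 * (a 1 div 2)"
    using n minus_mod_eq_mult_div[of "a 1" 2] unfolding coordinate_1 by (simp add: term4_leaf od_def)
  finally show ?thesis using n square_minus_od by (simp add: mult4_def)
qed

lemma mult4_leaf_first:
  "mult4 (2 * n + 1) \<gamma> = 2 * square_length n a b - 4 * ((a 1 + 1) div 2) + parity_changes n a 1"
proof -
  have "(\<Sum>k=1..n. term4 (2 * n + 1) k (\<gamma> k)) = (\<Sum>k=1..n. (\<gamma> k)\<^sup>2 + od (\<gamma> k))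
      + (term4 (2 * n + 1) 1 (\<gamma> 1) - ((\<gamma> 1)\<^sup>2 + od (\<gamma> 1)))"
    by (rule sum_local1) (use n in \<open>auto simp: term4_leaf term4_leaf(4)[simplified]\<close>)
  also have "term4 (2 * n + 1) 1 (\<gamma> 1) - ((\<gamma> 1)\<^sup>2 + od (\<gamma> 1)) = - 2 * a 1 - 2 * (a 1 mod 2)"
    using n unfolding coordinate_1 by (simp add: term4_leaf(4)[simplified] od_def)
  also have "\<dots> = - 4 * ((a 1 + 1) div 2)" by presburger
  finally show ?thesis using n square_plus_od by (simp add: mult4_def)
qed

lemma multiplicities:
  "4 * m_coeff n (eps 1 + eps 2) \<gamma> = 2 * square_length n a b + parity_changes n a 1"
  "2 \<le> i \<Longrightarrow> i < n \<Longrightarrow> 4 * m_coeff n (eps 1 + eps (i + 1)) \<gamma>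
     = 4 * square_length n a b - 2 * a i + 2 * parity_changes n a (i + 1)"
  "4 * m_coeff n (eps 1 - eps n) \<gamma> = 4 * square_length n a b - 4 * b"
  "2 \<le> i \<Longrightarrow> i < n \<Longrightarrow> 4 * m_coeff n (eps 1 - eps i) \<gamma>
     = 4 * square_length n a b - 2 * a i - 2 * parity_changes n a (i + 1)"
  "4 * m_coeff n (zscale 2 (eps 1)) \<gamma> = 2 * square_length n a b - parity_changes n a 1"
  "4 * m_coeff n (eps 2 + eps 3) \<gamma>
     = 2 * square_length n a b - 4 * ((a 1 + 1) div 2) + parity_changes n a 1"
  "4 * m_coeff n (- eps 1 + eps 2) \<gamma>
     = 2 * square_length n a b - 4 * (a 1 div 2) - parity_changes n a 1"
proof -
  note m = m_coeff_vertex[OF _ \<gamma>_lattice]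
  show "4 * m_coeff n (eps 1 + eps 2) \<gamma> = 2 * square_length n a b + parity_changes n a 1"
    using m[of 1] unfolding vertex_leaf mult4_first by simp
  show "4 * m_coeff n (eps 1 + eps (i + 1)) \<gamma>
     = 4 * square_length n a b - 2 * a i + 2 * parity_changes n a (i + 1)" if "2 \<le> i" "i < n"
    using m[of i] that unfolding vertex_up[OF that] mult4_up[OF that] by simp
  have "2 * n - n = n" by simp
  then have "vertex n = eps 1 - eps n" using vertex_down[of n] n by simp
  then show "4 * m_coeff n (eps 1 - eps n) \<gamma> = 4 * square_length n a b - 4 * b"
    using m[of n] mult4_middle by simp
  show "4 * m_coeff n (eps 1 - eps i) \<gamma>
     = 4 * square_length n a b - 2 * a i - 2 * parity_changes n a (i + 1)" if "2 \<le> i" "i < n"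
    using m[of "2 * n - i"] that unfolding mult4_down[OF that] vertex_down[OF that(1) less_imp_le[OF that(2)]]
    by simp
  show "4 * m_coeff n (zscale 2 (eps 1)) \<gamma> = 2 * square_length n a b - parity_changes n a 1"
    using m[of "2 * n - 1"] unfolding vertex_leaf mult4_last by simp
  show "4 * m_coeff n (eps 2 + eps 3) \<gamma>
     = 2 * square_length n a b - 4 * ((a 1 + 1) div 2) + parity_changes n a 1"
    using m[of "2 * n + 1"] unfolding vertex_leaf mult4_leaf_first by simp
  show "4 * m_coeff n (- eps 1 + eps 2) \<gamma>
     = 2 * square_length n a b - 4 * (a 1 div 2) - parity_changes n a 1"
    using m[of "2 * n"] unfolding vertex_leaf mult4_leaf_last by simp
qed

end

theorem theorem7p4:
  fixes n :: nat and a :: "nat \<Rightarrow> int" and b :: int and \<gamma> :: vec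
  assumes "n \<ge> 3"
    and "\<gamma> = lattice_elt n a b"
    and "a 0 = 0" and "a n = 0"
  shows
    "(real_of_int (m_coeff n (eps 1 + eps 2) \<gamma>)
       = square_length n a b / 2 + parity_changes n a 1 / 4)
     \<and> (\<forall>i\<in>{2..n-1}. real_of_int (m_coeff n (eps 1 + eps (i + 1)) \<gamma>)
       = square_length n a b - a i / 2 + parity_changes n a (i + 1) / 2)
     \<and> (real_of_int (m_coeff n (eps 1 - eps n) \<gamma>)
       = square_length n a b - b)
     \<and> (\<forall>i\<in>{2..n-1}. real_of_int (m_coeff n (eps 1 - eps i) \<gamma>)
       = square_length n a b - a i / 2 - parity_changes n a (i + 1) / 2)
     \<and> (real_of_int (m_coeff n (zscale 2 (eps 1)) \<gamma>)
       = square_length n a b / 2 - parity_changes n a 1 / 4)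
     \<and> (real_of_int (m_coeff n (eps 2 + eps 3) \<gamma>)
       = square_length n a b / 2 - \<lceil>a 1 / 2\<rceil> + parity_changes n a 1 / 4)
     \<and> (real_of_int (m_coeff n (- eps 1 + eps 2) \<gamma>)
       = square_length n a b / 2 - \<lfloor>a 1 / 2\<rfloor> - parity_changes n a 1 / 4)"
proof -
  have q: "real_of_int M = real_of_int N / 4" if "4 * M = N" for M N
    using that by auto
  note m = q[OF multiplicities(1)[OF assms]] q[OF multiplicities(2)[OF assms]] q[OF multiplicities(3)[OF assms]]
    q[OF multiplicities(4)[OF assms]] q[OF multiplicities(5)[OF assms]] q[OF multiplicities(6)[OF assms]]
    q[OF multiplicities(7)[OF assms]]
  have fl: "\<lfloor>a 1 / 2\<rfloor> = a 1 div 2"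
    using floor_divide_of_int_eq[of "a 1" 2, where ?'a = real] by simp
  have "\<lceil>a 1 / 2\<rceil> = - ((- a 1) div 2)"
    using floor_divide_of_int_eq[of "- a 1" 2, where ?'a = real] by (simp add: ceiling_def)
  then have ce: "\<lceil>a 1 / 2\<rceil> = (a 1 + 1) div 2" by presburger
  have r: "2 \<le> i" "i < n" if "i \<in> {2..n-1}" for i using that assms(1) by auto
  show ?thesis
    unfolding fl ce m(1,3,5,6,7)
    by (intro conjI ballI; (subst m(2)[OF r] m(4)[OF r])?; simp add: add_divide_distrib diff_divide_distrib)
qed

end
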